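(* Let $R$ be a totally ordered set and let $C$ and $C'$ be chain complexes of persistence modules of finite type indexed by $R$, with given interval decompositions $C_n\cong\bigoplus_{j\in J_n}\mathbb{I}\lceil b_{n,j},d_{n,j}\rfloor$ and $C'_n\cong\bigoplus_{j\in J'_n}\mathbb{I}\lceil b'_{n,j},d'_{n,j}\rfloor$ ($J_n,J'_n$ finite), and boundary maps represented by matrices $\partial_n$ and $\partial'_n$. Fix $n$. Let $Z_n=\ker\partial_n$, with the interval decomposition and the invertible matrix $\widetilde T_n$ representing the inclusion $Z_n\hookrightarrow C_n$ given by the kernel procedure (described in the context) applied to $\partial_n$. Then $\widetilde M_{n+1}=(\widetilde T_n)^{-1}\partial_{n+1}$ represents the boundary map with restricted codomain $C_{n+1}\to Z_n$; and the cokernel procedure (described in the context) applied to $\widetilde M_{n+1}$ gives an interval decomposition of the homology $H_n=Z_n/\operatorname{im}\partial_{n+1}$ and an invertible matrix $\widetilde S_n$ representing the quotient map $Z_n\to H_n$. Furthermore, let $C\to C'$ be a map of chain complexes with $C_n\to C'_n$ represented by a matrix $X_n$, and let $\widetilde T'_n,\widetilde S'_n$ be the analogous matrices for $C'$. Then $(\widetilde T'_n)^{-1}X_n\widetilde T_n$ represents the induced map on cycles $Z_n\to Z'_n$, and $\widetilde S'_n(\widetilde T'_n)^{-1}X_n\widetilde T_n(\widetilde S_n)^{-1}$ represents the induced map on homology $H_n\to H'_n$.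
   Context: Fix a field $F$; all vector spaces are over $F$. A persistence module indexed by $R$ is a functor from the poset $R$ to vector spaces; morphisms are natural transformations; direct sums, images, kernels, cokernels are pointwise. A cut of $R$ is a pair $c=(c^\downarrow,c^\uparrow)$ of (possibly empty) subsets with $c^\downarrow\cup c^\uparrow=R$ and $r_1<r_2$ for all $r_1\in c^\downarrow$, $r_2\in c^\uparrow$; cuts are ordered by inclusion of $c^\downarrow$. For cuts $b\le d$, $\lceil b,d\rfloor=b^\uparrow\cap d^\downarrow$. The interval module $\mathbb{I}\lceil b,d\rfloor$ is $F$ at $t\in\lceil b,d\rfloor$ and $0$ elsewhere, with identity structure maps inside the interval and zero maps otherwise. Empty bars $b=d$ (zero modules) are allowed in decompositions. Finite type means isomorphic to a finite direct sum of interval modules. Matrix representation: with respect to finite interval decompositions $A\cong\bigoplus_{j\in J}\mathbb{I}\lceil a'_j,c'_j\rfloor$ and $B\cong\bigoplus_{i\in I}\mathbb{I}\lceil a_i,c_i\rfloor$, a matrix $X=\{x_{i,j}\}$ over $F$ represents a morphism $\varphi\colon A\to B$ if $x_{i,j}=0$ whenever $a_i>a'_j$ or $c_i>c'_j$, and for all $i,j$ and all $t\in\lceil a_i,c_i\rfloor\cap\lceil a'_j,c'_j\rfloor$ the composite $\mathbb{I}\lceil a'_j,c'_j\rfloor_t\to A_t\xrightarrow{\varphi_t}B_t\to\mathbb{I}\lceil a_i,c_i\rfloor_t$ is multiplication by $x_{i,j}$. Position $i,j$ is nontrivial if $a'_j<c_i$. Ordered column reduction of a matrix with ordered rows and columns: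 process columns from least to greatest; if the current column is zero, move on; otherwise its first (least-row) nonzero entry is its pivot, and multiples of the current column are added to each greater column to make the entry in the pivot's row zero. Ordered row reduction interchanges rows and columns. Both produce the same pivot positions. For the two procedures, let $X$ represent $\varphi\colon U=\bigoplus_{j\in J}\mathbb{I}\lceil \beta'_j,\delta'_j\rfloor\to V=\bigoplus_{i\in I}\mathbb{I}\lceil \beta_i,\delta_i\rfloor$, with columns ordered by birth times $\beta'_j$ and rows in reverse by death times $\delta_i$ (ties arbitrary, here and below). Kernel procedure: let $XT$ be obtained by ordered column reduction of $X$, with $T$ the product of the elementary matrices used. Put $\beta''_j=\delta_{p(j)}$ if column $j$ has a pivot in a nontrivial position $(p(j),j)$, and $\beta''_j=\beta'_j$ otherwise. Reorder the columns of $T$ by $\beta''_j$ and its rows in reverse by $\delta'_j$, and perform ordered column reduction of $T$ to obtain $\widetilde T$; let $q(j)$ be the row index of the pivot of $\widetilde T$ in column $j$. The kernel is given the decomposition $\ker\varphi\cong\bigoplus_{j\in J}\mathbb{I}\lceil\beta''_j,\delta'_{q(j)}\rfloor$ for which $\widetilde T$ represents the inclusion $\ker\varphi\hookrightarrow U$. Cokernel procedure: let $SX$ be obtained by ordered row reduction of $X$, with $S$ the product of the elementary matrices used. Put $\delta''_i=\beta'_{p'(i)}$ if row $i$ has a pivot in a nontrivial position $(i,p'(i))$, and $\delta''_i=\delta_i$ otherwise. Reorder the rows of $S$ in reverse by $\delta''_i$ and its columns by $\beta_i$, and perform ordered row reduction of $S$ to obtain $\widetilde S$; let $q'(i)$ be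 the column index of the pivot of $\widetilde S$ in row $i$. The cokernel is given the decomposition $\operatorname{coker}\varphi\cong\bigoplus_{i\in I}\mathbb{I}\lceil\beta_{q'(i)},\delta''_i\rfloor$ for which $\widetilde S$ represents the quotient map $V\to\operatorname{coker}\varphi$. *)

theory Defs
  imports "HOL-Algebra.AbelCoset" "Jordan_Normal_Form.VS_Connect"
begin

section \<open>Cuts\<close>

typedef (overloaded) ('r::linorder) cut =
  "{c :: 'r set \<times> 'r set. fst c \<union> snd c = UNIV \<and> (\<forall>x\<in>fst c. \<forall>y\<in>snd c. x < y)}"
  by (rule exI[of _ "({}, UNIV)"]) simp

definition lower :: "'r::linorder cut \<Rightarrow> 'r set" where
  "lower c = fst (Rep_cut c)"

definition upper :: "'r::linorder cut \<Rightarrow> 'r set" where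
  "upper c = snd (Rep_cut c)"

lemma upper_eq: "upper c = - lower c"
  using Rep_cut[of c] by (fastforce simp: upper_def lower_def)

lemma lower_inject: "lower c = lower d \<Longrightarrow> c = d"
  using upper_eq[of c] upper_eq[of d]
  by (metis Rep_cut_inject lower_def upper_def prod_eqI)

lemma lower_closed: "x \<in> lower c \<Longrightarrow> y \<le> x \<Longrightarrow> y \<in> lower c"
  using Rep_cut[of c] by (fastforce simp: lower_def)

instantiation cut :: (linorder) linorder
begin

definition less_eq_cut :: "'a cut \<Rightarrow> 'a cut \<Rightarrow> bool" where
  "less_eq_cut c d \<longleftrightarrow> lower c \<subseteq> lower d"

definition less_cut :: "'a cut \<Rightarrow> 'a cut \<Rightarrow> bool" where
  "less_cut c d \<longleftrightarrow> lower c \<subset> lower d"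

instance
proof
  fix c d :: "'a cut"
  show "c \<le> d \<or> d \<le> c"
    unfolding less_eq_cut_def by (meson lower_closed linear subsetI)
qed (auto simp: less_eq_cut_def less_cut_def intro: lower_inject)

end

definition bar_interval :: "'r::linorder cut \<Rightarrow> 'r cut \<Rightarrow> 'r set" where
  "bar_interval b d = upper b \<inter> lower d"


section \<open>Persistence modules\<close>

record ('r, 'f, 'v) pmod =
  space :: "'r \<Rightarrow> ('f, 'v) module"
  transition :: "'r \<Rightarrow> 'r \<Rightarrow> 'v \<Rightarrow> 'v"

definition persistence_module :: "('r::linorder, 'f::field, 'v) pmod \<Rightarrow> bool" where
  "persistence_module A \<longleftrightarrow>
     (\<forall>t. vectorspace class_ring (space A t)) \<and>
     (\<forall>s t. s \<le> t \<longrightarrow> transition A s t \<in> LinearCombinations.module_hom class_ring (space A s) (space A t)) \<and>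
     (\<forall>t. \<forall>x\<in>carrier (space A t). transition A t t x = x) \<and>
     (\<forall>r s t. r \<le> s \<and> s \<le> t \<longrightarrow>
        (\<forall>x\<in>carrier (space A r). transition A s t (transition A r s x) = transition A r t x))"

definition pmod_hom ::
  "('r::linorder, 'f::field, 'v) pmod \<Rightarrow> ('r, 'f, 'w) pmod \<Rightarrow> ('r \<Rightarrow> 'v \<Rightarrow> 'w) \<Rightarrow> bool" where
  "pmod_hom A B \<phi> \<longleftrightarrow>
     (\<forall>t. \<phi> t \<in> LinearCombinations.module_hom class_ring (space A t) (space B t)) \<and>
     (\<forall>s t. s \<le> t \<longrightarrow>
        (\<forall>x\<in>carrier (space A s). \<phi> t (transition A s t x) = transition B s t (\<phi> s x)))"

definition pmod_iso ::
  "('r::linorder, 'f::field, 'v) pmod \<Rightarrow> ('r, 'f, 'w) pmod \<Rightarrow> ('r \<Rightarrow> 'v \<Rightarrow> 'w) \<Rightarrow> bool" where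
  "pmod_iso A B \<phi> \<longleftrightarrow>
     pmod_hom A B \<phi> \<and> (\<forall>t. bij_betw (\<phi> t) (carrier (space A t)) (carrier (space B t)))"

definition pmod_kernel ::
  "('r::linorder, 'f::field, 'v) pmod \<Rightarrow> ('r, 'f, 'w) pmod \<Rightarrow> ('r \<Rightarrow> 'v \<Rightarrow> 'w) \<Rightarrow> ('r, 'f, 'v) pmod"
where
  "pmod_kernel A B \<phi> =
     \<lparr>space = (\<lambda>t. (space A t)\<lparr>carrier := a_kernel (space A t) (space B t) (\<phi> t)\<rparr>),
      transition = transition A\<rparr>"

definition pmod_image ::
  "('r::linorder, 'f::field, 'v) pmod \<Rightarrow> ('r \<Rightarrow> 'v \<Rightarrow> 'w) \<Rightarrow> 'r \<Rightarrow> 'w set" where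
  "pmod_image A \<phi> t = \<phi> t ` carrier (space A t)"

(* The ring slots mult and one of the record are irrelevant to a vector space. *)

definition quotient_space :: "('f, 'v) module \<Rightarrow> 'v set \<Rightarrow> ('f, 'v set) module" where
  "quotient_space V N =
     \<lparr>carrier = a_rcosets\<^bsub>V\<^esub> N, mult = undefined, one = undefined, zero = N, add = set_add V,
      smult = (\<lambda>a K. \<Union>x\<in>K. N +>\<^bsub>V\<^esub> (a \<odot>\<^bsub>V\<^esub> x))\<rparr>"

definition quotient_map :: "('r, 'f, 'v) pmod \<Rightarrow> ('r \<Rightarrow> 'v set) \<Rightarrow> 'r \<Rightarrow> 'v \<Rightarrow> 'v set" where
  "quotient_map A N t x = N t +>\<^bsub>space A t\<^esub> x"

(* The map of cosets induced by g, for the submodule N of the target vector space V. *)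

definition coset_map :: "('f, 'w) module \<Rightarrow> 'w set \<Rightarrow> ('v \<Rightarrow> 'w) \<Rightarrow> 'v set \<Rightarrow> 'w set" where
  "coset_map V N g K = (\<Union>x\<in>K. N +>\<^bsub>V\<^esub> g x)"

definition pmod_quotient ::
  "('r, 'f, 'v) pmod \<Rightarrow> ('r \<Rightarrow> 'v set) \<Rightarrow> ('r, 'f, 'v set) pmod" where
  "pmod_quotient A N =
     \<lparr>space = (\<lambda>t. quotient_space (space A t) (N t)),
      transition = (\<lambda>s t. coset_map (space A t) (N t) (transition A s t))\<rparr>"


section \<open>Interval decompositions and matrices\<close>

definition interval_module :: "'r::linorder cut \<Rightarrow> 'r cut \<Rightarrow> ('r, 'f::field, 'f) pmod" where
  "interval_module b d =
     \<lparr>space = (\<lambda>t. \<lparr>carrier = (if t \<in> bar_interval b d then UNIV else {0}),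
                    mult = undefined, one = undefined, zero = 0, add = (+), smult = (*)\<rparr>),
      transition = (\<lambda>s t x. if s \<in> bar_interval b d \<and> t \<in> bar_interval b d then x else 0)\<rparr>"

(* Used for finite J only; for infinite J this formula is the product. *)

definition pmod_direct_sum ::
  "'j set \<Rightarrow> ('j \<Rightarrow> ('r, 'f, 'v) pmod) \<Rightarrow> ('r, 'f, 'j \<Rightarrow> 'v) pmod" where
  "pmod_direct_sum J M =
     \<lparr>space = (\<lambda>t. \<lparr>carrier = (\<Pi>\<^sub>E j\<in>J. carrier (space (M j) t)),
                    mult = undefined, one = undefined,
                    zero = (\<lambda>j\<in>J. \<zero>\<^bsub>space (M j) t\<^esub>),
                    add = (\<lambda>f g. \<lambda>j\<in>J. f j \<oplus>\<^bsub>space (M j) t\<^esub> g j),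
                    smult = (\<lambda>a f. \<lambda>j\<in>J. a \<odot>\<^bsub>space (M j) t\<^esub> f j)\<rparr>),
      transition = (\<lambda>s t f. \<lambda>j\<in>J. transition (M j) s t (f j))\<rparr>"

record (overloaded) ('r::linorder, 'j) barcode =
  bars :: "'j set"
  birth :: "'j \<Rightarrow> 'r cut"
  death :: "'j \<Rightarrow> 'r cut"

definition interval_decomposition ::
  "('r::linorder, 'f::field, 'v) pmod \<Rightarrow> ('r, 'j) barcode \<Rightarrow> ('r \<Rightarrow> 'v \<Rightarrow> 'j \<Rightarrow> 'f) \<Rightarrow> bool" where
  "interval_decomposition A \<A> \<alpha> \<longleftrightarrow>
     persistence_module A \<and> finite (bars \<A>) \<and> (\<forall>j\<in>bars \<A>. birth \<A> j \<le> death \<A> j) \<and>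
     pmod_iso A (pmod_direct_sum (bars \<A>) (\<lambda>j. interval_module (birth \<A> j) (death \<A> j))) \<alpha>"

(* A matrix is a function X with entry X i j in row i and column j; only its entries at the
   finite index sets in question matter. *)

definition represents ::
  "('r::linorder, 'f::field, 'v) pmod \<Rightarrow> ('r, 'j) barcode \<Rightarrow> ('r \<Rightarrow> 'v \<Rightarrow> 'j \<Rightarrow> 'f) \<Rightarrow>
   ('r, 'f, 'w) pmod \<Rightarrow> ('r, 'i) barcode \<Rightarrow> ('r \<Rightarrow> 'w \<Rightarrow> 'i \<Rightarrow> 'f) \<Rightarrow>
   ('r \<Rightarrow> 'v \<Rightarrow> 'w) \<Rightarrow> ('i \<Rightarrow> 'j \<Rightarrow> 'f) \<Rightarrow> bool" where
  "represents A \<A> \<alpha> B \<B> \<beta> \<phi> X \<longleftrightarrow>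
     pmod_hom A B \<phi> \<and>
     (\<forall>i\<in>bars \<B>. \<forall>j\<in>bars \<A>.
        (birth \<B> i > birth \<A> j \<or> death \<B> i > death \<A> j \<longrightarrow> X i j = 0) \<and>
        (\<forall>t \<in> bar_interval (birth \<B> i) (death \<B> i) \<inter> bar_interval (birth \<A> j) (death \<A> j). \<forall>s.
           \<beta> t (\<phi> t (inv_into (carrier (space A t)) (\<alpha> t)
             (\<lambda>k\<in>bars \<A>. if k = j then s else 0))) i = X i j * s))"

definition mmul :: "'k set \<Rightarrow> ('i \<Rightarrow> 'k \<Rightarrow> 'f::field) \<Rightarrow> ('k \<Rightarrow> 'j \<Rightarrow> 'f) \<Rightarrow> 'i \<Rightarrow> 'j \<Rightarrow> 'f" where
  "mmul K A B i j = (\<Sum>k\<in>K. A i k * B k j)"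

definition mone :: "'j \<Rightarrow> 'j \<Rightarrow> 'f::field" where
  "mone i j = (if i = j then 1 else 0)"

definition mtranspose :: "('i \<Rightarrow> 'j \<Rightarrow> 'f) \<Rightarrow> 'j \<Rightarrow> 'i \<Rightarrow> 'f" where
  "mtranspose A j i = A i j"

definition minverts :: "'j set \<Rightarrow> ('j \<Rightarrow> 'j \<Rightarrow> 'f::field) \<Rightarrow> ('j \<Rightarrow> 'j \<Rightarrow> 'f) \<Rightarrow> bool" where
  "minverts J A B \<longleftrightarrow>
     (\<forall>i\<in>J. \<forall>j\<in>J. mmul J A B i j = mone i j \<and> mmul J B A i j = mone i j)"

definition minvertible :: "'j set \<Rightarrow> ('j \<Rightarrow> 'j \<Rightarrow> 'f::field) \<Rightarrow> bool" where
  "minvertible J A \<longleftrightarrow> (\<exists>B. minverts J A B)"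

definition minv :: "'j set \<Rightarrow> ('j \<Rightarrow> 'j \<Rightarrow> 'f::field) \<Rightarrow> 'j \<Rightarrow> 'j \<Rightarrow> 'f" where
  "minv J A = (SOME B. minverts J A B)"


section \<open>Ordered reduction\<close>

(* An ordering of an index set is a list of its elements, from least to greatest. *)

definition pivot :: "'i list \<Rightarrow> ('i \<Rightarrow> 'f::field) \<Rightarrow> 'i option" where
  "pivot rs v = find (\<lambda>i. v i \<noteq> 0) rs"

(* (j, k, c) stands for adding c times column j to column k, which is right multiplication by
   the elementary matrix below. *)

type_synonym ('j, 'f) column_op = "'j \<times> 'j \<times> 'f"

fun apply_op :: "('j, 'f::field) column_op \<Rightarrow> ('i \<Rightarrow> 'j \<Rightarrow> 'f) \<Rightarrow> 'i \<Rightarrow> 'j \<Rightarrow> 'f" where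
  "apply_op (j, k, c) A i l = (if l = k then A i k + A i j * c else A i l)"

fun elementary_matrix :: "('j, 'f::field) column_op \<Rightarrow> 'j \<Rightarrow> 'j \<Rightarrow> 'f" where
  "elementary_matrix (j, k, c) i l = (if i = l then 1 else if i = j \<and> l = k then c else 0)"

fun column_ops :: "'i list \<Rightarrow> 'j list \<Rightarrow> ('i \<Rightarrow> 'j \<Rightarrow> 'f::field) \<Rightarrow> ('j, 'f) column_op list" where
  "column_ops rs [] A = []"
| "column_ops rs (j # ks) A =
     (case pivot rs (\<lambda>i. A i j) of
        None \<Rightarrow> column_ops rs ks A
      | Some p \<Rightarrow>
          (let ops = map (\<lambda>k. (j, k, - (A p k / A p j))) ks
           in ops @ column_ops rs ks (fold apply_op ops A)))"

definition column_reduction ::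
  "'i list \<Rightarrow> 'j list \<Rightarrow> ('i \<Rightarrow> 'j \<Rightarrow> 'f::field) \<Rightarrow> 'i \<Rightarrow> 'j \<Rightarrow> 'f" where
  "column_reduction rs cs A = fold apply_op (column_ops rs cs A) A"

definition column_multiplier ::
  "'i list \<Rightarrow> 'j list \<Rightarrow> ('i \<Rightarrow> 'j \<Rightarrow> 'f::field) \<Rightarrow> 'j \<Rightarrow> 'j \<Rightarrow> 'f" where
  "column_multiplier rs cs A =
     foldr (\<lambda>op. mmul (set cs) (elementary_matrix op)) (column_ops rs cs A) mone"

definition row_reduction ::
  "'i list \<Rightarrow> 'j list \<Rightarrow> ('i \<Rightarrow> 'j \<Rightarrow> 'f::field) \<Rightarrow> 'i \<Rightarrow> 'j \<Rightarrow> 'f" where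
  "row_reduction rs cs A = mtranspose (column_reduction cs rs (mtranspose A))"

definition row_multiplier ::
  "'i list \<Rightarrow> 'j list \<Rightarrow> ('i \<Rightarrow> 'j \<Rightarrow> 'f::field) \<Rightarrow> 'i \<Rightarrow> 'i \<Rightarrow> 'f" where
  "row_multiplier rs cs A = mtranspose (column_multiplier cs rs (mtranspose A))"


section \<open>Kernel and cokernel procedures\<close>

definition increasing_order :: "('j \<Rightarrow> 'c::linorder) \<Rightarrow> 'j set \<Rightarrow> 'j list \<Rightarrow> bool" where
  "increasing_order f J xs \<longleftrightarrow> distinct xs \<and> set xs = J \<and> sorted_wrt (\<le>) (map f xs)"

definition decreasing_order :: "('j \<Rightarrow> 'c::linorder) \<Rightarrow> 'j set \<Rightarrow> 'j list \<Rightarrow> bool" where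
  "decreasing_order f J xs \<longleftrightarrow> distinct xs \<and> set xs = J \<and> sorted_wrt (\<ge>) (map f xs)"

(* kernel_procedure U V X K T: with some choice of tie-breaks, the procedure applied to the
   matrix X from the barcode U to the barcode V returns the barcode K and the matrix T. *)

definition kernel_procedure ::
  "('r::linorder, 'j) barcode \<Rightarrow> ('r, 'i) barcode \<Rightarrow> ('i \<Rightarrow> 'j \<Rightarrow> 'f::field) \<Rightarrow>
   ('r, 'j) barcode \<Rightarrow> ('j \<Rightarrow> 'j \<Rightarrow> 'f) \<Rightarrow> bool" where
  "kernel_procedure \<U> \<V> X \<K> T' \<longleftrightarrow>
     (\<exists>cs rs cs' rs' XT T b d.
        increasing_order (birth \<U>) (bars \<U>) cs \<and> decreasing_order (death \<V>) (bars \<V>) rs \<and>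
        XT = column_reduction rs cs X \<and> T = column_multiplier rs cs X \<and>
        b = (\<lambda>j. case pivot rs (\<lambda>i. XT i j) of
                   None \<Rightarrow> birth \<U> j
                 | Some p \<Rightarrow> if birth \<U> j < death \<V> p then death \<V> p else birth \<U> j) \<and>
        increasing_order b (bars \<U>) cs' \<and> decreasing_order (death \<U>) (bars \<U>) rs' \<and>
        T' = column_reduction rs' cs' T \<and>
        d = (\<lambda>j. death \<U> (the (pivot rs' (\<lambda>i. T' i j)))) \<and>
        \<K> = \<lparr>bars = bars \<U>, birth = b, death = d\<rparr>)"

definition cokernel_procedure ::
  "('r::linorder, 'j) barcode \<Rightarrow> ('r, 'i) barcode \<Rightarrow> ('i \<Rightarrow> 'j \<Rightarrow> 'f::field) \<Rightarrow>
   ('r, 'i) barcode \<Rightarrow> ('i \<Rightarrow> 'i \<Rightarrow> 'f) \<Rightarrow> bool" where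
  "cokernel_procedure \<U> \<V> X \<K> S' \<longleftrightarrow>
     (\<exists>cs rs cs' rs' SX S b d.
        increasing_order (birth \<U>) (bars \<U>) cs \<and> decreasing_order (death \<V>) (bars \<V>) rs \<and>
        SX = row_reduction rs cs X \<and> S = row_multiplier rs cs X \<and>
        d = (\<lambda>i. case pivot cs (\<lambda>j. SX i j) of
                   None \<Rightarrow> death \<V> i
                 | Some p \<Rightarrow> if birth \<U> p < death \<V> i then birth \<U> p else death \<V> i) \<and>
        decreasing_order d (bars \<V>) rs' \<and> increasing_order (birth \<V>) (bars \<V>) cs' \<and>
        S' = row_reduction rs' cs' S \<and>
        b = (\<lambda>i. birth \<V> (the (pivot cs' (\<lambda>j. S' i j)))) \<and>
        \<K> = \<lparr>bars = bars \<V>, birth = b, death = d\<rparr>)"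


section \<open>Chain complexes\<close>

(* Complexes are graded by the integers; a complex graded by the naturals is extended by zero. *)

definition chain_complex ::
  "(int \<Rightarrow> ('r::linorder, 'f::field, 'v) pmod) \<Rightarrow> (int \<Rightarrow> 'r \<Rightarrow> 'v \<Rightarrow> 'v) \<Rightarrow> bool" where
  "chain_complex C \<delta> \<longleftrightarrow>
     (\<forall>n. persistence_module (C n) \<and> pmod_hom (C n) (C (n - 1)) (\<delta> n) \<and>
       (\<forall>t. \<forall>x\<in>carrier (space (C (n + 1)) t).
          \<delta> n t (\<delta> (n + 1) t x) = \<zero>\<^bsub>space (C (n - 1)) t\<^esub>))"

definition chain_map ::
  "(int \<Rightarrow> ('r::linorder, 'f::field, 'v) pmod) \<Rightarrow> (int \<Rightarrow> 'r \<Rightarrow> 'v \<Rightarrow> 'v) \<Rightarrow>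
   (int \<Rightarrow> ('r, 'f, 'w) pmod) \<Rightarrow> (int \<Rightarrow> 'r \<Rightarrow> 'w \<Rightarrow> 'w) \<Rightarrow> (int \<Rightarrow> 'r \<Rightarrow> 'v \<Rightarrow> 'w) \<Rightarrow> bool"
where
  "chain_map C \<delta> C' \<delta>' f \<longleftrightarrow>
     (\<forall>n. pmod_hom (C n) (C' n) (f n) \<and>
       (\<forall>t. \<forall>x\<in>carrier (space (C n) t). \<delta>' n t (f n t x) = f (n - 1) t (\<delta> n t x)))"

definition decomposed_complex ::
  "(int \<Rightarrow> ('r::linorder, 'f::field, 'v) pmod) \<Rightarrow> (int \<Rightarrow> 'r \<Rightarrow> 'v \<Rightarrow> 'v) \<Rightarrow>
   (int \<Rightarrow> ('r, 'j) barcode) \<Rightarrow> (int \<Rightarrow> 'r \<Rightarrow> 'v \<Rightarrow> 'j \<Rightarrow> 'f) \<Rightarrow> (int \<Rightarrow> 'j \<Rightarrow> 'j \<Rightarrow> 'f) \<Rightarrow> bool"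
where
  "decomposed_complex C \<delta> \<C> \<alpha> D \<longleftrightarrow>
     chain_complex C \<delta> \<and> (\<forall>n. interval_decomposition (C n) (\<C> n) (\<alpha> n)) \<and>
     (\<forall>n. represents (C n) (\<C> n) (\<alpha> n) (C (n - 1)) (\<C> (n - 1)) (\<alpha> (n - 1)) (\<delta> n) (D n))"

definition cycles ::
  "(int \<Rightarrow> ('r::linorder, 'f::field, 'v) pmod) \<Rightarrow> (int \<Rightarrow> 'r \<Rightarrow> 'v \<Rightarrow> 'v) \<Rightarrow> int \<Rightarrow> ('r, 'f, 'v) pmod"
where
  "cycles C \<delta> n = pmod_kernel (C n) (C (n - 1)) (\<delta> n)"

definition boundaries ::
  "(int \<Rightarrow> ('r::linorder, 'f::field, 'v) pmod) \<Rightarrow> (int \<Rightarrow> 'r \<Rightarrow> 'v \<Rightarrow> 'v) \<Rightarrow> int \<Rightarrow> 'r \<Rightarrow> 'v set"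
where
  "boundaries C \<delta> n = pmod_image (C (n + 1)) (\<delta> (n + 1))"

definition homology ::
  "(int \<Rightarrow> ('r::linorder, 'f::field, 'v) pmod) \<Rightarrow> (int \<Rightarrow> 'r \<Rightarrow> 'v \<Rightarrow> 'v) \<Rightarrow> int \<Rightarrow> ('r, 'f, 'v set) pmod"
where
  "homology C \<delta> n = pmod_quotient (cycles C \<delta> n) (boundaries C \<delta> n)"

definition homology_map ::
  "(int \<Rightarrow> ('r::linorder, 'f::field, 'w) pmod) \<Rightarrow> (int \<Rightarrow> 'r \<Rightarrow> 'w \<Rightarrow> 'w) \<Rightarrow> int \<Rightarrow>
   ('r \<Rightarrow> 'v \<Rightarrow> 'w) \<Rightarrow> 'r \<Rightarrow> 'v set \<Rightarrow> 'w set" where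
  "homology_map C' \<delta>' n g t = coset_map (space (cycles C' \<delta>' n) t) (boundaries C' \<delta>' n t) (g t)"

(* Since the inclusion is injective and the quotient map is surjective, the isomorphisms \<zeta>
   and \<eta> below are determined on carriers by the barcodes and the matrices T and S. *)

definition cycles_decomposition ::
  "(int \<Rightarrow> ('r::linorder, 'f::field, 'v) pmod) \<Rightarrow> (int \<Rightarrow> 'r \<Rightarrow> 'v \<Rightarrow> 'v) \<Rightarrow>
   (int \<Rightarrow> ('r, 'j) barcode) \<Rightarrow> (int \<Rightarrow> 'r \<Rightarrow> 'v \<Rightarrow> 'j \<Rightarrow> 'f) \<Rightarrow> int \<Rightarrow>
   ('r, 'j) barcode \<Rightarrow> ('j \<Rightarrow> 'j \<Rightarrow> 'f) \<Rightarrow> ('r \<Rightarrow> 'v \<Rightarrow> 'j \<Rightarrow> 'f) \<Rightarrow> bool" where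
  "cycles_decomposition C \<delta> \<C> \<alpha> n \<Z> T \<zeta> \<longleftrightarrow>
     interval_decomposition (cycles C \<delta> n) \<Z> \<zeta> \<and>
     represents (cycles C \<delta> n) \<Z> \<zeta> (C n) (\<C> n) (\<alpha> n) (\<lambda>t x. x) T"

definition homology_decomposition ::
  "(int \<Rightarrow> ('r::linorder, 'f::field, 'v) pmod) \<Rightarrow> (int \<Rightarrow> 'r \<Rightarrow> 'v \<Rightarrow> 'v) \<Rightarrow> int \<Rightarrow>
   ('r, 'j) barcode \<Rightarrow> ('r \<Rightarrow> 'v \<Rightarrow> 'j \<Rightarrow> 'f) \<Rightarrow>
   ('r, 'j) barcode \<Rightarrow> ('j \<Rightarrow> 'j \<Rightarrow> 'f) \<Rightarrow> ('r \<Rightarrow> 'v set \<Rightarrow> 'j \<Rightarrow> 'f) \<Rightarrow> bool" where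
  "homology_decomposition C \<delta> n \<Z> \<zeta> \<H> S \<eta> \<longleftrightarrow>
     interval_decomposition (homology C \<delta> n) \<H> \<eta> \<and>
     represents (cycles C \<delta> n) \<Z> \<zeta> (homology C \<delta> n) \<H> \<eta>
       (quotient_map (cycles C \<delta> n) (boundaries C \<delta> n)) S"

end

(*
  Over each t, a persistence module with a given interval decomposition is the quotient E_t / F_t of
  coordinate spaces, where E_t is spanned by the bars born by t and F_t by the bars dead at t, and the
  transition maps are induced by inclusions.  A matrix represents a morphism exactly when it maps E_t
  to E_t and F_t to F_t and induces the morphism on the quotients.

  The pivots of a reduced matrix lie in distinct rows, so the topmost one in a linear combination of
  columns cannot cancel.  Hence the kernel procedure yields an invertible T mapping E_t of the kernel
  onto {v in E_t. X v in F_t} and F_t onto F_t.  The cokernel procedure is the kernel procedure of the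
  transposed matrix with all orders reversed, and its correctness follows by taking annihilators.
  The statements about cycles, homology and induced maps are then diagram chases with E_t and F_t.
*)
theory Submission
  imports Defs "HOL-Library.Function_Algebras"
begin

section \<open>Coordinate spaces and matrices\<close>

text \<open>One matrix has to serve every t at once, so nothing is chosen fibrewise. The bars born
  by t form a prefix of any order by birth, the bars dead at t a suffix of any order by decreasing
  death, and no other property of the orders is used; this is why ties are harmless. The first
  multiplier T is triangular for the birth order and so preserves every E_t, but the preimage of F_t
  under T need not be a coordinate space. The second reduction repairs this: its operations are
  triangular for the new births, hence preserve every E_t of the kernel, and its distinct pivots
  make the preimage of each F_t a coordinate space. The new birth is a maximum because a reduced
  column contributes to the kernel at t exactly when it is born and its pivot row is dead. Quotients
  E_t / F_t are preferred to sums of interval modules because a matrix entry between two bars that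
  are never alive together is seen in no fibre and yet enters matrix products. On coordinate spaces
  it is an entry like any other.\<close>

definition coord :: "'j set \<Rightarrow> ('j \<Rightarrow> 'f::field) set" where
  "coord P = {v. \<forall>j. v j \<noteq> 0 \<longrightarrow> j \<in> P}"

text \<open>The value 0 off I puts every product into \<open>coord I\<close>, so that equality of
  vectors can be plain equality of functions although matrices are unconstrained off the index
  sets.\<close>

definition mvec :: "'i set \<Rightarrow> 'j set \<Rightarrow> ('i \<Rightarrow> 'j \<Rightarrow> 'f::field) \<Rightarrow> ('j \<Rightarrow> 'f) \<Rightarrow> 'i \<Rightarrow> 'f" where
  "mvec I J X v i = (if i \<in> I then \<Sum>j\<in>J. X i j * v j else 0)"

lemma coord_mono: "P \<subseteq> Q \<Longrightarrow> coord P \<subseteq> coord Q"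
  by (auto simp: coord_def)

lemma coord_subsetD: "v \<in> coord P \<Longrightarrow> P \<subseteq> Q \<Longrightarrow> v \<in> coord Q"
  by (auto simp: coord_def)

lemma zero_in_coord: "(\<lambda>_. 0) \<in> coord P"
  by (simp add: coord_def)

lemma coord_add: "u \<in> coord P \<Longrightarrow> v \<in> coord P \<Longrightarrow> (\<lambda>j. u j + v j) \<in> coord P"
  by (force simp: coord_def)

lemma coord_diff: "u \<in> coord P \<Longrightarrow> v \<in> coord P \<Longrightarrow> (\<lambda>j. u j - v j) \<in> coord P"
  by (force simp: coord_def)

lemma coord_scale: "v \<in> coord P \<Longrightarrow> (\<lambda>j. a * v j) \<in> coord P"
  by (force simp: coord_def)

lemma mvec_in_coord: "mvec I J X v \<in> coord I"
  by (simp add: coord_def mvec_def)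

lemma mvec_add: "mvec I J X (\<lambda>j. u j + v j) = (\<lambda>i. mvec I J X u i + mvec I J X v i)"
  by (rule ext) (simp add: mvec_def distrib_left sum.distrib)

lemma mvec_scale: "mvec I J X (\<lambda>j. a * v j) = (\<lambda>i. a * mvec I J X v i)"
  by (rule ext) (simp add: mvec_def sum_distrib_left mult.left_commute)

lemma mvec_zero: "mvec I J X (\<lambda>_. 0) = (\<lambda>_. 0)"
  by (rule ext) (simp add: mvec_def)

lemma mvec_cong:
  "(\<And>i j. i \<in> I \<Longrightarrow> j \<in> J \<Longrightarrow> X i j = Y i j) \<Longrightarrow> mvec I J X v = mvec I J Y v"
  by (rule ext) (auto simp: mvec_def intro: sum.cong)

lemma mmul_assoc: "mmul L A (mmul K B C) = mmul K (mmul L A B) C"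
  unfolding mmul_def
  by (intro ext) (simp add: sum_distrib_left sum_distrib_right mult.assoc sum.swap[of _ K L])

lemma mmul_mone_right: "finite J \<Longrightarrow> j \<in> J \<Longrightarrow> mmul J A mone i j = A i j"
  by (simp add: mmul_def mone_def if_distrib cong: if_cong)

lemma mmul_mone_left: "finite J \<Longrightarrow> i \<in> J \<Longrightarrow> mmul J mone A i j = A i j"
  by (simp add: mmul_def mone_def if_distrib[of "\<lambda>x. x * _"] cong: if_cong)

lemma mmul_cong:
  "(\<And>k. k \<in> K \<Longrightarrow> A i k = A' i k) \<Longrightarrow> (\<And>k. k \<in> K \<Longrightarrow> B k j = B' k j) \<Longrightarrow>
   mmul K A B i j = mmul K A' B' i j"
  by (simp add: mmul_def)

lemma mvec_mmul: "mvec I J (mmul K A B) v = mvec I K A (mvec K J B v)"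
proof (rule ext)
  fix i
  have "(\<Sum>j\<in>J. (\<Sum>k\<in>K. A i k * B k j) * v j) = (\<Sum>k\<in>K. A i k * (\<Sum>j\<in>J. B k j * v j))"
    by (simp add: sum_distrib_left sum_distrib_right mult.assoc sum.swap[of _ K J])
  then show "mvec I J (mmul K A B) v i = mvec I K A (mvec K J B v) i"
    by (simp add: mvec_def mmul_def)
qed

lemma mvec_mone: "finite J \<Longrightarrow> v \<in> coord J \<Longrightarrow> mvec J J mone v = v"
  by (rule ext) (auto simp: mvec_def mone_def coord_def if_distrib[of "\<lambda>x. x * _"] cong: if_cong)

lemma minverts_mvec:
  assumes "finite J" "minverts J A B" "v \<in> coord J"
  shows "mvec J J A (mvec J J B v) = v" "mvec J J B (mvec J J A v) = v"
proof -
  have "mvec J J (mmul J A B) v = mvec J J mone v" "mvec J J (mmul J B A) v = mvec J J mone v"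
    using assms(2) by (auto simp: minverts_def intro!: mvec_cong)
  then show "mvec J J A (mvec J J B v) = v" "mvec J J B (mvec J J A v) = v"
    using assms by (simp_all add: mvec_mmul mvec_mone)
qed

lemma minverts_sym: "minverts J A B \<Longrightarrow> minverts J B A"
  by (auto simp: minverts_def)

lemma minverts_mmul:
  assumes J: "finite J" and A: "minverts J A A'" and B: "minverts J B B'"
  shows "minverts J (mmul J A B) (mmul J B' A')"
proof -
  \<comment> \<open>Stated for arbitrary matrices, because the product in the other order is the
    same claim for B' and A' in place of A and B.\<close>
  have cancel: "mmul J (mmul J A B) (mmul J B' A') i j = mone i j"
    if "i \<in> J" "j \<in> J" and A: "minverts J A A'" and B: "minverts J B B'"
    for i j and A A' B B' :: "'a \<Rightarrow> 'a \<Rightarrow> 'b"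
  proof -
    have "mmul J (mmul J A B) (mmul J B' A') i j = mmul J A (mmul J (mmul J B B') A') i j"
      by (simp add: mmul_assoc)
    also have "\<dots> = mmul J A A' i j"
    proof (rule mmul_cong)
      fix k assume k: "k \<in> J"
      have "mmul J (mmul J B B') A' k j = mmul J mone A' k j"
        using B k by (intro mmul_cong) (auto simp: minverts_def)
      then show "mmul J (mmul J B B') A' k j = A' k j"
        using J k by (simp add: mmul_mone_left)
    qed simp
    finally show ?thesis
      using A that by (simp add: minverts_def)
  qed
  show ?thesis
    unfolding minverts_def[of J "mmul J A B"]
    using cancel A B minverts_sym by metis
qed

lemma minverts_cong:
  "(\<And>i j. i \<in> J \<Longrightarrow> j \<in> J \<Longrightarrow> A i j = A' i j) \<Longrightarrow> minverts J A B \<longleftrightarrow> minverts J A' B"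
  unfolding minverts_def mmul_def by simp

lemma minverts_minv: "minvertible J A \<Longrightarrow> minverts J A (minv J A)"
  unfolding minvertible_def minv_def by (metis someI_ex)

lemma mtranspose_mtranspose [simp]: "mtranspose (mtranspose A) = A"
  by (intro ext) (simp add: mtranspose_def)

lemma minverts_mtranspose:
  "minverts J A B \<Longrightarrow> minverts J (mtranspose A) (mtranspose B)"
  unfolding minverts_def mmul_def mtranspose_def mone_def by (simp add: mult.commute)


section \<open>Ordered column reduction\<close>

text \<open>The strict order of positions. Its recursion is that of \<open>column_ops\<close>, which
  adds the head of the list to the entries of the tail.\<close>

fun precedes :: "'j list \<Rightarrow> 'j \<Rightarrow> 'j \<Rightarrow> bool" where
  "precedes [] i k \<longleftrightarrow> False"
| "precedes (x # xs) i k \<longleftrightarrow> i = x \<and> k \<in> set xs \<or> precedes xs i k"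

lemma precedes_in_set: "precedes xs i k \<Longrightarrow> i \<in> set xs \<and> k \<in> set xs"
  by (induction xs) auto

lemma precedes_irrefl: "distinct xs \<Longrightarrow> \<not> precedes xs i i"
  by (induction xs) (auto dest: precedes_in_set)

lemma precedes_trans:
  "distinct xs \<Longrightarrow> precedes xs i k \<Longrightarrow> precedes xs k l \<Longrightarrow> precedes xs i l"
  by (induction xs) (auto dest: precedes_in_set)

lemma sorted_wrt_precedes: "sorted_wrt R (map f xs) \<Longrightarrow> precedes xs i k \<Longrightarrow> R (f i) (f k)"
  by (induction xs) auto

definition upper_triangular :: "'j list \<Rightarrow> ('j \<Rightarrow> 'j \<Rightarrow> 'f::field) \<Rightarrow> bool" where
  "upper_triangular xs A \<longleftrightarrow>
     (\<forall>i\<in>set xs. \<forall>j\<in>set xs. A i j \<noteq> 0 \<longrightarrow> i = j \<or> precedes xs i j)"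

lemma upper_triangular_mone: "upper_triangular xs mone"
  by (simp add: upper_triangular_def mone_def)

lemma upper_triangular_mmul:
  assumes "distinct xs" "upper_triangular xs A" "upper_triangular xs B"
  shows "upper_triangular xs (mmul (set xs) A B)"
  unfolding upper_triangular_def
proof (intro ballI impI)
  fix i j assume ij: "i \<in> set xs" "j \<in> set xs" "mmul (set xs) A B i j \<noteq> 0"
  then obtain k where "k \<in> set xs" "A i k \<noteq> 0" "B k j \<noteq> 0"
    unfolding mmul_def by (auto elim!: sum.not_neutral_contains_not_neutral)
  with assms ij show "i = j \<or> precedes xs i j"
    unfolding upper_triangular_def using precedes_trans by metis
qed

lemma upper_triangular_elementary:
  "precedes xs j k \<Longrightarrow> upper_triangular xs (elementary_matrix (j, k, c))"
  by (simp add: upper_triangular_def)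

lemma minverts_elementary:
  assumes J: "finite J" "j \<in> J" "k \<in> J" and jk: "j \<noteq> k"
  shows "minverts J (elementary_matrix (j, k, c)) (elementary_matrix (j, k, - c))"
proof -
  have "mmul J (elementary_matrix (j, k, c)) (elementary_matrix (j, k, - c)) i l = mone i l"
    if "i \<in> J" "l \<in> J" for i l and c :: 'b
  proof -
    have "mmul J (elementary_matrix (j, k, c)) (elementary_matrix (j, k, - c)) i l =
        (\<Sum>m\<in>J. (if i = m then elementary_matrix (j, k, - c) i l else 0) +
           (if k = m then (if i = j then c * elementary_matrix (j, k, - c) k l else 0) else 0))"
      unfolding mmul_def using jk by (intro sum.cong) auto
    also have "\<dots> = mone i l"
      using J that jk by (auto simp: sum.distrib mone_def)
    finally show ?thesis .
  qed
  from this this[of _ _ "- c"] show ?thesis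
    by (simp add: minverts_def)
qed

section \<open>Column operations as products of elementary matrices\<close>

lemma apply_op_eq_mmul:
  assumes "finite J" "j \<in> J" "k \<in> J" "j \<noteq> k" "l \<in> J"
  shows "apply_op (j, k, c) A i l = mmul J A (elementary_matrix (j, k, c)) i l"
proof -
  have "mmul J A (elementary_matrix (j, k, c)) i l =
      (\<Sum>m\<in>J. (if m = l then A i l else 0) + (if m = j then (if l = k then A i j * c else 0) else 0))"
    unfolding mmul_def using assms by (intro sum.cong) auto
  also have "\<dots> = apply_op (j, k, c) A i l"
    using assms by (simp add: sum.distrib)
  finally show ?thesis ..
qed

abbreviation op_product :: "'j set \<Rightarrow> ('j, 'f::field) column_op list \<Rightarrow> 'j \<Rightarrow> 'j \<Rightarrow> 'f" where
  "op_product J ops \<equiv> foldr (\<lambda>op. mmul J (elementary_matrix op)) ops mone"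

lemma fold_apply_op_eq_mmul:
  assumes "distinct cs" "\<And>j k c. (j, k, c) \<in> set ops \<Longrightarrow> precedes cs j k" "l \<in> set cs"
  shows "fold apply_op ops A i l = mmul (set cs) A (op_product (set cs) ops) i l"
  using assms(2,3)
proof (induction ops arbitrary: A)
  case Nil
  then show ?case by (simp add: mmul_mone_right)
next
  case (Cons op ops)
  obtain j k c where op: "op = (j, k, c)" by (cases op)
  have jk: "precedes cs j k" using Cons.prems op by auto
  then have jk': "j \<in> set cs" "k \<in> set cs" "j \<noteq> k"
    using precedes_in_set precedes_irrefl[OF assms(1)] by metis+
  have "fold apply_op (op # ops) A i l = mmul (set cs) (apply_op op A) (op_product (set cs) ops) i l"
    using Cons.IH[OF _ Cons.prems(2)] Cons.prems(1) by (metis fold_simps(2) list.set_intros(2))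
  also have "\<dots> = mmul (set cs) (mmul (set cs) A (elementary_matrix op)) (op_product (set cs) ops) i l"
    using apply_op_eq_mmul[OF _ jk', of _ c A i] unfolding op by (intro mmul_cong) auto
  finally show ?case by (simp add: mmul_assoc)
qed

text \<open>The inverse is the reversed product of the operations with negated coefficients. It is
  built together with its triangular shape, since the shape of the inverse is what later yields
  equality, and not just inclusion, for images of coordinate spaces.\<close>

lemma op_product_inverse:
  assumes cs: "distinct cs" and ops: "\<And>j k c. (j, k, c) \<in> set ops \<Longrightarrow> precedes cs j k"
  shows "upper_triangular cs (op_product (set cs) ops) \<and>
    (\<exists>B. upper_triangular cs B \<and> minverts (set cs) (op_product (set cs) ops) B)"
  using ops
proof (induction ops)
  case Nil
  then show ?case
    using upper_triangular_mone by (auto simp: minverts_def mmul_mone_right intro!: exI[of _ mone])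
next
  case (Cons op ops)
  obtain j k c where op: "op = (j, k, c)" by (cases op)
  have jk: "precedes cs j k" using Cons.prems op by auto
  then have jk': "j \<in> set cs" "k \<in> set cs" "j \<noteq> k"
    using precedes_in_set precedes_irrefl[OF cs] by metis+
  from Cons obtain B where tri: "upper_triangular cs (op_product (set cs) ops)"
      "upper_triangular cs B" and B: "minverts (set cs) (op_product (set cs) ops) B"
    by auto
  have "minverts (set cs) (op_product (set cs) (op # ops))
      (mmul (set cs) B (elementary_matrix (j, k, - c)))"
    unfolding op foldr_Cons o_apply
    using jk' B by (intro minverts_mmul minverts_elementary) auto
  moreover have "upper_triangular cs (op_product (set cs) (op # ops))"
      "upper_triangular cs (mmul (set cs) B (elementary_matrix (j, k, - c)))"
    unfolding op foldr_Cons o_apply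
    using cs jk tri by (intro upper_triangular_mmul upper_triangular_elementary; simp)+
  ultimately show ?case by blast
qed

section \<open>Pivots of the reduced matrix\<close>

lemma pivot_Nil [simp]: "pivot [] v = None"
  by (simp add: pivot_def)

lemma pivot_Cons [simp]: "pivot (r # rs) v = (if v r \<noteq> 0 then Some r else pivot rs v)"
  by (simp add: pivot_def)

lemma pivot_None_iff: "pivot rs v = None \<longleftrightarrow> (\<forall>i\<in>set rs. v i = 0)"
  by (induction rs) auto

lemma pivot_SomeD: "pivot rs v = Some p \<Longrightarrow> p \<in> set rs \<and> v p \<noteq> 0"
  by (induction rs) (auto split: if_splits)

lemma pivot_least:
  "pivot rs v = Some p \<Longrightarrow> i \<in> set rs \<Longrightarrow> v i \<noteq> 0 \<Longrightarrow> i = p \<or> precedes rs p i"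
  by (induction rs) (auto split: if_splits dest: pivot_SomeD)

lemma column_ops_precedes:
  assumes "distinct cs" "(j, k, c) \<in> set (column_ops rs cs A)"
  shows "precedes cs j k"
  using assms
  by (induction rs cs A rule: column_ops.induct) (auto simp: Let_def split: option.splits)

text \<open>As j is not among the targets, column j stays as it is while its multiples are added, so
  all additions use the original entries.\<close>

lemma fold_apply_op_row:
  assumes "distinct ks" "j \<notin> set ks"
  shows "fold apply_op (map (\<lambda>k. (j, k, c k)) ks) A i l =
    (if l \<in> set ks then A i l + A i j * c l else A i l)"
  using assms by (induction ks arbitrary: A) auto

lemma fold_apply_op_unchanged:
  assumes "\<And>j k c. (j, k, c) \<in> set ops \<Longrightarrow> k \<noteq> l"
  shows "fold apply_op ops A i l = A i l"
  using assms
proof (induction ops arbitrary: A)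
  case (Cons op ops)
  obtain j k c where op: "op = (j, k, c)" by (cases op)
  have "fold apply_op ops (apply_op op A) i l = apply_op op A i l"
    by (rule Cons.IH) (meson Cons.prems list.set_intros(2))
  moreover have "k \<noteq> l" using Cons.prems op by auto
  ultimately show ?case by (simp add: op)
qed simp

text \<open>A row that has been cleared on the columns L stays cleared there as long as only columns
  of L are added to others. The pivot row of a processed column is preserved in this way.\<close>

lemma fold_apply_op_zero_row:
  assumes "\<And>j k c. (j, k, c) \<in> set ops \<Longrightarrow> j \<in> L" "\<And>l. l \<in> L \<Longrightarrow> A p l = 0" "l \<in> L"
  shows "fold apply_op ops A p l = 0"
  using assms
proof (induction ops arbitrary: A)
  case (Cons op ops)
  obtain j k c where op: "op = (j, k, c)" by (cases op)
  have "j \<in> L" using Cons.prems(1) op by auto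
  then have "\<And>l. l \<in> L \<Longrightarrow> apply_op op A p l = 0"
    using Cons.prems(2) op by auto
  moreover have "\<And>j k c. (j, k, c) \<in> set ops \<Longrightarrow> j \<in> L"
    using Cons.prems(1) by (meson list.set_intros(2))
  ultimately show ?case
    using Cons.IH[of "apply_op op A"] Cons.prems(3) by simp
qed simp

definition distinct_pivots :: "'i list \<Rightarrow> 'j set \<Rightarrow> ('i \<Rightarrow> 'j \<Rightarrow> 'f::field) \<Rightarrow> bool" where
  "distinct_pivots rs J R \<longleftrightarrow> (\<forall>j\<in>J. \<forall>k\<in>J. \<forall>p.
     pivot rs (\<lambda>i. R i j) = Some p \<and> pivot rs (\<lambda>i. R i k) = Some p \<longrightarrow> j = k)"

text \<open>A processed column j is never changed again, and its pivot row is cleared in all later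
  columns. Only later columns are added from then on, so that row stays zero in them and none of
  them can have its pivot there.\<close>

lemma distinct_pivots_column_reduction:
  assumes "distinct cs"
  shows "distinct_pivots rs (set cs) (column_reduction rs cs A)"
  unfolding column_reduction_def
  using assms
proof (induction rs cs A rule: column_ops.induct)
  case (1 rs A)
  then show ?case by (simp add: distinct_pivots_def)
next
  case (2 rs j ks A)
  show ?case
  proof (cases "pivot rs (\<lambda>i. A i j)")
    case None
    \<comment> \<open>A zero column stays zero, so it has no pivot that could coincide with another
      one.\<close>
    have "fold apply_op (column_ops rs ks A) A i j = A i j" for i
      using 2(3) column_ops_precedes[of ks _ _ _ rs A]
      by (intro fold_apply_op_unchanged) (auto dest: precedes_in_set)
    then have "pivot rs (\<lambda>i. fold apply_op (column_ops rs ks A) A i j) = None"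
      using None by simp
    then show ?thesis
      using 2(1)[OF None] 2(3) None unfolding distinct_pivots_def by auto
  next
    case (Some p)
    define ops where "ops = map (\<lambda>k. (j, k, - (A p k / A p j))) ks"
    define B where "B = fold apply_op ops A"
    define R where "R = fold apply_op (column_ops rs ks B) B"
    have p: "A p j \<noteq> 0" "p \<in> set rs" using Some pivot_SomeD by metis+
    have R: "R = fold apply_op (column_ops rs (j # ks) A) A"
      by (simp add: Some R_def B_def ops_def Let_def)
    have IH: "distinct_pivots rs (set ks) R"
      using 2(2)[OF Some refl] 2(3) unfolding R_def B_def ops_def by simp
    have B: "B i l = (if l \<in> set ks then A i l - A i j * (A p l / A p j) else A i l)" for i l
      unfolding B_def ops_def using 2(3) by (subst fold_apply_op_row) auto
    have Bp: "B p l = 0" if "l \<in> set ks" for l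
      using that p by (simp add: B)
    have "R i j = B i j" for i
      unfolding R_def using 2(3) column_ops_precedes[of ks _ _ _ rs B]
      by (intro fold_apply_op_unchanged) (auto dest: precedes_in_set)
    then have Rj: "R i j = A i j" for i
      using 2(3) by (simp add: B)
    have Rp: "R p l = 0" if "l \<in> set ks" for l
      unfolding R_def using that 2(3) Bp column_ops_precedes[of ks _ _ _ rs B]
      by (intro fold_apply_op_zero_row[where L = "set ks"]) (auto, meson precedes_in_set)
    have "pivot rs (\<lambda>i. R i l) \<noteq> Some p" if "l \<in> set ks" for l
      using Rp[OF that] by (auto dest: pivot_SomeD)
    then show ?thesis
      using IH Some unfolding R[symmetric] distinct_pivots_def by (auto simp: Rj)
  qed
qed

lemma column_reduction_eq_mmul:
  assumes "distinct cs" "l \<in> set cs"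
  shows "column_reduction rs cs A i l = mmul (set cs) A (column_multiplier rs cs A) i l"
  unfolding column_reduction_def column_multiplier_def
  using assms by (intro fold_apply_op_eq_mmul) (auto dest: column_ops_precedes)

lemma column_multiplier_inverse:
  assumes "distinct cs"
  obtains B where "upper_triangular cs (column_multiplier rs cs A)" "upper_triangular cs B"
    "minverts (set cs) (column_multiplier rs cs A) B"
  using op_product_inverse[OF assms, of "column_ops rs cs A"] assms
  unfolding column_multiplier_def by (auto dest: column_ops_precedes)

section \<open>Prefixes and suffixes of an order and their coordinate spaces\<close>

definition initial :: "'j list \<Rightarrow> 'j set \<Rightarrow> bool" where
  "initial xs P \<longleftrightarrow> P \<subseteq> set xs \<and> (\<forall>i k. precedes xs i k \<longrightarrow> k \<in> P \<longrightarrow> i \<in> P)"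

text \<open>In a list without repetitions, \<open>initial\<close> sets are the prefixes and
  \<open>final\<close> sets the suffixes. Prefixes are suited to columns, whose coordinate spaces
  triangular matrices preserve; suffixes are suited to rows, because a column is supported in a
  suffix as soon as its pivot lies there.\<close>

definition final :: "'j list \<Rightarrow> 'j set \<Rightarrow> bool" where
  "final xs Q \<longleftrightarrow> Q \<subseteq> set xs \<and> (\<forall>i k. precedes xs i k \<longrightarrow> i \<in> Q \<longrightarrow> k \<in> Q)"

lemma upper_triangular_coord:
  assumes "upper_triangular cs A" "initial cs P" "v \<in> coord P"
  shows "mvec (set cs) (set cs) A v \<in> coord P"
  unfolding coord_def
proof (intro CollectI allI impI)
  fix i assume i: "mvec (set cs) (set cs) A v i \<noteq> 0"
  then have "i \<in> set cs" "(\<Sum>j\<in>set cs. A i j * v j) \<noteq> 0"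
    by (auto simp: mvec_def split: if_splits)
  then obtain j where "j \<in> set cs" "A i j \<noteq> 0" "v j \<noteq> 0"
    by (auto elim!: sum.not_neutral_contains_not_neutral)
  with \<open>i \<in> set cs\<close> assms show "i \<in> P"
    unfolding upper_triangular_def initial_def coord_def by blast
qed

text \<open>The multiplier and its inverse are both triangular, so each maps \<open>coord P\<close>
  into itself.\<close>

lemma column_multiplier_coord:
  assumes "distinct cs" "initial cs P"
  shows "mvec (set cs) (set cs) (column_multiplier rs cs A) ` coord P = coord P"
proof -
  obtain B where B: "upper_triangular cs (column_multiplier rs cs A)" "upper_triangular cs B"
      "minverts (set cs) (column_multiplier rs cs A) B"
    using column_multiplier_inverse[OF assms(1)] .
  have "v \<in> mvec (set cs) (set cs) (column_multiplier rs cs A) ` coord P" if v: "v \<in> coord P" for v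
  proof
    show "mvec (set cs) (set cs) B v \<in> coord P"
      using B assms v upper_triangular_coord by blast
    show "v = mvec (set cs) (set cs) (column_multiplier rs cs A) (mvec (set cs) (set cs) B v)"
      using minverts_mvec(1)[OF _ B(3)] v assms(2) by (auto simp: initial_def dest: coord_subsetD)
  qed
  then show ?thesis
    using upper_triangular_coord[OF B(1) assms(2)] by blast
qed

text \<open>The topmost pivot among the columns occurring in a combination lies in a row where no other
  of these columns is nonzero, so it cannot cancel.\<close>

lemma pivot_no_cancellation:
  assumes "finite J" "distinct_pivots rs J R" "final rs Q"
    and "\<And>i. i \<in> set rs \<Longrightarrow> i \<notin> Q \<Longrightarrow> (\<Sum>j\<in>J. R i j * c j) = 0"
    and "j \<in> J" "c j \<noteq> 0" "pivot rs (\<lambda>i. R i j) = Some p"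
  shows "p \<in> Q"
  using assms
proof (induction rs arbitrary: J Q)
  case (Cons r rs)
  show ?case
  proof (cases "\<exists>m\<in>J. c m \<noteq> 0 \<and> R r m \<noteq> 0")
    case True
    then obtain m where m: "m \<in> J" "c m \<noteq> 0" "R r m \<noteq> 0" by blast
    \<comment> \<open>A nonzero entry in the top row r makes r the pivot, so distinct pivots leave
      at most one such column.\<close>
    have "R r l = 0" if "l \<in> J" "l \<noteq> m" for l
      using Cons.prems(2) m that unfolding distinct_pivots_def by (auto split: if_splits)
    then have "(\<Sum>l\<in>J. R r l * c l) = (\<Sum>l\<in>J. if l = m then R r m * c m else 0)"
      by (intro sum.cong) auto
    also have "\<dots> = R r m * c m"
      using Cons.prems(1) m by simp
    also have "\<dots> \<noteq> 0"
      using m by simp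
    finally have "r \<in> Q"
      using Cons.prems(4)[of r] by auto
    \<comment> \<open>A suffix that contains the head contains the whole list, and in particular
      p.\<close>
    then show ?thesis
      using Cons.prems(3,7) unfolding final_def by (auto split: if_splits dest: pivot_SomeD)
  next
    case False
    \<comment> \<open>Columns with coefficient zero have to be dropped: they may be nonzero in row
      r, and removing r would then change their pivots and could destroy distinctness.\<close>
    let ?J = "{l\<in>J. c l \<noteq> 0}"
    have piv: "pivot (r # rs) (\<lambda>i. R i l) = pivot rs (\<lambda>i. R i l)" if "l \<in> ?J" for l
      using False that by auto
    have "p \<in> Q \<inter> set rs"
    proof (rule Cons.IH[of ?J])
      show "distinct_pivots rs ?J R"
        using Cons.prems(2) piv unfolding distinct_pivots_def by (metis (no_types, lifting) mem_Collect_eq)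
      show "final rs (Q \<inter> set rs)"
        using Cons.prems(3) unfolding final_def by (auto dest: precedes_in_set)
      show "(\<Sum>l\<in>?J. R i l * c l) = 0" if "i \<in> set rs" "i \<notin> Q \<inter> set rs" for i
      proof -
        have "(\<Sum>l\<in>?J. R i l * c l) = (\<Sum>l\<in>J. R i l * c l)"
          using Cons.prems(1) by (intro sum.mono_neutral_left) auto
        then show ?thesis using Cons.prems(4)[of i] that by auto
      qed
    qed (use Cons.prems piv[of j] in auto)
    then show ?thesis by simp
  qed
qed simp


section \<open>The kernel procedure on coordinate spaces\<close>

text \<open>The matrix returned by the kernel procedure. Its transpose, taken for the transposed X
  with rows and columns interchanged, is the matrix of the cokernel procedure, so the lemmas on it
  serve both.\<close>

definition rereduced :: "'i list \<Rightarrow> 'j list \<Rightarrow> ('i \<Rightarrow> 'j \<Rightarrow> 'f::field) \<Rightarrow> 'j list \<Rightarrow> 'j list \<Rightarrow> 'j \<Rightarrow> 'j \<Rightarrow> 'f" where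
  "rereduced rs cs X rs' cs' = column_reduction rs' cs' (column_multiplier rs cs X)"

lemma rereduced_factor:
  assumes "distinct cs'" "set cs' = set cs"
  shows "mvec (set cs) (set cs) (rereduced rs cs X rs' cs') v =
    mvec (set cs) (set cs) (column_multiplier rs cs X)
      (mvec (set cs) (set cs) (column_multiplier rs' cs' (column_multiplier rs cs X)) v)"
  unfolding mvec_mmul[symmetric] rereduced_def
  using assms by (intro mvec_cong) (metis column_reduction_eq_mmul)

text \<open>The two multipliers are triangular for different orders, so their product need not be
  triangular for either of them; the inverse is taken factor by factor.\<close>

lemma rereduced_minvertible:
  assumes "distinct cs" "distinct cs'" "set cs' = set cs"
  shows "minvertible (set cs) (rereduced rs cs X rs' cs')"
proof -
  let ?T = "column_multiplier rs cs X"
  obtain B where B: "minverts (set cs) ?T B"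
    using column_multiplier_inverse[OF assms(1)] by metis
  obtain B' where B': "minverts (set cs) (column_multiplier rs' cs' ?T) B'"
    using column_multiplier_inverse[OF assms(2)] assms(3) by metis
  have "minverts (set cs) (mmul (set cs) ?T (column_multiplier rs' cs' ?T)) (mmul (set cs) B' B)"
    using B B' by (simp add: minverts_mmul)
  then have "minverts (set cs) (rereduced rs cs X rs' cs') (mmul (set cs) B' B)"
    unfolding rereduced_def using assms column_reduction_eq_mmul[OF assms(2)]
    by (subst minverts_cong) auto
  then show ?thesis by (auto simp: minvertible_def)
qed

text \<open>Here P stands for the bars of the domain born by t, Q for the bars of the codomain dead
  at t, and P'' for the bars of the kernel born by t. Writing v = T c with c in
  \<open>coord P\<close> gives X v as a combination of reduced columns. By the absence of
  cancellation it is supported in Q exactly when every column that occurs has its pivot, if any, in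
  Q.\<close>

lemma rereduced_kernel:
  assumes cs: "distinct cs" "distinct cs'" "set cs' = set cs"
    and P: "initial cs P" and Q: "final rs Q"
    and P'': "P'' = {j\<in>P. \<forall>p. pivot rs (\<lambda>i. column_reduction rs cs X i j) = Some p \<longrightarrow> p \<in> Q}"
    and init: "initial cs' P''"
  shows "mvec (set cs) (set cs) (rereduced rs cs X rs' cs') ` coord P'' =
    {v \<in> coord P. mvec (set rs) (set cs) X v \<in> coord Q}"
proof -
  let ?J = "set cs" and ?T = "column_multiplier rs cs X" and ?R = "column_reduction rs cs X"
  \<comment> \<open>The second multiplier maps \<open>coord P''\<close> onto itself, because P'' is
    a prefix of the new order; only the first multiplier remains to be considered.\<close>
  have image: "mvec ?J ?J (rereduced rs cs X rs' cs') ` coord P'' = mvec ?J ?J ?T ` coord P''"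
    using column_multiplier_coord[OF cs(2) init, of rs' ?T]
    unfolding rereduced_factor[OF cs(2,3)] cs(3) by (metis (no_types, lifting) image_cong image_image)
  have XT: "mvec (set rs) ?J X (mvec ?J ?J ?T c) = mvec (set rs) ?J ?R c" for c
    unfolding mvec_mmul[symmetric] by (intro mvec_cong) (simp add: column_reduction_eq_mmul[OF cs(1)])
  have "mvec ?J ?J ?T c \<in> coord P \<and> mvec (set rs) ?J X (mvec ?J ?J ?T c) \<in> coord Q"
    if c: "c \<in> coord P''" for c
  proof
    have "c \<in> coord P" using c P'' by (auto simp: coord_def)
    then show "mvec ?J ?J ?T c \<in> coord P"
      using column_multiplier_coord[OF cs(1) P] by blast
    \<comment> \<open>The nonzero rows of a column lie at or after its pivot, hence in the suffix Q
      once the pivot does.\<close>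
    have "i \<in> Q" if i: "mvec (set rs) ?J ?R c i \<noteq> 0" for i
    proof -
      from i have "i \<in> set rs" "(\<Sum>j\<in>?J. ?R i j * c j) \<noteq> 0"
        by (auto simp: mvec_def split: if_splits)
      then obtain j where j: "j \<in> ?J" "?R i j \<noteq> 0" "c j \<noteq> 0"
        by (auto elim!: sum.not_neutral_contains_not_neutral)
      then obtain p where p: "pivot rs (\<lambda>i. ?R i j) = Some p"
        using \<open>i \<in> set rs\<close> by (metis pivot_None_iff option.exhaust)
      have "p \<in> Q"
        using j c p P'' by (auto simp: coord_def)
      then show "i \<in> Q"
        using pivot_least[OF p \<open>i \<in> set rs\<close> j(2)] Q by (auto simp: final_def)
    qed
    then show "mvec (set rs) ?J X (mvec ?J ?J ?T c) \<in> coord Q"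
      unfolding XT by (auto simp: coord_def)
  qed
  moreover have "v \<in> mvec ?J ?J ?T ` coord P''"
    if v: "v \<in> coord P" "mvec (set rs) ?J X v \<in> coord Q" for v
  proof -
    obtain c where c: "c \<in> coord P" "v = mvec ?J ?J ?T c"
      using column_multiplier_coord[OF cs(1) P, of rs X] v(1) by blast
    have zero: "(\<Sum>j\<in>?J. ?R i j * c j) = 0" if "i \<in> set rs" "i \<notin> Q" for i
    proof -
      have "mvec (set rs) ?J ?R c i = 0"
        using v(2) that unfolding c(2) XT by (auto simp: coord_def)
      then show ?thesis using that by (simp add: mvec_def)
    qed
    have "j \<in> P''" if j: "c j \<noteq> 0" for j
    proof -
      have "j \<in> P" using c(1) j by (simp add: coord_def)
      moreover have "p \<in> Q" if "pivot rs (\<lambda>i. ?R i j) = Some p" for p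
        using pivot_no_cancellation[OF _ distinct_pivots_column_reduction[OF cs(1)] Q zero] that j
          \<open>j \<in> P\<close> P by (auto simp: initial_def)
      ultimately show ?thesis by (simp add: P'')
    qed
    then show ?thesis using c by (auto simp: coord_def)
  qed
  ultimately show ?thesis unfolding image by blast
qed

lemma minvertible_pivot:
  assumes inv: "minvertible (set rs) A" and j: "j \<in> set rs"
  obtains p where "pivot rs (\<lambda>i. A i j) = Some p"
proof (cases "pivot rs (\<lambda>i. A i j)")
  case None
  then have zero: "A i j = 0" if "i \<in> set rs" for i
    using that pivot_None_iff by metis
  obtain B where "minverts (set rs) A B"
    using inv by (auto simp: minvertible_def)
  then have "mmul (set rs) B A j j = 1"
    using j by (simp add: minverts_def mone_def)
  moreover have "mmul (set rs) B A j j = 0"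
    using zero by (simp add: mmul_def)
  ultimately show ?thesis by simp
qed

text \<open>The argument about pivots is now applied to T itself, with rows ordered by death: T is
  invertible with distinct pivots, so the columns whose pivot lies in the suffix P form a basis of
  \<open>coord P\<close>.\<close>

lemma rereduced_final:
  assumes cs: "distinct cs" "distinct cs'" "set cs' = set cs" and rs': "set rs' = set cs"
    and P: "final rs' P"
    and T: "T = rereduced rs cs X rs' cs'"
    and P'': "P'' = {j\<in>set cs. the (pivot rs' (\<lambda>i. T i j)) \<in> P}"
  shows "mvec (set cs) (set cs) T ` coord P'' = coord P"
proof -
  let ?J = "set cs"
  have inv: "minvertible ?J T"
    using rereduced_minvertible[OF cs] T by simp
  then obtain B where B: "minverts ?J T B" by (auto simp: minvertible_def)
  have piv: "\<exists>p. pivot rs' (\<lambda>i. T i j) = Some p" if "j \<in> ?J" for j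
    using minvertible_pivot[of rs' T j] inv rs' that by auto
  have "mvec ?J ?J T c \<in> coord P" if c: "c \<in> coord P''" for c
    unfolding coord_def
  proof (intro CollectI allI impI)
    fix i assume i: "mvec ?J ?J T c i \<noteq> 0"
    then have "i \<in> ?J" "(\<Sum>j\<in>?J. T i j * c j) \<noteq> 0"
      by (auto simp: mvec_def split: if_splits)
    then obtain j where j: "j \<in> ?J" "T i j \<noteq> 0" "c j \<noteq> 0"
      by (auto elim!: sum.not_neutral_contains_not_neutral)
    obtain p where p: "pivot rs' (\<lambda>i. T i j) = Some p"
      using piv[OF j(1)] by blast
    have "p \<in> P" using c j p P'' by (auto simp: coord_def)
    then show "i \<in> P"
      using pivot_least[OF p, of i] \<open>i \<in> ?J\<close> rs' j(2) P unfolding final_def by blast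
  qed
  moreover have "v \<in> mvec ?J ?J T ` coord P''" if v: "v \<in> coord P" for v
  proof
    let ?c = "mvec ?J ?J B v"
    have "P \<subseteq> ?J" using P rs' by (simp add: final_def)
    then show Tc: "v = mvec ?J ?J T ?c"
      using minverts_mvec(1)[OF _ B] v coord_subsetD by (metis List.finite_set)
    \<comment> \<open>T maps ?c to v, which vanishes off P; so every column occurring in ?c must
      have its pivot in P.\<close>
    have zero: "(\<Sum>j\<in>?J. T i j * ?c j) = 0" if "i \<in> set rs'" "i \<notin> P" for i
    proof -
      have "v i = 0" using v that by (auto simp: coord_def)
      then show ?thesis
        using that rs' by (subst (asm) Tc) (simp add: mvec_def[of ?J ?J T])
    qed
    have "j \<in> P''" if "?c j \<noteq> 0" for j
    proof -
      have j: "j \<in> ?J" using that by (auto simp: mvec_def split: if_splits)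
      obtain p where p: "pivot rs' (\<lambda>i. T i j) = Some p"
        using piv[OF j] by blast
      have "distinct_pivots rs' ?J T"
        using distinct_pivots_column_reduction[OF cs(2)] cs(3) unfolding T rereduced_def by metis
      then have "p \<in> P"
        using pivot_no_cancellation[where c = ?c and R = T, OF _ _ P zero] j p that by blast
      then show ?thesis using j p by (simp add: P'')
    qed
    then show "?c \<in> coord P''" by (simp add: coord_def)
  qed
  ultimately show ?thesis by blast
qed

section \<open>The cokernel procedure on coordinate spaces\<close>

text \<open>A basis of W together with w is independent, so some functional on the space of all
  functions vanishes on W and not at w. Since I is finite and w and W live in
  \<open>coord I\<close>, its values on the unit vectors of I suffice to describe it there.\<close>

lemma separating_functional:
  assumes "finite I" "w \<in> coord I" "w \<notin> W" "W \<subseteq> coord I"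
    and zero: "(\<lambda>_. 0) \<in> W"
    and add: "\<And>u v. u \<in> W \<Longrightarrow> v \<in> W \<Longrightarrow> (\<lambda>i. u i + v i) \<in> W"
    and scale: "\<And>a v. v \<in> W \<Longrightarrow> (\<lambda>i. a * v i) \<in> W"
  obtains y :: "'i \<Rightarrow> 'f::field"
    where "y \<in> coord I" "\<And>x. x \<in> W \<Longrightarrow> (\<Sum>i\<in>I. y i * x i) = 0" "(\<Sum>i\<in>I. y i * w i) \<noteq> 0"
proof -
  interpret V: vector_space "\<lambda>(a::'f) (v::'i \<Rightarrow> 'f) i. a * v i"
    by unfold_locales (auto simp: algebra_simps fun_eq_iff)
  interpret P: vector_space_pair "\<lambda>(a::'f) (v::'i \<Rightarrow> 'f) i. a * v i" "(*) :: 'f \<Rightarrow> 'f \<Rightarrow> 'f"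
    by unfold_locales (auto simp: algebra_simps)
  have sub: "V.subspace W"
    using zero add scale by (auto simp: V.subspace_def zero_fun_def plus_fun_def)
  obtain B where B: "B \<subseteq> W" "V.independent B" "W \<subseteq> V.span B"
    using V.maximal_independent_subset by blast
  have "V.span B \<subseteq> W"
    using B(1) sub by (rule V.span_minimal)
  then have "V.independent (insert w B)"
    using B(2) assms(3) V.independent_insertI[of w B] by blast
  then obtain g where g: "Vector_Spaces.linear (\<lambda>(a::'f) (v::'i \<Rightarrow> 'f) i. a * v i) (*) g"
      "\<forall>x\<in>insert w B. g x = (if x = w then 1 else 0)"
    using P.linear_independent_extend[of "insert w B" "\<lambda>x. if x = w then 1 else 0"] by blast
  interpret g: Vector_Spaces.linear "\<lambda>(a::'f) (v::'i \<Rightarrow> 'f) i. a * v i" "(*)" g by (fact g(1))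
  let ?e = "\<lambda>i k. if k = i then 1 else (0::'f)"
  \<comment> \<open>The coordinates of the functional on the unit vectors; off I they are set to 0,
    so that y lies in \<open>coord I\<close>.\<close>
  define y where "y i = (if i \<in> I then g (?e i) else 0)" for i
  have gx: "g x = (\<Sum>i\<in>I. y i * x i)" if "x \<in> coord I" for x
  proof -
    have "x = (\<Sum>i\<in>I. (\<lambda>k. x i * ?e i k))"
    proof
      fix k
      have sum_apply: "(\<Sum>i\<in>A. h i) k = (\<Sum>i\<in>A. h i k)" for A and h :: "'i \<Rightarrow> 'i \<Rightarrow> 'f"
        by (induction A rule: infinite_finite_induct) auto
      show "x k = (\<Sum>i\<in>I. (\<lambda>k. x i * ?e i k)) k"
        unfolding sum_apply using that \<open>finite I\<close> by (auto simp: coord_def if_distrib cong: if_cong)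
    qed
    then have "g x = g (\<Sum>i\<in>I. (\<lambda>k. x i * ?e i k))"
      by (rule arg_cong)
    also have "\<dots> = (\<Sum>i\<in>I. g (\<lambda>k. x i * ?e i k))"
      by (rule g.sum)
    also have "\<dots> = (\<Sum>i\<in>I. y i * x i)"
      by (intro sum.cong refl) (simp only: g.scale y_def if_True mult.commute)
    finally show ?thesis .
  qed
  have "g x = 0" if "x \<in> W" for x
  proof -
    have "x \<in> V.span B" using that B(3) by blast
    moreover have "g b = 0" if "b \<in> B" for b
      using g(2) that B(1) assms(3) by auto
    ultimately show ?thesis
      using P.linear_eq_0_on_span[OF g(1)] by blast
  qed
  moreover have "g w = 1" using g(2) by simp
  moreover have "y \<in> coord I" by (simp add: y_def coord_def)
  ultimately show ?thesis
    using that[of y] gx assms(2,4) by (metis subsetD zero_neq_one)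
qed

definition dot :: "'i set \<Rightarrow> ('i \<Rightarrow> 'f::field) \<Rightarrow> ('i \<Rightarrow> 'f) \<Rightarrow> 'f" where
  "dot I y w = (\<Sum>i\<in>I. y i * w i)"

lemma dot_mvec_mtranspose: "dot I (mvec I J (mtranspose A) z) w = dot J z (mvec J I A w)"
proof -
  have "dot I (mvec I J (mtranspose A) z) w = (\<Sum>i\<in>I. \<Sum>j\<in>J. A j i * z j * w i)"
    by (simp add: dot_def mvec_def mtranspose_def sum_distrib_right)
  also have "\<dots> = (\<Sum>j\<in>J. \<Sum>i\<in>I. A j i * z j * w i)"
    by (rule sum.swap)
  also have "\<dots> = dot J z (mvec J I A w)"
    by (simp add: dot_def mvec_def sum_distrib_left mult.assoc mult.left_commute)
  finally show ?thesis .
qed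

lemma dot_unit: "finite I \<Longrightarrow> i \<in> I \<Longrightarrow> dot I (\<lambda>k. if k = i then 1 else 0) w = w i"
  by (simp add: dot_def if_distrib[of "\<lambda>x. x * _"] cong: if_cong)

lemma dot_unit_right: "finite I \<Longrightarrow> i \<in> I \<Longrightarrow> dot I w (\<lambda>k. if k = i then 1 else 0) = w i"
  by (simp add: dot_def if_distrib cong: if_cong)

text \<open>Coordinate spaces of complementary sets are annihilators of each other; one direction is
  tested on the unit vectors outside P.\<close>

lemma coord_annihilator:
  assumes "finite I" "w \<in> coord I"
  shows "(\<forall>y\<in>coord (I - P). dot I y w = 0) \<longleftrightarrow> w \<in> coord P"
proof
  assume zero: "\<forall>y\<in>coord (I - P). dot I y w = 0"
  show "w \<in> coord P"
    unfolding coord_def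
  proof (intro CollectI allI impI, rule ccontr)
    fix i assume i: "w i \<noteq> 0" "i \<notin> P"
    then have "i \<in> I" using assms by (simp add: coord_def)
    then have "(\<lambda>k. if k = i then 1 else 0) \<in> coord (I - P)"
      using i by (simp add: coord_def)
    then have "dot I (\<lambda>k. if k = i then 1 else 0) w = 0"
      using zero by blast
    then show False using i dot_unit[OF assms(1) \<open>i \<in> I\<close>, of w] by metis
  qed
next
  assume "w \<in> coord P"
  then show "\<forall>y\<in>coord (I - P). dot I y w = 0"
    unfolding dot_def coord_def by (intro sum.neutral ballI) fastforce
qed

text \<open>Adjointness moves the test vectors across S. A statement on images under the transpose
  thereby becomes one on preimages under S, which is the form that a quotient map needs.\<close>

lemma mtranspose_annihilator:
  assumes "finite I" "w \<in> coord I" "mvec I I (mtranspose S) ` coord (I - P) = W"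
  shows "mvec I I S w \<in> coord P \<longleftrightarrow> (\<forall>y\<in>W. dot I y w = 0)"
  unfolding coord_annihilator[OF assms(1) mvec_in_coord, symmetric]
  using assms(3) dot_mvec_mtranspose[of I I S] by force

text \<open>The dual of \<open>rereduced_final\<close>: the complement of a prefix is a suffix, and
  annihilators turn complements back.\<close>

lemma corereduced_birth:
  assumes rs: "distinct rs" "distinct rs'" "set rs' = set rs" and cs': "set cs' = set rs"
    and E: "initial cs' E"
    and S: "S = mtranspose (rereduced cs rs Y cs' rs')"
    and E'': "E'' = {i\<in>set rs. the (pivot cs' (\<lambda>j. S i j)) \<in> E}"
    and w: "w \<in> coord (set rs)"
  shows "mvec (set rs) (set rs) S w \<in> coord E'' \<longleftrightarrow> w \<in> coord E"
proof -
  let ?I = "set rs"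
  \<comment> \<open>Needed to pass to complements: a pivot outside E must be known to exist and to
    lie in the index set.\<close>
  have piv: "the (pivot cs' (\<lambda>j. S i j)) \<in> ?I" if i: "i \<in> ?I" for i
  proof -
    obtain p where p: "pivot cs' (\<lambda>j. mtranspose S j i) = Some p"
    proof (rule minvertible_pivot)
      show "minvertible (set cs') (mtranspose S)"
        using rereduced_minvertible[OF rs, of cs Y cs'] by (simp add: S cs')
    qed (use i cs' in auto)
    then show ?thesis using pivot_SomeD[OF p] cs' by (simp add: mtranspose_def)
  qed
  have "mvec ?I ?I (mtranspose S) ` coord (?I - E'') = coord (?I - E)"
  proof (rule rereduced_final[OF rs cs'])
    show "final cs' (?I - E)"
      using E cs' unfolding final_def initial_def by (auto dest: precedes_in_set)
    show "mtranspose S = rereduced cs rs Y cs' rs'"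
      by (simp add: S)
    show "?I - E'' = {j \<in> ?I. the (pivot cs' (\<lambda>i. mtranspose S i j)) \<in> ?I - E}"
      using piv by (auto simp: E'' mtranspose_def)
  qed
  then show ?thesis
    using mtranspose_annihilator[of ?I w S E''] coord_annihilator[of ?I w E] w by auto
qed

text \<open>The dual of \<open>rereduced_kernel\<close>. The conditions on y there, to vanish on F
  and to have its image under the transpose vanish on E, say that y annihilates
  \<open>coord F\<close> and the image of \<open>coord E\<close>. By finite-dimensional duality the
  annihilator of all such y is the sum of these two spaces.\<close>

lemma corereduced_death:
  assumes rs: "distinct rs" "distinct rs'" "set rs' = set rs"
    and F: "final rs F" and E: "initial cs E"
    and F'': "F'' = {i\<in>set rs. i \<in> F \<or> (\<exists>p\<in>E. pivot cs (\<lambda>j. row_reduction rs cs X i j) = Some p)}"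
    and final: "final rs' F''"
    and S: "S = mtranspose (rereduced cs rs (mtranspose X) cs' rs')"
    and w: "w \<in> coord (set rs)"
  shows "mvec (set rs) (set rs) S w \<in> coord F'' \<longleftrightarrow>
    (\<exists>u\<in>coord F. \<exists>e\<in>coord E. w = (\<lambda>i. u i + mvec (set rs) (set cs) X e i))"
proof -
  let ?I = "set rs" and ?J = "set cs"
  let ?W = "{y \<in> coord (?I - F). mvec ?J ?I (mtranspose X) y \<in> coord (?J - E)}"
  have image: "mvec ?I ?I (mtranspose S) ` coord (?I - F'') = ?W"
    unfolding S mtranspose_mtranspose
  proof (rule rereduced_kernel[OF rs])
    show "initial rs (?I - F)"
      using F unfolding final_def initial_def by (auto dest: precedes_in_set)
    show "final cs (?J - E)"
      using E unfolding final_def initial_def by (auto dest: precedes_in_set)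
    show "initial rs' (?I - F'')"
      using final rs unfolding final_def initial_def by (auto dest: precedes_in_set)
    show "?I - F'' = {j \<in> ?I - F. \<forall>p. pivot cs (\<lambda>i. column_reduction cs rs (mtranspose X) i j) = Some p
        \<longrightarrow> p \<in> ?J - E}"
      unfolding F'' row_reduction_def mtranspose_def by (auto dest: pivot_SomeD)
  qed
  have "(\<forall>y\<in>?W. dot ?I y w = 0) \<longleftrightarrow>
      (\<exists>u\<in>coord F. \<exists>e\<in>coord E. w = (\<lambda>i. u i + mvec ?I ?J X e i))" (is "?L \<longleftrightarrow> ?R")
  proof
    assume ?R
    then obtain u e where u: "u \<in> coord F" and e: "e \<in> coord E"
      and w: "w = (\<lambda>i. u i + mvec ?I ?J X e i)" by blast
    show ?L
    proof
      fix y assume y: "y \<in> ?W"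
      have "dot ?I y u = 0"
        using u y unfolding dot_def coord_def by (intro sum.neutral ballI) fastforce
      moreover have "dot ?I y (mvec ?I ?J X e) = 0"
        unfolding dot_mvec_mtranspose[symmetric]
        using e y unfolding dot_def coord_def by (intro sum.neutral ballI) fastforce
      ultimately show "dot ?I y w = 0"
        unfolding w by (simp add: dot_def distrib_left sum.distrib)
    qed
  next
    assume L: ?L
    \<comment> \<open>The sum of the two spaces. If w were outside it, a functional y would separate
      them, and such a y is shown to lie in ?W, where it must annihilate w.\<close>
    let ?U = "{\<lambda>i. u i + mvec ?I ?J X e i | u e. u \<in> coord F \<and> e \<in> coord E}"
    have UI: "u \<in> coord F \<Longrightarrow> e \<in> coord E \<Longrightarrow> x = (\<lambda>i. u i + mvec ?I ?J X e i) \<Longrightarrow> x \<in> ?U" for x u e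
      by blast
    show ?R
    proof (rule ccontr)
      assume "\<not> ?R"
      then have "w \<notin> ?U" by blast
      obtain y where y: "y \<in> coord ?I" "\<And>x. x \<in> ?U \<Longrightarrow> (\<Sum>i\<in>?I. y i * x i) = 0"
          "(\<Sum>i\<in>?I. y i * w i) \<noteq> 0"
      proof (rule separating_functional[of ?I w ?U])
        show "?U \<subseteq> coord ?I"
          using F coord_add[OF coord_subsetD mvec_in_coord] unfolding final_def by blast
        show "(\<lambda>_. 0) \<in> ?U"
          by (rule UI[OF zero_in_coord zero_in_coord]) (simp add: mvec_zero)
        show "(\<lambda>i. a * v i) \<in> ?U" if v: "v \<in> ?U" for a v
        proof -
          obtain u e where "u \<in> coord F" "e \<in> coord E" "v = (\<lambda>i. u i + mvec ?I ?J X e i)"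
            using v by blast
          then show ?thesis
            by (intro UI[OF coord_scale[of u F a] coord_scale[of e E a]])
              (simp_all add: mvec_scale distrib_left)
        qed
        show "(\<lambda>i. v i + v' i) \<in> ?U" if v: "v \<in> ?U" "v' \<in> ?U" for v v'
        proof -
          obtain u e where "u \<in> coord F" "e \<in> coord E" "v = (\<lambda>i. u i + mvec ?I ?J X e i)"
            using v(1) by blast
          moreover obtain u' e' where "u' \<in> coord F" "e' \<in> coord E" "v' = (\<lambda>i. u' i + mvec ?I ?J X e' i)"
            using v(2) by blast
          ultimately show ?thesis
            by (intro UI[OF coord_add[of u F u'] coord_add[of e E e']]) (simp_all add: mvec_add ac_simps)
        qed
      qed (use w \<open>w \<notin> ?U\<close> in auto)
      have dot0: "dot ?I y x = 0" if "x \<in> ?U" for x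
        using y(2)[OF that] by (simp add: dot_def)
      \<comment> \<open>The unit vectors of F belong to ?U and are tested here.\<close>
      have "y i = 0" if "i \<in> F" for i
      proof -
        have "(\<lambda>k. if k = i then 1 else 0) \<in> ?U"
          using that by (intro UI[OF _ zero_in_coord, of "\<lambda>k. if k = i then 1 else 0"])
            (simp_all add: coord_def mvec_zero)
        then show ?thesis
          using dot0 dot_unit_right[of ?I i y] that F by (auto simp: final_def)
      qed
      then have "y \<in> coord (?I - F)"
        using y(1) by (auto simp: coord_def)
      \<comment> \<open>The images under X of the unit vectors of E belong to ?U and are tested
        here, by adjointness.\<close>
      moreover have "mvec ?J ?I (mtranspose X) y j = 0" if "j \<in> E" for j
      proof -
        have j: "j \<in> ?J" using that E by (auto simp: initial_def)
        let ?e = "\<lambda>k. if k = j then 1 else 0"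
        have "mvec ?I ?J X ?e \<in> ?U"
          using that by (intro UI[OF zero_in_coord, of ?e]) (auto simp: coord_def)
        then have "dot ?J (mvec ?J ?I (mtranspose X) y) ?e = 0"
          using dot0[of "mvec ?I ?J X ?e"] by (simp only: dot_mvec_mtranspose)
        then show ?thesis using dot_unit_right[OF _ j, of "mvec ?J ?I (mtranspose X) y"] by simp
      qed
      then have "mvec ?J ?I (mtranspose X) y \<in> coord (?J - E)"
        using mvec_in_coord[of ?J ?I "mtranspose X" y] unfolding coord_def by blast
      ultimately have "dot ?I y w = 0" using L by blast
      then show False using y(3) by (simp add: dot_def)
    qed
  qed
  then show ?thesis
    using mtranspose_annihilator[OF _ w image] by simp
qed

section \<open>Vector spaces and persistence modules\<close>

lemma persistence_module_vectorspace: "persistence_module A \<Longrightarrow> vectorspace class_ring (space A t)"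
  by (simp add: persistence_module_def)

lemma persistence_module_transition_hom:
  "persistence_module A \<Longrightarrow> s \<le> t \<Longrightarrow>
   transition A s t \<in> LinearCombinations.module_hom class_ring (space A s) (space A t)"
  by (simp add: persistence_module_def)

lemma module_hom_mem:
  "f \<in> LinearCombinations.module_hom K V W \<Longrightarrow> x \<in> carrier V \<Longrightarrow> f x \<in> carrier W"
  using module_hom_closed by blast

lemma module_hom_scale:
  "f \<in> LinearCombinations.module_hom class_ring V W \<Longrightarrow> x \<in> carrier V \<Longrightarrow>
   f (a \<odot>\<^bsub>V\<^esub> x) = a \<odot>\<^bsub>W\<^esub> f x"
  unfolding LinearCombinations.module_hom_def by (simp only: mem_Collect_eq partial_object.simps UNIV_I)

lemma vectorspace_module: "vectorspace K V \<Longrightarrow> Module.module K V"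
  by (rule vectorspace.axioms(1))

lemma vectorspace_abelian_group: "vectorspace K V \<Longrightarrow> abelian_group V"
  by (rule module.axioms(2)[OF vectorspace_module])

lemma vectorspace_smult_zero:
  assumes "vectorspace class_ring V" "x \<in> carrier V"
  shows "0 \<odot>\<^bsub>V\<^esub> x = \<zero>\<^bsub>V\<^esub>"
  using module.smult_l_null[OF vectorspace_module[OF assms(1)] assms(2)] by simp

lemma module_hom_zero:
  assumes "f \<in> LinearCombinations.module_hom class_ring V W" "vectorspace class_ring V" "vectorspace class_ring W"
  shows "f \<zero>\<^bsub>V\<^esub> = \<zero>\<^bsub>W\<^esub>"
proof -
  have zero: "\<zero>\<^bsub>V\<^esub> \<in> carrier V"
    using abelian_monoid.zero_closed[OF abelian_group.axioms(1)[OF vectorspace_abelian_group[OF assms(2)]]] .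
  have "f (0 \<odot>\<^bsub>V\<^esub> \<zero>\<^bsub>V\<^esub>) = 0 \<odot>\<^bsub>W\<^esub> f \<zero>\<^bsub>V\<^esub>"
    using assms(1) zero by (rule module_hom_scale)
  then show ?thesis
    using vectorspace_smult_zero[OF assms(2) zero]
      vectorspace_smult_zero[OF assms(3) module_hom_mem[OF assms(1) zero]] by simp
qed

lemma pmod_hom_module_hom:
  "pmod_hom A B \<phi> \<Longrightarrow> \<phi> t \<in> LinearCombinations.module_hom class_ring (space A t) (space B t)"
  by (simp add: pmod_hom_def)

lemma pmod_hom_transition:
  "pmod_hom A B \<phi> \<Longrightarrow> s \<le> t \<Longrightarrow> x \<in> carrier (space A s) \<Longrightarrow>
   \<phi> t (transition A s t x) = transition B s t (\<phi> s x)"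
  by (simp add: pmod_hom_def)

lemma (in abelian_group) add_eq_right_iff:
  "x \<in> carrier G \<Longrightarrow> y \<in> carrier G \<Longrightarrow> x \<oplus> y = y \<longleftrightarrow> x = \<zero>"
  by (metis add.m_comm add.l_cancel_one)


section \<open>Presentations of persistence modules\<close>

definition born :: "('r::linorder, 'j) barcode \<Rightarrow> 'r \<Rightarrow> 'j set" where
  "born \<A> t = {j\<in>bars \<A>. t \<in> upper (birth \<A> j)}"

definition dead :: "('r::linorder, 'j) barcode \<Rightarrow> 'r \<Rightarrow> 'j set" where
  "dead \<A> t = {j\<in>bars \<A>. t \<notin> lower (death \<A> j)}"

text \<open>The map \<pi> runs from coordinates to the module, opposite to the isomorphism of an
  interval decomposition, so an element has many coordinate vectors, differing by dead bars. The
  transition axiom says that a vector presenting an element keeps presenting it at later times.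
  Taken over all t, \<open>dead_born\<close> says that every bar has birth \<le> death.\<close>

locale presents =
  fixes A :: "('r::linorder, 'f::field, 'v) pmod"
    and \<A> :: "('r, 'j) barcode"
    and \<pi> :: "'r \<Rightarrow> ('j \<Rightarrow> 'f) \<Rightarrow> 'v"
  assumes pmod: "persistence_module A"
    and finite_bars: "finite (bars \<A>)"
    and dead_born: "dead \<A> t \<subseteq> born \<A> t"
    and closed: "v \<in> coord (born \<A> t) \<Longrightarrow> \<pi> t v \<in> carrier (space A t)"
    and surj: "x \<in> carrier (space A t) \<Longrightarrow> \<exists>v\<in>coord (born \<A> t). x = \<pi> t v"
    and add: "u \<in> coord (born \<A> t) \<Longrightarrow> v \<in> coord (born \<A> t) \<Longrightarrow>
      \<pi> t (\<lambda>j. u j + v j) = \<pi> t u \<oplus>\<^bsub>space A t\<^esub> \<pi> t v"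
    and scale: "v \<in> coord (born \<A> t) \<Longrightarrow> \<pi> t (\<lambda>j. a * v j) = a \<odot>\<^bsub>space A t\<^esub> \<pi> t v"
    and zero_iff: "v \<in> coord (born \<A> t) \<Longrightarrow> \<pi> t v = \<zero>\<^bsub>space A t\<^esub> \<longleftrightarrow> v \<in> coord (dead \<A> t)"
    and transition: "s \<le> t \<Longrightarrow> v \<in> coord (born \<A> s) \<Longrightarrow> transition A s t (\<pi> s v) = \<pi> t v"

definition filtered :: "('r::linorder, 'j) barcode \<Rightarrow> ('r, 'i) barcode \<Rightarrow> ('i \<Rightarrow> 'j \<Rightarrow> 'f::field) \<Rightarrow> bool" where
  "filtered \<A> \<B> X \<longleftrightarrow> (\<forall>t.
     mvec (bars \<B>) (bars \<A>) X ` coord (born \<A> t) \<subseteq> coord (born \<B> t) \<and>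
     mvec (bars \<B>) (bars \<A>) X ` coord (dead \<A> t) \<subseteq> coord (dead \<B> t))"

definition induces ::
  "('r::linorder, 'j) barcode \<Rightarrow> ('r \<Rightarrow> ('j \<Rightarrow> 'f::field) \<Rightarrow> 'v) \<Rightarrow> ('r, 'i) barcode \<Rightarrow>
   ('r \<Rightarrow> ('i \<Rightarrow> 'f) \<Rightarrow> 'w) \<Rightarrow> ('r \<Rightarrow> 'v \<Rightarrow> 'w) \<Rightarrow> ('i \<Rightarrow> 'j \<Rightarrow> 'f) \<Rightarrow> bool" where
  "induces \<A> \<pi> \<B> \<rho> \<phi> X \<longleftrightarrow> filtered \<A> \<B> X \<and>
     (\<forall>t. \<forall>v\<in>coord (born \<A> t). \<phi> t (\<pi> t v) = \<rho> t (mvec (bars \<B>) (bars \<A>) X v))"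

abbreviation interval_sum :: "('r::linorder, 'j) barcode \<Rightarrow> ('r, 'f::field, 'j \<Rightarrow> 'f) pmod" where
  "interval_sum \<A> \<equiv> pmod_direct_sum (bars \<A>) (\<lambda>j. interval_module (birth \<A> j) (death \<A> j))"

text \<open>The passage from \<open>coord (born \<A> t)\<close> to its quotient by
  \<open>coord (dead \<A> t)\<close>, with the quotient realised as the fibre of the sum of interval
  modules; hence the extensional functions.\<close>

definition restrict_alive :: "('r::linorder, 'j) barcode \<Rightarrow> 'r \<Rightarrow> ('j \<Rightarrow> 'f::field) \<Rightarrow> 'j \<Rightarrow> 'f" where
  "restrict_alive \<A> t v = (\<lambda>j\<in>bars \<A>. if t \<in> bar_interval (birth \<A> j) (death \<A> j) then v j else 0)"

definition proj ::
  "('r::linorder, 'f::field, 'v) pmod \<Rightarrow> ('r, 'j) barcode \<Rightarrow> ('r \<Rightarrow> 'v \<Rightarrow> 'j \<Rightarrow> 'f) \<Rightarrow>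
   'r \<Rightarrow> ('j \<Rightarrow> 'f) \<Rightarrow> 'v" where
  "proj A \<A> \<alpha> t v = inv_into (carrier (space A t)) (\<alpha> t) (restrict_alive \<A> t v)"

lemma born_subset: "born \<A> t \<subseteq> bars \<A>" and dead_subset: "dead \<A> t \<subseteq> bars \<A>"
  by (auto simp: born_def dead_def)

lemma alive_iff:
  "j \<in> bars \<A> \<Longrightarrow> t \<in> bar_interval (birth \<A> j) (death \<A> j) \<longleftrightarrow> j \<in> born \<A> t \<and> j \<notin> dead \<A> t"
  by (auto simp: born_def dead_def bar_interval_def)

lemma upper_closed: "x \<in> upper c \<Longrightarrow> x \<le> y \<Longrightarrow> y \<in> upper c"
  using lower_closed[of y c x] by (auto simp: upper_eq)

lemma born_mono: "s \<le> t \<Longrightarrow> born \<A> s \<subseteq> born \<A> t"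
  by (auto simp: born_def intro: upper_closed)

lemma dead_mono: "s \<le> t \<Longrightarrow> dead \<A> s \<subseteq> dead \<A> t"
  by (auto simp: dead_def dest: lower_closed)

lemma presents_surj:
  assumes "presents A \<A> \<pi>" "x \<in> carrier (space A t)"
  obtains v where "v \<in> coord (born \<A> t)" "x = \<pi> t v"
  using presents.surj[OF assms] by blast

lemma presents_vectorspace: "presents A \<A> \<pi> \<Longrightarrow> vectorspace class_ring (space A t)"
  by (rule persistence_module_vectorspace[OF presents.pmod])

lemma presents_eq_iff:
  assumes A: "presents A \<A> \<pi>" and u: "u \<in> coord (born \<A> t)" and v: "v \<in> coord (born \<A> t)"
  shows "\<pi> t u = \<pi> t v \<longleftrightarrow> (\<lambda>j. u j - v j) \<in> coord (dead \<A> t)"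
proof -
  have "\<pi> t u = \<pi> t (\<lambda>j. u j - v j) \<oplus>\<^bsub>space A t\<^esub> \<pi> t v"
    using presents.add[OF A coord_diff[OF u v] v] by simp
  moreover have "x \<oplus>\<^bsub>space A t\<^esub> y = y \<longleftrightarrow> x = \<zero>\<^bsub>space A t\<^esub>"
    if "x \<in> carrier (space A t)" "y \<in> carrier (space A t)" for x y
    using that vectorspace_abelian_group[OF presents_vectorspace[OF A]]
    by (simp only: abelian_group.add_eq_right_iff)
  ultimately show ?thesis
    using presents.zero_iff[OF A coord_diff[OF u v]] presents.closed[OF A v]
      presents.closed[OF A coord_diff[OF u v]] by simp
qed

section \<open>Fibres of a sum of interval modules as quotients of coordinate spaces\<close>

lemma interval_sum_carrier:
  "carrier (space (interval_sum \<A>) t) =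
   restrict_alive \<A> t ` coord (born \<A> t)" (is "?C = ?R")
proof (intro equalityI subsetI)
  fix f assume f: "f \<in> ?C"
  let ?v = "\<lambda>j. if j \<in> bars \<A> then f j else 0"
  have zero: "f j = 0" if "j \<in> bars \<A>" "t \<notin> bar_interval (birth \<A> j) (death \<A> j)" for j
    using f that by (fastforce simp: pmod_direct_sum_def interval_module_def dest: PiE_mem)
  have "f \<in> extensional (bars \<A>)"
    using f by (auto simp: pmod_direct_sum_def PiE_def)
  then have "f = restrict_alive \<A> t ?v"
    using zero by (auto simp: restrict_alive_def fun_eq_iff extensional_def)
  moreover have "?v \<in> coord (born \<A> t)"
    using zero by (auto simp: coord_def alive_iff split: if_splits)
  ultimately show "f \<in> ?R" by blast
next
  fix f assume "f \<in> ?R"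
  then show "f \<in> ?C"
    by (auto simp: pmod_direct_sum_def interval_module_def restrict_alive_def)
qed

lemma interval_sum_add:
  "restrict_alive \<A> t u \<oplus>\<^bsub>space (interval_sum \<A>) t\<^esub>
   restrict_alive \<A> t v = restrict_alive \<A> t (\<lambda>j. u j + v j)"
  by (auto simp: pmod_direct_sum_def interval_module_def restrict_alive_def)

lemma interval_sum_scale:
  "a \<odot>\<^bsub>space (interval_sum \<A>) t\<^esub>
   restrict_alive \<A> t v = restrict_alive \<A> t (\<lambda>j. a * v j)"
  by (auto simp: pmod_direct_sum_def interval_module_def restrict_alive_def)

lemma interval_sum_transition:
  assumes "s \<le> t" "v \<in> coord (born \<A> s)"
  shows "transition (interval_sum \<A>) s t
    (restrict_alive \<A> s v) = restrict_alive \<A> t v"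
proof -
  \<comment> \<open>Dead bars stay dead, so a bar alive at t but not at s is not yet born at s, and
    v vanishes there.\<close>
  have "v j = 0" if "j \<in> bars \<A>" "j \<in> born \<A> t" "j \<notin> dead \<A> t" "\<not> (j \<in> born \<A> s \<and> j \<notin> dead \<A> s)" for j
    using assms that dead_mono[OF assms(1), of \<A>] by (auto simp: coord_def)
  then show ?thesis
    by (auto simp: pmod_direct_sum_def interval_module_def restrict_alive_def alive_iff fun_eq_iff)
qed

lemma restrict_alive_eq_iff:
  assumes "u \<in> coord (born \<A> t)" "v \<in> coord (born \<A> t)"
  shows "restrict_alive \<A> t u = restrict_alive \<A> t v \<longleftrightarrow> (\<lambda>j. u j - v j) \<in> coord (dead \<A> t)"
proof -
  have "restrict_alive \<A> t u = restrict_alive \<A> t v \<longleftrightarrow>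
      (\<forall>j\<in>bars \<A>. j \<in> born \<A> t \<and> j \<notin> dead \<A> t \<longrightarrow> u j = v j)"
    by (auto simp: restrict_alive_def fun_eq_iff alive_iff)
  also have "\<dots> \<longleftrightarrow> (\<lambda>j. u j - v j) \<in> coord (dead \<A> t)"
    using assms born_subset[of \<A> t] unfolding coord_def mem_Collect_eq
    by (metis (no_types, opaque_lifting) diff_self eq_iff_diff_eq_0 subsetD)
  finally show ?thesis .
qed

lemma interval_decomposition_bij:
  "interval_decomposition A \<A> \<alpha> \<Longrightarrow>
   bij_betw (\<alpha> t) (carrier (space A t)) (restrict_alive \<A> t ` coord (born \<A> t))"
  unfolding interval_decomposition_def pmod_iso_def interval_sum_carrier by blast

lemma proj_props:
  assumes A: "interval_decomposition A \<A> \<alpha>" and v: "v \<in> coord (born \<A> t)"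
  shows "proj A \<A> \<alpha> t v \<in> carrier (space A t)" "\<alpha> t (proj A \<A> \<alpha> t v) = restrict_alive \<A> t v"
    and "x \<in> carrier (space A t) \<Longrightarrow> \<alpha> t x = restrict_alive \<A> t v \<Longrightarrow> proj A \<A> \<alpha> t v = x"
proof -
  note bij = interval_decomposition_bij[OF A, of t]
  have v': "restrict_alive \<A> t v \<in> \<alpha> t ` carrier (space A t)"
    using bij_betw_imp_surj_on[OF bij] v by blast
  show "proj A \<A> \<alpha> t v \<in> carrier (space A t)"
    unfolding proj_def using v' by (rule inv_into_into)
  show "\<alpha> t (proj A \<A> \<alpha> t v) = restrict_alive \<A> t v"
    unfolding proj_def using v' by (rule f_inv_into_f)
  show "x \<in> carrier (space A t) \<Longrightarrow> \<alpha> t x = restrict_alive \<A> t v \<Longrightarrow> proj A \<A> \<alpha> t v = x"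
    unfolding proj_def using inv_into_f_eq[OF bij_betw_imp_inj_on[OF bij]] by blast
qed

lemma interval_decomposition_presents:
  assumes A: "interval_decomposition A \<A> \<alpha>"
  shows "presents A \<A> (proj A \<A> \<alpha>)"
proof -
  let ?\<pi> = "proj A \<A> \<alpha>"
  note pr = proj_props[OF A]
  note bij = interval_decomposition_bij[OF A]
  have pm: "persistence_module A" and fin: "finite (bars \<A>)"
    and bd: "\<And>j. j \<in> bars \<A> \<Longrightarrow> birth \<A> j \<le> death \<A> j"
    and hom: "pmod_hom A (interval_sum \<A>) \<alpha>"
    using A unfolding interval_decomposition_def pmod_iso_def by blast+
  note vs = persistence_module_vectorspace[OF pm]
  note \<alpha> = pmod_hom_module_hom[OF hom]
  have scale: "?\<pi> t (\<lambda>j. a * v j) = a \<odot>\<^bsub>space A t\<^esub> ?\<pi> t v"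
    if v: "v \<in> coord (born \<A> t)" for t a v
  proof (rule pr(3)[OF coord_scale[OF v]])
    show "a \<odot>\<^bsub>space A t\<^esub> ?\<pi> t v \<in> carrier (space A t)"
      using module.smult_closed[OF vectorspace_module[OF vs], of a, OF _ pr(1)[OF v]] by simp
    show "\<alpha> t (a \<odot>\<^bsub>space A t\<^esub> ?\<pi> t v) = restrict_alive \<A> t (\<lambda>j. a * v j)"
      unfolding module_hom_scale[OF \<alpha> pr(1)[OF v]] pr(2)[OF v] by (rule interval_sum_scale)
  qed
  show ?thesis
  proof (rule presents.intro)
    show "dead \<A> t \<subseteq> born \<A> t" for t
    proof
      fix j assume "j \<in> dead \<A> t"
      then show "j \<in> born \<A> t"
        using bd[of j] by (auto simp: dead_def born_def less_eq_cut_def upper_eq)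
    qed
    show "\<exists>v\<in>coord (born \<A> t). x = ?\<pi> t v" if x: "x \<in> carrier (space A t)" for t x
    proof -
      obtain v where v: "v \<in> coord (born \<A> t)" "\<alpha> t x = restrict_alive \<A> t v"
        using bij_betw_imp_surj_on[OF bij[of t]] x by blast
      then show ?thesis using pr(3)[OF v(1) x v(2)] by blast
    qed
    show "?\<pi> t (\<lambda>j. u j + v j) = ?\<pi> t u \<oplus>\<^bsub>space A t\<^esub> ?\<pi> t v"
      if uv: "u \<in> coord (born \<A> t)" "v \<in> coord (born \<A> t)" for t u v
    proof (rule pr(3)[OF coord_add[OF uv]])
      show "?\<pi> t u \<oplus>\<^bsub>space A t\<^esub> ?\<pi> t v \<in> carrier (space A t)"
        using abelian_monoid.a_closed[OF abelian_group.axioms(1)[OF vectorspace_abelian_group[OF vs]]]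
          pr(1)[OF uv(1)] pr(1)[OF uv(2)] by blast
      show "\<alpha> t (?\<pi> t u \<oplus>\<^bsub>space A t\<^esub> ?\<pi> t v) = restrict_alive \<A> t (\<lambda>j. u j + v j)"
        unfolding LinearCombinations.module_hom_add[OF \<alpha> pr(1)[OF uv(1)] pr(1)[OF uv(2)]] pr(2)[OF uv(1)] pr(2)[OF uv(2)]
        by (rule interval_sum_add)
    qed
    show "?\<pi> t v = \<zero>\<^bsub>space A t\<^esub> \<longleftrightarrow> v \<in> coord (dead \<A> t)"
      if v: "v \<in> coord (born \<A> t)" for t v
    proof -
      \<comment> \<open>Zero is the multiple by 0 of any element, so it is presented by the zero
        vector, and the kernel of the projection can be read off from
        \<open>restrict_alive\<close>.\<close>
      have "\<zero>\<^bsub>space A t\<^esub> = ?\<pi> t (\<lambda>_. 0)"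
        using scale[OF v, of 0] by (simp only: vectorspace_smult_zero[OF vs pr(1)[OF v]] mult_zero_left)
      moreover have "?\<pi> t v = ?\<pi> t (\<lambda>_. 0) \<longleftrightarrow> restrict_alive \<A> t v = restrict_alive \<A> t (\<lambda>_. 0)"
      proof
        assume "?\<pi> t v = ?\<pi> t (\<lambda>_. 0)"
        then have "\<alpha> t (?\<pi> t v) = \<alpha> t (?\<pi> t (\<lambda>_. 0))" by (rule arg_cong)
        then show "restrict_alive \<A> t v = restrict_alive \<A> t (\<lambda>_. 0)"
          unfolding pr(2)[OF v] pr(2)[OF zero_in_coord] .
      qed (simp only: proj_def)
      ultimately show ?thesis
        using restrict_alive_eq_iff[OF v zero_in_coord] by simp
    qed
    show "transition A s t (?\<pi> s v) = ?\<pi> t v"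
      if st: "s \<le> t" and v: "v \<in> coord (born \<A> s)" for s t v
    proof (rule pr(3)[symmetric])
      show "v \<in> coord (born \<A> t)" by (rule coord_subsetD[OF v born_mono[OF st]])
      show "transition A s t (?\<pi> s v) \<in> carrier (space A t)"
        using module_hom_mem[OF persistence_module_transition_hom[OF pm st] pr(1)[OF v]] .
      show "\<alpha> t (transition A s t (?\<pi> s v)) = restrict_alive \<A> t v"
        unfolding pmod_hom_transition[OF hom st pr(1)[OF v]] pr(2)[OF v]
        using st v by (rule interval_sum_transition)
    qed
  qed (use pm fin pr(1) scale in auto)
qed

text \<open>The converse of \<open>interval_decomposition_presents\<close>. It reduces the
  construction of a decomposition of cycles or homology to that of a presentation, and it also
  controls the projection belonging to the decomposition.\<close>

lemma presents_interval_decomposition: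
  assumes A: "presents A \<A> \<pi>"
  obtains \<alpha> where "interval_decomposition A \<A> \<alpha>"
    "\<And>t v. v \<in> coord (born \<A> t) \<Longrightarrow> proj A \<A> \<alpha> t v = \<pi> t v"
proof -
  let ?D = "interval_sum \<A> ::
    ('a, 'b, 'd \<Rightarrow> 'b) pmod"
  \<comment> \<open>The choice is harmless: two vectors presenting the same element differ by a
    vector supported on dead bars, which \<open>restrict_alive\<close> discards.\<close>
  define \<alpha> where "\<alpha> t x = restrict_alive \<A> t (SOME v. v \<in> coord (born \<A> t) \<and> \<pi> t v = x)" for t x
  have \<alpha>: "\<alpha> t (\<pi> t v) = restrict_alive \<A> t v" if v: "v \<in> coord (born \<A> t)" for t v
  proof -
    let ?w = "SOME w. w \<in> coord (born \<A> t) \<and> \<pi> t w = \<pi> t v"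
    have "?w \<in> coord (born \<A> t) \<and> \<pi> t ?w = \<pi> t v"
      using v by (rule someI[of _ v, OF conjI]) (rule refl)
    then show ?thesis
      unfolding \<alpha>_def using v presents_eq_iff[OF A, of ?w t v] restrict_alive_eq_iff[of ?w \<A> t v] by blast
  qed
  have inj: "inj_on (\<alpha> t) (carrier (space A t))" for t
  proof (rule inj_onI)
    fix x y assume "x \<in> carrier (space A t)" "y \<in> carrier (space A t)" and eq: "\<alpha> t x = \<alpha> t y"
    then obtain u v where uv: "u \<in> coord (born \<A> t)" "x = \<pi> t u" "v \<in> coord (born \<A> t)" "y = \<pi> t v"
      using presents_surj[OF A] by metis
    then show "x = y"
      using eq presents_eq_iff[OF A uv(1,3)] restrict_alive_eq_iff[OF uv(1,3)] by (simp add: \<alpha>)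
  qed
  have "\<alpha> t ` carrier (space A t) = carrier (space ?D t)" for t
  proof -
    have "\<pi> t ` coord (born \<A> t) = carrier (space A t)"
      by (auto intro: presents.closed[OF A] elim: presents_surj[OF A])
    then have "\<alpha> t ` carrier (space A t) = (\<lambda>v. \<alpha> t (\<pi> t v)) ` coord (born \<A> t)"
      by (metis image_image)
    then show ?thesis
      unfolding interval_sum_carrier using \<alpha> by simp
  qed
  with inj have bij: "bij_betw (\<alpha> t) (carrier (space A t)) (carrier (space ?D t))" for t
    by (simp add: bij_betw_def)
  have "pmod_hom A ?D \<alpha>"
    unfolding pmod_hom_def LinearCombinations.module_hom_def
  proof (intro conjI allI impI ballI CollectI)
    show "\<alpha> t \<in> carrier (space A t) \<rightarrow> carrier (space ?D t)" for t
      using bij bij_betwE by blast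
    show "\<alpha> t (x \<oplus>\<^bsub>space A t\<^esub> y) = \<alpha> t x \<oplus>\<^bsub>space ?D t\<^esub> \<alpha> t y"
      if xy: "x \<in> carrier (space A t) \<and> y \<in> carrier (space A t)" for t x y
    proof -
      obtain u v where uv: "u \<in> coord (born \<A> t)" "x = \<pi> t u" "v \<in> coord (born \<A> t)" "y = \<pi> t v"
        using xy presents_surj[OF A] by metis
      then have "\<alpha> t (x \<oplus>\<^bsub>space A t\<^esub> y) = restrict_alive \<A> t (\<lambda>j. u j + v j)"
        using \<alpha>[OF coord_add[OF uv(1,3)]] presents.add[OF A uv(1,3)] by simp
      then show ?thesis
        using uv by (simp add: \<alpha> interval_sum_add)
    qed
    show "\<alpha> t (a \<odot>\<^bsub>space A t\<^esub> x) = a \<odot>\<^bsub>space ?D t\<^esub> \<alpha> t x"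
      if x: "a \<in> carrier class_ring \<and> x \<in> carrier (space A t)" for t a x
    proof -
      obtain v where v: "v \<in> coord (born \<A> t)" "x = \<pi> t v"
        using x presents_surj[OF A] by metis
      then have "\<alpha> t (a \<odot>\<^bsub>space A t\<^esub> x) = restrict_alive \<A> t (\<lambda>j. a * v j)"
        using \<alpha>[OF coord_scale[OF v(1), of a]] presents.scale[OF A v(1), of a] by simp
      then show ?thesis
        using v by (simp add: \<alpha> interval_sum_scale)
    qed
    show "\<alpha> t (transition A s t x) = transition ?D s t (\<alpha> s x)"
      if st: "s \<le> t" and x: "x \<in> carrier (space A s)" for s t x
    proof -
      obtain v where v: "v \<in> coord (born \<A> s)" "x = \<pi> s v"
        using x presents_surj[OF A] by metis
      have v': "v \<in> coord (born \<A> t)" by (rule coord_subsetD[OF v(1) born_mono[OF st]])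
      show ?thesis
        using v v' st by (simp add: \<alpha> presents.transition[OF A] interval_sum_transition)
    qed
  qed
  moreover have "birth \<A> j \<le> death \<A> j" if "j \<in> bars \<A>" for j
    unfolding less_eq_cut_def
    using presents.dead_born[OF A] that by (auto simp: born_def dead_def upper_eq)
  ultimately have dec: "interval_decomposition A \<A> \<alpha>"
    using presents.pmod[OF A] presents.finite_bars[OF A] bij
    unfolding interval_decomposition_def pmod_iso_def by blast
  moreover have "proj A \<A> \<alpha> t v = \<pi> t v" if "v \<in> coord (born \<A> t)" for t v
    using proj_props(3)[OF dec that presents.closed[OF A that] \<alpha>[OF that]] .
  ultimately show ?thesis using that by blast
qed

text \<open>Unit vectors are tested at every t. A nonzero entry X i j forces i to be born whenever j
  is, and dead whenever j is, and over all t these are comparisons of cuts. Entries between bars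
  that are never alive together are constrained as well.\<close>

lemma filtered_iff:
  fixes \<A> :: "('r::linorder, 'j) barcode" and X :: "'i \<Rightarrow> 'j \<Rightarrow> 'f::field"
  assumes fin: "finite (bars \<A>)"
  shows "filtered \<A> \<B> X \<longleftrightarrow>
    (\<forall>i\<in>bars \<B>. \<forall>j\<in>bars \<A>. birth \<B> i > birth \<A> j \<or> death \<B> i > death \<A> j \<longrightarrow> X i j = 0)"
proof
  let ?X = "mvec (bars \<B>) (bars \<A>) X"
  assume F: "filtered \<A> \<B> X"
  show "\<forall>i\<in>bars \<B>. \<forall>j\<in>bars \<A>. birth \<B> i > birth \<A> j \<or> death \<B> i > death \<A> j \<longrightarrow> X i j = 0"
  proof (intro ballI impI, rule ccontr)
    fix i j assume ij: "i \<in> bars \<B>" "j \<in> bars \<A>" and X: "X i j \<noteq> 0"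
      and less: "birth \<B> i > birth \<A> j \<or> death \<B> i > death \<A> j"
    let ?e = "\<lambda>k. if k = j then 1 else 0"
    have "?X ?e i = X i j"
      using ij fin by (simp add: mvec_def if_distrib cong: if_cong)
    then have nz: "?X ?e i \<noteq> 0" using X by simp
    have "t \<in> upper (birth \<B> i)" if "t \<in> upper (birth \<A> j)" for t
    proof -
      have "?e \<in> coord (born \<A> t)" using that ij by (simp add: coord_def born_def)
      then have "?X ?e \<in> coord (born \<B> t)" using F unfolding filtered_def by blast
      then show ?thesis using nz by (auto simp: coord_def born_def)
    qed
    moreover have "t \<notin> lower (death \<B> i)" if "t \<notin> lower (death \<A> j)" for t
    proof -
      have "?e \<in> coord (dead \<A> t)" using that ij by (simp add: coord_def dead_def)
      then have "?X ?e \<in> coord (dead \<B> t)" using F unfolding filtered_def by blast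
      then show ?thesis using nz by (auto simp: coord_def dead_def)
    qed
    ultimately show False
      using less by (auto simp: less_cut_def upper_eq)
  qed
next
  let ?X = "mvec (bars \<B>) (bars \<A>) X"
  assume H: "\<forall>i\<in>bars \<B>. \<forall>j\<in>bars \<A>. birth \<B> i > birth \<A> j \<or> death \<B> i > death \<A> j \<longrightarrow> X i j = 0"
  have supp: "\<exists>j\<in>bars \<A>. v j \<noteq> 0 \<and> i \<in> bars \<B> \<and> birth \<B> i \<le> birth \<A> j \<and> death \<B> i \<le> death \<A> j"
    if "?X v i \<noteq> 0" for v i
  proof -
    from that have "i \<in> bars \<B>" "(\<Sum>j\<in>bars \<A>. X i j * v j) \<noteq> 0"
      by (auto simp: mvec_def split: if_splits)
    then obtain j where "j \<in> bars \<A>" "X i j \<noteq> 0" "v j \<noteq> 0"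
      by (auto elim!: sum.not_neutral_contains_not_neutral)
    with H \<open>i \<in> bars \<B>\<close> show ?thesis by (metis not_le)
  qed
  show "filtered \<A> \<B> X"
    unfolding filtered_def
  proof (intro allI conjI image_subsetI)
    fix t and v :: "'j \<Rightarrow> 'f" assume v: "v \<in> coord (born \<A> t)"
    have "i \<in> born \<B> t" if "?X v i \<noteq> 0" for i
      using supp[OF that] v by (auto simp: coord_def born_def less_eq_cut_def upper_eq)
    then show "?X v \<in> coord (born \<B> t)" by (simp add: coord_def)
  next
    fix t and v :: "'j \<Rightarrow> 'f" assume v: "v \<in> coord (dead \<A> t)"
    have "i \<in> dead \<B> t" if "?X v i \<noteq> 0" for i
      using supp[OF that] v by (auto simp: coord_def dead_def less_eq_cut_def)
    then show "?X v \<in> coord (dead \<B> t)" by (simp add: coord_def)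
  qed
qed

text \<open>Linearity is asked for on \<open>coord P\<close> only. The function in question below is
  a coordinate of a chosen lift, which is linear for coordinates that are not dead although the lift
  itself need not be.\<close>

lemma linear_functional_sum:
  assumes "finite P" "v \<in> coord P"
    and add: "\<And>u v. u \<in> coord P \<Longrightarrow> v \<in> coord P \<Longrightarrow> g (\<lambda>j. u j + v j) = g u + g v"
    and scale: "\<And>a v. v \<in> coord P \<Longrightarrow> g (\<lambda>j. a * v j) = a * g v"
  shows "g v = (\<Sum>j\<in>P. v j * (g (\<lambda>k. if k = j then 1 else 0) :: 'f::field))"
  using assms
proof (induction P arbitrary: v)
  case empty
  then have "v = (\<lambda>j. 0 * v j)" by (auto simp: coord_def)
  then have "g v = 0 * g v" using empty(3)[of v 0] empty(1) by metis
  then show ?case by simp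
next
  case (insert x P)
  let ?u = "v(x := 0)" and ?e = "\<lambda>k. if k = x then 1 else (0 :: 'f)"
  have sub: "coord P \<subseteq> (coord (insert x P) :: ('a \<Rightarrow> 'f) set)" by (rule coord_mono) blast
  have u: "?u \<in> coord P" and e: "?e \<in> coord (insert x P)"
    using insert.prems(1) by (auto simp: coord_def)
  have "v = (\<lambda>j. ?u j + v x * ?e j)" by auto
  then have "g v = g ?u + v x * g ?e"
    using insert.prems(2)[of ?u "\<lambda>j. v x * ?e j"] insert.prems(3)[OF e] coord_scale[OF e] u sub
    by (metis subsetD)
  also have "g ?u = (\<Sum>j\<in>P. ?u j * g (\<lambda>k. if k = j then 1 else 0))"
    using insert.prems(2,3) sub by (intro insert.IH[OF u]) blast+
  also have "\<dots> = (\<Sum>j\<in>P. v j * g (\<lambda>k. if k = j then 1 else 0))"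
    using insert.hyps by (intro sum.cong) auto
  finally show ?case
    using insert.hyps by simp
qed

text \<open>The definition of \<open>represents\<close> tests single bars alive at t, whereas
  \<open>induces\<close> speaks of every vector supported on bars born by t. To pass from the first
  to the second, \<phi> is lifted to coordinates. The coordinates of a lift at bars not dead do not
  depend on the choice, so they are linear and can be computed on unit vectors.\<close>

lemma represents_iff:
  fixes A :: "('r::linorder, 'f::field, 'v) pmod" and B :: "('r, 'f, 'w) pmod"
  assumes A: "interval_decomposition A \<A> \<alpha>" and B: "interval_decomposition B \<B> \<beta>"
  shows "represents A \<A> \<alpha> B \<B> \<beta> \<phi> X \<longleftrightarrow>
    pmod_hom A B \<phi> \<and> induces \<A> (proj A \<A> \<alpha>) \<B> (proj B \<B> \<beta>) \<phi> X"
proof -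
  let ?\<pi> = "proj A \<A> \<alpha>" and ?\<rho> = "proj B \<B> \<beta>" and ?X = "mvec (bars \<B>) (bars \<A>) X"
  have PA: "presents A \<A> ?\<pi>" and PB: "presents B \<B> ?\<rho>"
    using A B interval_decomposition_presents by auto
  have fin: "finite (bars \<A>)" using PA by (rule presents.finite_bars)
  have unit: "(\<lambda>k\<in>bars \<A>. if k = j then s else 0) = restrict_alive \<A> t (\<lambda>k. if k = j then s else 0)"
      "(\<lambda>k. if k = j then s else 0) \<in> coord (born \<A> t)"
    if "j \<in> bars \<A>" "t \<in> bar_interval (birth \<A> j) (death \<A> j)" for j t and s :: 'f
    using that by (auto simp: restrict_alive_def fun_eq_iff coord_def alive_iff)
  show ?thesis
  proof (cases "pmod_hom A B \<phi> \<and> filtered \<A> \<B> X")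
    case False
    then show ?thesis
      unfolding represents_def induces_def filtered_iff[OF fin] by blast
  next
    case True
    then have hom: "pmod_hom A B \<phi>" and F: "filtered \<A> \<B> X" by auto
    note \<phi> = module_hom_mem[OF pmod_hom_module_hom[OF hom]]
    note \<phi>_add = LinearCombinations.module_hom_add[OF pmod_hom_module_hom[OF hom]]
    note \<phi>_scale = module_hom_scale[OF pmod_hom_module_hom[OF hom]]
    \<comment> \<open>A bar dead at t has no entry towards a bar that is not dead at t, by the
      condition on deaths.\<close>
    have X0: "X i j = 0" if "i \<in> bars \<B>" "i \<notin> dead \<B> t" "j \<in> dead \<A> t" for i j t
    proof -
      have "\<not> death \<B> i \<le> death \<A> j" "j \<in> bars \<A>"
        using that by (auto simp: less_eq_cut_def dead_def)
      then show ?thesis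
        using F that(1) unfolding filtered_iff[OF fin] not_le by blast
    qed
    have entries: "(\<forall>i\<in>bars \<B>. \<forall>j\<in>bars \<A>.
        \<forall>t \<in> bar_interval (birth \<B> i) (death \<B> i) \<inter> bar_interval (birth \<A> j) (death \<A> j). \<forall>s.
           \<beta> t (\<phi> t (inv_into (carrier (space A t)) (\<alpha> t)
             (\<lambda>k\<in>bars \<A>. if k = j then s else 0))) i = X i j * s) \<longleftrightarrow>
        (\<forall>t. \<forall>v\<in>coord (born \<A> t). \<phi> t (?\<pi> t v) = ?\<rho> t (?X v))" (is "?L \<longleftrightarrow> ?R")
    proof
      assume R: ?R
      show ?L
      proof (intro ballI allI)
        fix i j t and s :: 'f assume i: "i \<in> bars \<B>" and j: "j \<in> bars \<A>"
          and t: "t \<in> bar_interval (birth \<B> i) (death \<B> i) \<inter> bar_interval (birth \<A> j) (death \<A> j)"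
        let ?e = "\<lambda>k. if k = j then s else 0"
        have e: "?e \<in> coord (born \<A> t)" using unit(2) j t by blast
        then have Xe: "?X ?e \<in> coord (born \<B> t)" using F unfolding filtered_def by blast
        have "\<phi> t (inv_into (carrier (space A t)) (\<alpha> t) (\<lambda>k\<in>bars \<A>. ?e k)) = ?\<rho> t (?X ?e)"
          using R e unit(1)[OF j, of t s] t unfolding proj_def by auto
        then have "\<beta> t (\<phi> t (inv_into (carrier (space A t)) (\<alpha> t) (\<lambda>k\<in>bars \<A>. ?e k))) i = ?X ?e i"
          using proj_props(2)[OF B Xe] i t by (simp add: restrict_alive_def)
        also have "\<dots> = X i j * s"
          using i j fin by (simp add: mvec_def if_distrib cong: if_cong)
        finally show "\<beta> t (\<phi> t (inv_into (carrier (space A t)) (\<alpha> t) (\<lambda>k\<in>bars \<A>. ?e k))) i = X i j * s" .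
      qed
    next
      assume L: ?L
      show ?R
      proof (intro allI ballI)
        fix t and v :: "_ \<Rightarrow> 'f" assume v: "v \<in> coord (born \<A> t)"
        have \<pi>c: "?\<pi> t u \<in> carrier (space A t)" if "u \<in> coord (born \<A> t)" for u
          using presents.closed[OF PA that] .
        have ex: "\<exists>w\<in>coord (born \<B> t). \<phi> t (?\<pi> t u) = ?\<rho> t w" if "u \<in> coord (born \<A> t)" for u
          using presents_surj[OF PB \<phi>[OF \<pi>c[OF that]]] by metis
        \<comment> \<open>An arbitrary lift of \<phi> to coordinates. No linearity is available for
          h itself.\<close>
        define h where "h u = (SOME w. w \<in> coord (born \<B> t) \<and> \<phi> t (?\<pi> t u) = ?\<rho> t w)" for u
        have h: "h u \<in> coord (born \<B> t)" "\<phi> t (?\<pi> t u) = ?\<rho> t (h u)" if "u \<in> coord (born \<A> t)" for u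
          using someI_ex[of "\<lambda>w. w \<in> coord (born \<B> t) \<and> \<phi> t (?\<pi> t u) = ?\<rho> t w"] ex[OF that]
          unfolding h_def by blast+
        have \<beta>: "\<beta> t (\<phi> t (?\<pi> t u)) = restrict_alive \<B> t (h u)" if "u \<in> coord (born \<A> t)" for u
          using h[OF that] proj_props(2)[OF B] by metis
        \<comment> \<open>Vectors presenting the same element agree off the dead bars; this gives
          the linearity of the coordinates used below.\<close>
        have same: "w i = w' i" if "w \<in> coord (born \<B> t)" "w' \<in> coord (born \<B> t)" "?\<rho> t w = ?\<rho> t w'"
            "i \<notin> dead \<B> t" for w w' i
        proof -
          have "(\<lambda>i. w i - w' i) \<in> coord (dead \<B> t)"
            using presents_eq_iff[OF PB that(1,2)] that(3) by simp
          then have "w i - w' i = 0" using that(4) unfolding coord_def by blast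
          then show ?thesis by simp
        qed
        have hX: "h v i = ?X v i" if i: "i \<in> born \<B> t" "i \<notin> dead \<B> t" for i
        proof -
          have iB: "i \<in> bars \<B>" by (rule subsetD[OF born_subset i(1)])
          have "h v i = (\<Sum>j\<in>born \<A> t. v j * h (\<lambda>k. if k = j then 1 else (0 :: 'f)) i)"
          proof (rule linear_functional_sum[where g = "\<lambda>u. h u i", OF _ v])
            show "finite (born \<A> t)" using fin born_subset by (rule rev_finite_subset)
            show "h (\<lambda>j. u j + w j) i = h u i + h w i"
              if uw: "u \<in> coord (born \<A> t)" "w \<in> coord (born \<A> t)" for u w
            proof (rule same[of _ "\<lambda>i. h u i + h w i"])
              show "?\<rho> t (h (\<lambda>j. u j + w j)) = ?\<rho> t (\<lambda>i. h u i + h w i)"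
                using presents.add[OF PB h(1)[OF uw(1)] h(1)[OF uw(2)]] h(2)[OF uw(1)] h(2)[OF uw(2)]
                  h(2)[OF coord_add[OF uw]] presents.add[OF PA uw] \<phi>_add[OF \<pi>c[OF uw(1)] \<pi>c[OF uw(2)]]
                by simp
            qed (use i h(1)[OF coord_add[OF uw]] coord_add[OF h(1)[OF uw(1)] h(1)[OF uw(2)]] in simp_all)
            show "h (\<lambda>j. a * u j) i = a * h u i" if u: "u \<in> coord (born \<A> t)" for a u
            proof (rule same[of _ "\<lambda>i. a * h u i"])
              show "?\<rho> t (h (\<lambda>j. a * u j)) = ?\<rho> t (\<lambda>i. a * h u i)"
                using presents.scale[OF PB h(1)[OF u]] h(2)[OF u] h(2)[OF coord_scale[OF u]]
                  presents.scale[OF PA u] \<phi>_scale[OF \<pi>c[OF u]] by simp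
            qed (use i h(1)[OF coord_scale[OF u]] coord_scale[OF h(1)[OF u]] in simp_all)
          qed
          also have "\<dots> = (\<Sum>j\<in>born \<A> t. X i j * v j)"
          proof (rule sum.cong)
            fix j assume j: "j \<in> born \<A> t"
            then have jA: "j \<in> bars \<A>" by (rule subsetD[OF born_subset])
            let ?e = "\<lambda>k. if k = j then 1 else (0 :: 'f)"
            have e: "?e \<in> coord (born \<A> t)" using j by (simp add: coord_def)
            \<comment> \<open>The hypothesis covers only bars j alive at t. For a dead j both sides
              vanish: \<pi> sends the unit vector to zero, and the entry is zero by
              \<open>X0\<close>.\<close>
            have "h ?e i = X i j"
            proof (cases "j \<in> dead \<A> t")
              case True
              have "?e \<in> coord (dead \<A> t)" using True by (simp add: coord_def)
              then have "?\<pi> t ?e = \<zero>\<^bsub>space A t\<^esub>" using presents.zero_iff[OF PA e] by blast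
              then have "?\<rho> t (h ?e) = \<phi> t (\<zero>\<^bsub>space A t\<^esub>)" using h(2)[OF e] by simp
              also have "\<dots> = \<zero>\<^bsub>space B t\<^esub>"
                using pmod_hom_module_hom[OF hom] presents_vectorspace[OF PA] presents_vectorspace[OF PB]
                by (rule module_hom_zero)
              finally have "h ?e \<in> coord (dead \<B> t)"
                using presents.zero_iff[OF PB h(1)[OF e]] by blast
              then show ?thesis using i X0[OF iB i(2) True] by (auto simp: coord_def)
            next
              case False
              then have t: "t \<in> bar_interval (birth \<B> i) (death \<B> i) \<inter> bar_interval (birth \<A> j) (death \<A> j)"
                using i j iB jA by (simp add: alive_iff)
              have "\<beta> t (\<phi> t (?\<pi> t ?e)) i = X i j * 1"
                using L[rule_format, OF iB jA t, of 1] t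
                unfolding proj_def by (simp only: Int_iff unit(1)[OF jA, of t 1])
              then show ?thesis
                unfolding \<beta>[OF e] using iB t by (simp add: restrict_alive_def)
            qed
            then show "v j * h ?e i = X i j * v j" by simp
          qed simp
          also have "\<dots> = (\<Sum>j\<in>bars \<A>. X i j * v j)"
            using v fin by (intro sum.mono_neutral_left born_subset) (auto simp: coord_def)
          finally show ?thesis using iB by (simp add: mvec_def)
        qed
        have Xv: "?X v \<in> coord (born \<B> t)" using F v unfolding filtered_def by blast
        have "(\<lambda>i. h v i - ?X v i) \<in> coord (dead \<B> t)"
        proof -
          have "i \<in> dead \<B> t" if "h v i - ?X v i \<noteq> 0" for i
          proof (rule ccontr)
            assume i: "i \<notin> dead \<B> t"
            have "i \<in> born \<B> t"
              using coord_diff[OF h(1)[OF v] Xv] that unfolding coord_def by blast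
            then show False using hX[OF _ i] that by simp
          qed
          then show ?thesis unfolding coord_def by blast
        qed
        then show "\<phi> t (?\<pi> t v) = ?\<rho> t (?X v)"
          using presents_eq_iff[OF PB h(1)[OF v] Xv] h(2)[OF v] by simp
      qed
    qed
    have "represents A \<A> \<alpha> B \<B> \<beta> \<phi> X \<longleftrightarrow> (\<forall>i\<in>bars \<B>. \<forall>j\<in>bars \<A>.
        \<forall>t \<in> bar_interval (birth \<B> i) (death \<B> i) \<inter> bar_interval (birth \<A> j) (death \<A> j). \<forall>s.
           \<beta> t (\<phi> t (inv_into (carrier (space A t)) (\<alpha> t)
             (\<lambda>k\<in>bars \<A>. if k = j then s else 0))) i = X i j * s)"
      using hom F unfolding represents_def filtered_iff[OF fin] by blast
    then show ?thesis
      using hom F entries unfolding induces_def by blast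
  qed
qed

section \<open>Kernels and quotients\<close>

lemma minvertible_cancel:
  assumes "finite J" "minvertible J T" "u \<in> coord J" "v \<in> coord J" "mvec J J T u = mvec J J T v"
  shows "u = v"
proof -
  obtain B where B: "minverts J T B" using assms(2) by (auto simp: minvertible_def)
  have "u = mvec J J B (mvec J J T u)"
    using minverts_mvec(2)[OF assms(1) B assms(3)] ..
  also have "\<dots> = v"
    unfolding assms(5) using minverts_mvec(2)[OF assms(1) B assms(4)] .
  finally show ?thesis .
qed

lemma unit_coord_iff: "(\<lambda>k. if k = j then 1 else (0 :: 'f::field)) \<in> coord P \<longleftrightarrow> j \<in> P"
  by (simp add: coord_def)

lemma induces_born:
  "induces \<A> \<pi> \<B> \<rho> \<phi> X \<Longrightarrow> v \<in> coord (born \<A> t) \<Longrightarrow> mvec (bars \<B>) (bars \<A>) X v \<in> coord (born \<B> t)"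
  unfolding induces_def filtered_def by blast

lemma induces_dead:
  "induces \<A> \<pi> \<B> \<rho> \<phi> X \<Longrightarrow> v \<in> coord (dead \<A> t) \<Longrightarrow> mvec (bars \<B>) (bars \<A>) X v \<in> coord (dead \<B> t)"
  unfolding induces_def filtered_def by blast

lemma induces_eq:
  "induces \<A> \<pi> \<B> \<rho> \<phi> X \<Longrightarrow> v \<in> coord (born \<A> t) \<Longrightarrow>
   \<phi> t (\<pi> t v) = \<rho> t (mvec (bars \<B>) (bars \<A>) X v)"
  unfolding induces_def by blast

lemma inducesI:
  assumes "\<And>t v. v \<in> coord (born \<A> t) \<Longrightarrow> mvec (bars \<B>) (bars \<A>) X v \<in> coord (born \<B> t)"
    and "\<And>t v. v \<in> coord (dead \<A> t) \<Longrightarrow> mvec (bars \<B>) (bars \<A>) X v \<in> coord (dead \<B> t)"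
    and "\<And>t v. v \<in> coord (born \<A> t) \<Longrightarrow> \<phi> t (\<pi> t v) = \<rho> t (mvec (bars \<B>) (bars \<A>) X v)"
  shows "induces \<A> \<pi> \<B> \<rho> \<phi> X"
  using assms unfolding induces_def filtered_def by blast

lemma induces_comp:
  assumes X: "induces \<A> \<pi> \<B> \<rho> \<phi> X" and Y: "induces \<B> \<rho> \<C> \<sigma> \<psi> Y"
  shows "induces \<A> \<pi> \<C> \<sigma> (\<lambda>t x. \<psi> t (\<phi> t x)) (mmul (bars \<B>) Y X)"
  by (rule inducesI; unfold mvec_mmul)
    (blast intro: induces_born[OF X] induces_born[OF Y] induces_dead[OF X] induces_dead[OF Y],
     blast intro: induces_born[OF X] induces_born[OF Y] induces_dead[OF X] induces_dead[OF Y],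
     simp only: induces_eq[OF X] induces_eq[OF Y] induces_born[OF X])

lemma induces_cong_proj:
  assumes "induces \<A> \<pi> \<B> \<rho> \<phi> X"
    and "\<And>t v. v \<in> coord (born \<A> t) \<Longrightarrow> \<pi>' t v = \<pi> t v"
    and "\<And>t v. v \<in> coord (born \<B> t) \<Longrightarrow> \<rho>' t v = \<rho> t v"
  shows "induces \<A> \<pi>' \<B> \<rho>' \<phi> X"
  using induces_born[OF assms(1)] induces_dead[OF assms(1)] induces_eq[OF assms(1)] assms(2,3)
  by (intro inducesI) simp_all

section \<open>Presenting a kernel and morphisms into it\<close>

lemma pmod_kernel_carrier:
  "carrier (space (pmod_kernel A B \<phi>) t) = {x \<in> carrier (space A t). \<phi> t x = \<zero>\<^bsub>space B t\<^esub>}"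
  by (simp add: pmod_kernel_def a_kernel_def')

lemma pmod_kernel_simps:
  "x \<oplus>\<^bsub>space (pmod_kernel A B \<phi>) t\<^esub> y = x \<oplus>\<^bsub>space A t\<^esub> y"
  "a \<odot>\<^bsub>space (pmod_kernel A B \<phi>) t\<^esub> x = a \<odot>\<^bsub>space A t\<^esub> x"
  "\<zero>\<^bsub>space (pmod_kernel A B \<phi>) t\<^esub> = \<zero>\<^bsub>space A t\<^esub>"
  "transition (pmod_kernel A B \<phi>) = transition A"
  by (simp_all add: pmod_kernel_def)

lemma vectorspace_submodule:
  assumes "vectorspace K V" "submodule K N V"
  shows "vectorspace K (V\<lparr>carrier := N\<rparr>)"
  using vectorspace.subspace_is_vs[OF assms(1)] assms by (simp add: subspace_def)

lemma module_hom_mod_hom: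
  assumes "vectorspace K V" "vectorspace K W" "f \<in> LinearCombinations.module_hom K V W"
  shows "mod_hom K V W f"
  unfolding mod_hom_def mod_hom_axioms_def by (intro conjI vectorspace_module assms)

lemma persistence_moduleI:
  assumes "\<And>t. vectorspace class_ring (space A t)"
    and "\<And>s t. s \<le> t \<Longrightarrow> transition A s t \<in> LinearCombinations.module_hom class_ring (space A s) (space A t)"
    and "\<And>t x. x \<in> carrier (space A t) \<Longrightarrow> transition A t t x = x"
    and "\<And>r s t x. r \<le> s \<Longrightarrow> s \<le> t \<Longrightarrow> x \<in> carrier (space A r) \<Longrightarrow>
      transition A s t (transition A r s x) = transition A r t x"
  shows "persistence_module A"
  unfolding persistence_module_def
  by (intro conjI allI impI ballI; (elim conjE)?; rule assms; assumption)

lemma module_homI: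
  assumes "\<And>x. x \<in> carrier V \<Longrightarrow> f x \<in> carrier W"
    and "\<And>x y. x \<in> carrier V \<Longrightarrow> y \<in> carrier V \<Longrightarrow> f (x \<oplus>\<^bsub>V\<^esub> y) = f x \<oplus>\<^bsub>W\<^esub> f y"
    and "\<And>a x. x \<in> carrier V \<Longrightarrow> f (a \<odot>\<^bsub>V\<^esub> x) = a \<odot>\<^bsub>W\<^esub> f x"
  shows "f \<in> LinearCombinations.module_hom class_ring V W"
  using assms unfolding LinearCombinations.module_hom_def by blast

lemma persistence_module_refl:
  "persistence_module A \<Longrightarrow> x \<in> carrier (space A t) \<Longrightarrow> transition A t t x = x"
  by (simp add: persistence_module_def)

lemma persistence_module_trans:
  "persistence_module A \<Longrightarrow> r \<le> s \<Longrightarrow> s \<le> t \<Longrightarrow> x \<in> carrier (space A r) \<Longrightarrow>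
   transition A s t (transition A r s x) = transition A r t x"
  unfolding persistence_module_def by blast

lemma pmod_kernel_persistence_module:
  assumes A: "persistence_module A" and B: "persistence_module B" and \<phi>: "pmod_hom A B \<phi>"
  shows "persistence_module (pmod_kernel A B \<phi>)"
proof (rule persistence_moduleI)
  show "vectorspace class_ring (space (pmod_kernel A B \<phi>) t)" for t
  proof -
    interpret mod_hom class_ring "space A t" "space B t" "\<phi> t"
      using A B \<phi> by (intro module_hom_mod_hom persistence_module_vectorspace pmod_hom_module_hom)
    have "ker = a_kernel (space A t) (space B t) (\<phi> t)"
      by (auto simp: ker_def a_kernel_def')
    then show ?thesis
      using vectorspace_submodule[OF persistence_module_vectorspace[OF A] ker_is_submodule]
      by (simp add: pmod_kernel_def)
  qed
  note hom = persistence_module_transition_hom[OF A]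
  show "transition (pmod_kernel A B \<phi>) s t
      \<in> LinearCombinations.module_hom class_ring (space (pmod_kernel A B \<phi>) s) (space (pmod_kernel A B \<phi>) t)"
    if st: "s \<le> t" for s t
  proof (rule module_homI; unfold pmod_kernel_simps)
    fix x assume x: "x \<in> carrier (space (pmod_kernel A B \<phi>) s)"
    then have "\<phi> t (transition A s t x) = transition B s t (\<zero>\<^bsub>space B s\<^esub>)"
      using pmod_hom_transition[OF \<phi> st, of x] by (simp add: pmod_kernel_carrier)
    also have "\<dots> = \<zero>\<^bsub>space B t\<^esub>"
      using B st by (intro module_hom_zero persistence_module_transition_hom persistence_module_vectorspace)
    finally show "transition A s t x \<in> carrier (space (pmod_kernel A B \<phi>) t)"
      using module_hom_mem[OF hom[OF st]] x by (simp add: pmod_kernel_carrier)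
  next
    fix a x assume "x \<in> carrier (space (pmod_kernel A B \<phi>) s)"
    then show "transition A s t (a \<odot>\<^bsub>space A s\<^esub> x) = a \<odot>\<^bsub>space A t\<^esub> transition A s t x"
      using module_hom_scale[OF hom[OF st]] by (simp add: pmod_kernel_carrier)
  next
    fix x y assume "x \<in> carrier (space (pmod_kernel A B \<phi>) s)" "y \<in> carrier (space (pmod_kernel A B \<phi>) s)"
    then show "transition A s t (x \<oplus>\<^bsub>space A s\<^esub> y) = transition A s t x \<oplus>\<^bsub>space A t\<^esub> transition A s t y"
      using LinearCombinations.module_hom_add[OF hom[OF st]] by (simp add: pmod_kernel_carrier)
  qed
qed (simp_all add: pmod_kernel_carrier pmod_kernel_simps persistence_module_refl[OF A]
    persistence_module_trans[OF A])

text \<open>The kernel of the map of quotients induced by X consists of the v in E_t with X v in the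
  F_t of the codomain, taken modulo the F_t of the domain. The hypotheses \<open>KB\<close> and
  \<open>KD\<close> say that T identifies the coordinate spaces of \<K> with these two
  spaces.\<close>

lemma kernel_presents:
  assumes A: "presents A \<A> \<pi>" and B: "presents B \<B> \<rho>" and \<phi>: "pmod_hom A B \<phi>"
    and X: "induces \<A> \<pi> \<B> \<rho> \<phi> X" and bars: "bars \<K> = bars \<A>"
    and T: "minvertible (bars \<A>) T"
    and KB: "\<And>t. mvec (bars \<A>) (bars \<A>) T ` coord (born \<K> t) =
      {v \<in> coord (born \<A> t). mvec (bars \<B>) (bars \<A>) X v \<in> coord (dead \<B> t)}"
    and KD: "\<And>t. mvec (bars \<A>) (bars \<A>) T ` coord (dead \<K> t) = coord (dead \<A> t)"
  shows "presents (pmod_kernel A B \<phi>) \<K> (\<lambda>t w. \<pi> t (mvec (bars \<A>) (bars \<A>) T w))"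
    and "induces \<K> (\<lambda>t w. \<pi> t (mvec (bars \<A>) (bars \<A>) T w)) \<A> \<pi> (\<lambda>t x. x) T"
proof -
  let ?T = "mvec (bars \<A>) (bars \<A>) T"
  note fin = presents.finite_bars[OF A]
  have Tborn: "?T w \<in> coord (born \<A> t)" and TX: "mvec (bars \<B>) (bars \<A>) X (?T w) \<in> coord (dead \<B> t)"
    if "w \<in> coord (born \<K> t)" for w t
    using KB[of t] that by blast+
  have inj: "u = v" if "?T u = ?T v" "u \<in> coord (bars \<A>)" "v \<in> coord (bars \<A>)" for u v
    using minvertible_cancel[OF fin T that(2,3,1)] .
  have sub: "w \<in> coord (bars \<A>)" if "w \<in> coord (born \<K> t) \<or> w \<in> coord (dead \<K> t)" for w :: "'d \<Rightarrow> 'b" and t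
    using that coord_subsetD[OF _ born_subset[of \<K> t]] coord_subsetD[OF _ dead_subset[of \<K> t]] bars by auto
  have kernel: "\<phi> t (\<pi> t v) = \<zero>\<^bsub>space B t\<^esub> \<longleftrightarrow> mvec (bars \<B>) (bars \<A>) X v \<in> coord (dead \<B> t)"
    if "v \<in> coord (born \<A> t)" for v t
    unfolding induces_eq[OF X that] using presents.zero_iff[OF B induces_born[OF X that]] .
  show "presents (pmod_kernel A B \<phi>) \<K> (\<lambda>t w. \<pi> t (?T w))"
  proof (rule presents.intro; (unfold pmod_kernel_simps)?)
    show "persistence_module (pmod_kernel A B \<phi>)"
      using presents.pmod[OF A] presents.pmod[OF B] \<phi> by (rule pmod_kernel_persistence_module)
    show "finite (bars \<K>)" using fin bars by simp
    \<comment> \<open>That a kernel bar is not born after its death comes from the inclusion of dead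
      vectors of \<A> in the preimage of dead vectors of \<B>, carried back by the injectivity of T,
      and not from the formulas for the two cuts.\<close>
    show "dead \<K> t \<subseteq> born \<K> t" for t
    proof
      fix j assume j: "j \<in> dead \<K> t"
      let ?e = "\<lambda>k. if k = j then 1 else (0 :: 'b)"
      have e: "?e \<in> coord (dead \<K> t)" using j by (simp only: unit_coord_iff)
      then have Te: "?T ?e \<in> coord (dead \<A> t)" using KD by blast
      then have "?T ?e \<in> coord (born \<A> t)" using presents.dead_born[OF A] coord_subsetD by blast
      then have "?T ?e \<in> ?T ` coord (born \<K> t)"
        unfolding KB using induces_dead[OF X Te] by blast
      then obtain w where "w \<in> coord (born \<K> t)" "?T ?e = ?T w" by blast
      then have "?e \<in> coord (born \<K> t)" using inj sub e by metis
      then show "j \<in> born \<K> t" by (simp only: unit_coord_iff)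
    qed
    show "\<pi> t (?T v) \<in> carrier (space (pmod_kernel A B \<phi>) t)" if v: "v \<in> coord (born \<K> t)" for v t
      using presents.closed[OF A Tborn[OF v]] kernel[OF Tborn[OF v]] TX[OF v]
      by (simp add: pmod_kernel_carrier)
    show "\<exists>w\<in>coord (born \<K> t). x = \<pi> t (?T w)" if x: "x \<in> carrier (space (pmod_kernel A B \<phi>) t)" for x t
    proof -
      have "x \<in> carrier (space A t)" using x by (simp add: pmod_kernel_carrier)
      then obtain v where v: "v \<in> coord (born \<A> t)" "x = \<pi> t v" by (rule presents_surj[OF A])
      then have "v \<in> ?T ` coord (born \<K> t)"
        unfolding KB using kernel[OF v(1)] x by (simp add: pmod_kernel_carrier)
      then show ?thesis using v(2) by blast
    qed
    show "\<pi> t (?T (\<lambda>j. u j + v j)) = \<pi> t (?T u) \<oplus>\<^bsub>space A t\<^esub> \<pi> t (?T v)"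
      if "u \<in> coord (born \<K> t)" "v \<in> coord (born \<K> t)" for u v t
      unfolding mvec_add using presents.add[OF A Tborn[OF that(1)] Tborn[OF that(2)]] .
    show "\<pi> t (?T (\<lambda>j. a * v j)) = a \<odot>\<^bsub>space A t\<^esub> \<pi> t (?T v)" if "v \<in> coord (born \<K> t)" for a v t
      unfolding mvec_scale using presents.scale[OF A Tborn[OF that]] .
    show "\<pi> t (?T v) = \<zero>\<^bsub>space A t\<^esub> \<longleftrightarrow> v \<in> coord (dead \<K> t)" if v: "v \<in> coord (born \<K> t)" for v t
    proof -
      have "?T v \<in> coord (dead \<A> t) \<longleftrightarrow> v \<in> coord (dead \<K> t)"
      proof
        assume "?T v \<in> coord (dead \<A> t)"
        then obtain w where w: "w \<in> coord (dead \<K> t)" "?T v = ?T w"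
          unfolding KD[symmetric] by blast
        then have "v = w" using inj sub v by blast
        then show "v \<in> coord (dead \<K> t)" using w(1) by simp
      qed (use KD in blast)
      then show ?thesis using presents.zero_iff[OF A Tborn[OF v]] by simp
    qed
    show "transition A s t (\<pi> s (?T v)) = \<pi> t (?T v)" if "s \<le> t" "v \<in> coord (born \<K> s)" for s t v
      using presents.transition[OF A that(1) Tborn[OF that(2)]] .
  qed
  show "induces \<K> (\<lambda>t w. \<pi> t (?T w)) \<A> \<pi> (\<lambda>t x. x) T"
  proof (rule inducesI; unfold bars)
    show "?T v \<in> coord (born \<A> t)" if "v \<in> coord (born \<K> t)" for v t
      using Tborn[OF that] .
    show "?T v \<in> coord (dead \<A> t)" if "v \<in> coord (dead \<K> t)" for v t
      using KD[of t] that by blast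
  qed simp
qed

text \<open>A vector Y v whose image under \<phi> is zero lies in the image of T on bars born by t,
  so the inverse of T lands in the right coordinate space. This serves both the boundary map with
  restricted codomain and the map on cycles.\<close>

lemma induces_into_kernel:
  assumes B: "presents B \<B> \<rho>"
    and X: "induces \<A> \<pi> \<B> \<rho> \<phi> X"
    and Y: "induces \<C> \<sigma> \<A> \<pi> \<psi> Y"
    and zero: "\<And>t x. x \<in> \<sigma> t ` coord (born \<C> t) \<Longrightarrow> \<phi> t (\<psi> t x) = \<zero>\<^bsub>space B t\<^esub>"
    and fin: "finite (bars \<A>)" and bars: "bars \<K> = bars \<A>" and T: "minvertible (bars \<A>) T"
    and KB: "\<And>t. mvec (bars \<A>) (bars \<A>) T ` coord (born \<K> t) =
      {v \<in> coord (born \<A> t). mvec (bars \<B>) (bars \<A>) X v \<in> coord (dead \<B> t)}"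
    and KD: "\<And>t. mvec (bars \<A>) (bars \<A>) T ` coord (dead \<K> t) = coord (dead \<A> t)"
    and \<kappa>: "induces \<K> \<kappa> \<A> \<pi> (\<lambda>t x. x) T"
  shows "induces \<C> \<sigma> \<K> \<kappa> \<psi> (mmul (bars \<A>) (minv (bars \<A>) T) Y)"
proof -
  let ?T = "mvec (bars \<A>) (bars \<A>) T" and ?T' = "mvec (bars \<A>) (bars \<A>) (minv (bars \<A>) T)"
    and ?Y = "mvec (bars \<A>) (bars \<C>) Y"
  have cancel: "?T' (?T w) = w" if "w \<in> coord (bars \<A>)" for w
    using minverts_mvec(2)[OF fin minverts_minv[OF T] that] .
  have born: "\<exists>w\<in>coord (born \<K> t). ?Y v = ?T w \<and> ?T' (?Y v) = w" if v: "v \<in> coord (born \<C> t)" for v t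
  proof -
    have Yv: "?Y v \<in> coord (born \<A> t)" using induces_born[OF Y v] .
    have "\<rho> t (mvec (bars \<B>) (bars \<A>) X (?Y v)) = \<zero>\<^bsub>space B t\<^esub>"
      using zero[of "\<sigma> t v" t] v induces_eq[OF Y v] induces_eq[OF X Yv] by simp
    then have "?Y v \<in> ?T ` coord (born \<K> t)"
      unfolding KB using Yv presents.zero_iff[OF B induces_born[OF X Yv]] by blast
    then obtain w where w: "w \<in> coord (born \<K> t)" "?Y v = ?T w" by blast
    moreover have "w \<in> coord (bars \<A>)"
      using coord_subsetD[OF w(1) born_subset] bars by simp
    ultimately show ?thesis using cancel by auto
  qed
  show ?thesis
  proof (rule inducesI; unfold mvec_mmul bars)
    show "?T' (?Y v) \<in> coord (born \<K> t)" if "v \<in> coord (born \<C> t)" for v t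
      using born[OF that] by auto
    show "?T' (?Y v) \<in> coord (dead \<K> t)" if v: "v \<in> coord (dead \<C> t)" for v t
    proof -
      have "?Y v \<in> ?T ` coord (dead \<K> t)"
        unfolding KD using induces_dead[OF Y v] .
      then obtain w where w: "w \<in> coord (dead \<K> t)" "?Y v = ?T w" by blast
      moreover have "w \<in> coord (bars \<A>)"
        using coord_subsetD[OF w(1) dead_subset] bars by simp
      ultimately show ?thesis using cancel by simp
    qed
    show "\<psi> t (\<sigma> t v) = \<kappa> t (?T' (?Y v))" if v: "v \<in> coord (born \<C> t)" for v t
    proof -
      obtain w where w: "w \<in> coord (born \<K> t)" "?Y v = ?T w" "?T' (?Y v) = w"
        using born[OF v] by blast
      have "\<psi> t (\<sigma> t v) = \<pi> t (?T w)"
        using induces_eq[OF Y v] w(2) by simp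
      also have "\<dots> = \<kappa> t w"
        using induces_eq[OF \<kappa> w(1)] bars by simp
      finally show ?thesis using w(3) by simp
    qed
  qed
qed

section \<open>Quotient spaces, quotient modules and their presentations\<close>

lemma submodule_additive_subgroup:
  assumes "vectorspace K V" "submodule K N V"
  shows "additive_subgroup N V"
proof -
  interpret vectorspace K V by (fact assms(1))
  interpret S: submodule K N V by (fact assms(2))
  show ?thesis
  proof (rule additive_subgroup.intro, rule add.subgroupI)
    show "\<ominus>\<^bsub>V\<^esub> x \<in> N" if "x \<in> N" for x
    proof -
      have "(\<ominus>\<^bsub>K\<^esub> \<one>\<^bsub>K\<^esub>) \<odot>\<^bsub>V\<^esub> x \<in> N" using that by (intro S.smult_closed) auto
      then show ?thesis by (simp only: smult_minus_1[OF subsetD[OF S.subset that]])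
    qed
    show "N \<noteq> {}" using S.zero_closed by blast
  qed (use S.subset S.m_closed in auto)
qed

lemma submodule_abelian_subgroup:
  assumes "vectorspace K V" "submodule K N V"
  shows "abelian_subgroup N V"
  using submodule_additive_subgroup[OF assms] vectorspace_abelian_group[OF assms(1)]
  by (rule abelian_subgroupI3)

text \<open>All members of a source coset lead to the same target coset, so the union defining
  \<open>coset_map\<close> collapses to a single coset.\<close>

lemma coset_map_coset:
  assumes V: "vectorspace K V" "submodule K N V" and W: "vectorspace K W" "submodule K M W"
    and g: "g \<in> carrier V \<rightarrow> carrier W" "g ` N \<subseteq> M"
    and add: "\<And>x y. x \<in> carrier V \<Longrightarrow> y \<in> carrier V \<Longrightarrow> g (x \<oplus>\<^bsub>V\<^esub> y) = g x \<oplus>\<^bsub>W\<^esub> g y"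
    and x: "x \<in> carrier V"
  shows "coset_map W M g (N +>\<^bsub>V\<^esub> x) = M +>\<^bsub>W\<^esub> g x"
proof -
  interpret N: abelian_subgroup N V using submodule_abelian_subgroup[OF V] .
  interpret M: abelian_subgroup M W using submodule_abelian_subgroup[OF W] .
  have "M +>\<^bsub>W\<^esub> g y = M +>\<^bsub>W\<^esub> g x" if y: "y \<in> N +>\<^bsub>V\<^esub> x" for y
  proof -
    obtain h where h: "h \<in> N" "y = h \<oplus>\<^bsub>V\<^esub> x" using y by (auto simp: a_r_coset_def')
    then have "g y = g h \<oplus>\<^bsub>W\<^esub> g x" using add x N.a_subset by blast
    then have "g y \<in> M +>\<^bsub>W\<^esub> g x" using g(2) h(1) by (auto simp: a_r_coset_def')
    then show ?thesis
      using M.a_repr_independence[of "g y" M "g x"] x g(1) M.a_subgroup by blast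
  qed
  moreover have "x \<in> N +>\<^bsub>V\<^esub> x" using N.a_rcos_self x .
  ultimately show ?thesis unfolding coset_map_def by blast
qed

text \<open>Transport of structure: the axioms are equations, apart from closure and inverses, and
  all of them pass to the image of a surjection that respects the operations.\<close>

lemma vectorspace_surjection:
  assumes V: "vectorspace class_ring V" and q: "q ` carrier V = carrier W"
    and add: "\<And>x y. x \<in> carrier V \<Longrightarrow> y \<in> carrier V \<Longrightarrow> q (x \<oplus>\<^bsub>V\<^esub> y) = q x \<oplus>\<^bsub>W\<^esub> q y"
    and scale: "\<And>a x. x \<in> carrier V \<Longrightarrow> q (a \<odot>\<^bsub>V\<^esub> x) = a \<odot>\<^bsub>W\<^esub> q x"
    and zero: "q \<zero>\<^bsub>V\<^esub> = \<zero>\<^bsub>W\<^esub>"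
  shows "vectorspace (class_ring :: 'f::field ring) W"
proof -
  interpret vectorspace "class_ring :: 'f ring" V by (fact V)
  have car: "\<exists>u\<in>carrier V. x = q u" if "x \<in> carrier W" for x
    using that q by blast
  have qc: "q u \<in> carrier W" if "u \<in> carrier V" for u
    using that q by blast
  have sc: "a \<odot>\<^bsub>V\<^esub> u \<in> carrier V" if "u \<in> carrier V" for a u
    using smult_closed[of a u] that by simp
  have "abelian_group W"
  proof (rule abelian_groupI)
    show "x \<oplus>\<^bsub>W\<^esub> y \<in> carrier W" if xy: "x \<in> carrier W" "y \<in> carrier W" for x y
    proof -
      obtain u v where u: "u \<in> carrier V" "x = q u" and v: "v \<in> carrier V" "y = q v"
        using car xy by blast
      show ?thesis using qc[OF M.a_closed[OF u(1) v(1)]] by (simp only: u(2) v(2) add[OF u(1) v(1)])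
    qed
    show "\<zero>\<^bsub>W\<^esub> \<in> carrier W" using qc[OF M.zero_closed] by (simp only: zero)
    show "(x \<oplus>\<^bsub>W\<^esub> y) \<oplus>\<^bsub>W\<^esub> z = x \<oplus>\<^bsub>W\<^esub> (y \<oplus>\<^bsub>W\<^esub> z)"
      if xyz: "x \<in> carrier W" "y \<in> carrier W" "z \<in> carrier W" for x y z
    proof -
      obtain u v where u: "u \<in> carrier V" "x = q u" and v: "v \<in> carrier V" "y = q v"
        using car xyz(1,2) by blast
      obtain w where w: "w \<in> carrier V" "z = q w" using car xyz(3) by blast
      show ?thesis
        unfolding u(2) v(2) w(2) using u(1) v(1) w(1)
        by (simp only: add[symmetric] M.a_closed M.a_assoc)
    qed
    show "x \<oplus>\<^bsub>W\<^esub> y = y \<oplus>\<^bsub>W\<^esub> x" if xy: "x \<in> carrier W" "y \<in> carrier W" for x y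
    proof -
      obtain u v where u: "u \<in> carrier V" "x = q u" and v: "v \<in> carrier V" "y = q v"
        using car xy by blast
      show ?thesis
        using M.a_comm[OF u(1) v(1)] by (simp only: u(2) v(2) add[OF u(1) v(1), symmetric] add[OF v(1) u(1), symmetric])
    qed
    show "\<zero>\<^bsub>W\<^esub> \<oplus>\<^bsub>W\<^esub> x = x" if x: "x \<in> carrier W" for x
    proof -
      obtain u where u: "u \<in> carrier V" "x = q u" using car x by blast
      show ?thesis
        using M.l_zero[OF u(1)] by (simp only: u(2) zero[symmetric] add[OF M.zero_closed u(1), symmetric])
    qed
    show "\<exists>y\<in>carrier W. y \<oplus>\<^bsub>W\<^esub> x = \<zero>\<^bsub>W\<^esub>" if x: "x \<in> carrier W" for x
    proof -
      obtain u where u: "u \<in> carrier V" "x = q u" using car x by blast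
      have m: "\<ominus>\<^bsub>V\<^esub> u \<in> carrier V" using u(1) by (rule M.a_inv_closed)
      show ?thesis
      proof
        show "q (\<ominus>\<^bsub>V\<^esub> u) \<in> carrier W" using qc[OF m] .
        show "q (\<ominus>\<^bsub>V\<^esub> u) \<oplus>\<^bsub>W\<^esub> x = \<zero>\<^bsub>W\<^esub>"
          using M.l_neg[OF u(1)] by (simp only: u(2) add[OF m u(1), symmetric] zero)
      qed
    qed
  qed
  then have "Module.module (class_ring :: 'f ring) W"
  proof (rule moduleI[OF module.axioms(1)[OF vectorspace_module[OF V]]])
    show "a \<odot>\<^bsub>W\<^esub> x \<in> carrier W" if x: "x \<in> carrier W" for a x
    proof -
      obtain u where u: "u \<in> carrier V" "x = q u" using car x by blast
      show ?thesis using qc[OF sc[OF u(1)]] by (simp only: u(2) scale[OF u(1)])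
    qed
    show "(a \<oplus>\<^bsub>class_ring\<^esub> b) \<odot>\<^bsub>W\<^esub> x = a \<odot>\<^bsub>W\<^esub> x \<oplus>\<^bsub>W\<^esub> b \<odot>\<^bsub>W\<^esub> x"
      if ab: "a \<in> carrier class_ring" "b \<in> carrier class_ring" and x: "x \<in> carrier W" for a b :: 'f and x
    proof -
      obtain u where u: "u \<in> carrier V" "x = q u" using car x by blast
      show ?thesis
        using arg_cong[OF smult_l_distr[OF ab u(1)], of q]
        by (simp only: u(2) scale[OF u(1)] add[OF sc[OF u(1)] sc[OF u(1)]])
    qed
    show "a \<odot>\<^bsub>W\<^esub> (x \<oplus>\<^bsub>W\<^esub> y) = a \<odot>\<^bsub>W\<^esub> x \<oplus>\<^bsub>W\<^esub> a \<odot>\<^bsub>W\<^esub> y"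
      if a: "a \<in> carrier class_ring" and xy: "x \<in> carrier W" "y \<in> carrier W" for a :: 'f and x y
    proof -
      obtain u v where u: "u \<in> carrier V" "x = q u" and v: "v \<in> carrier V" "y = q v"
        using car xy by blast
      show ?thesis
        using arg_cong[OF smult_r_distr[OF a u(1) v(1)], of q]
        by (simp only: u(2) v(2) scale[OF u(1)] scale[OF v(1)] scale[OF M.a_closed[OF u(1) v(1)]]
            add[OF u(1) v(1)] add[OF sc[OF u(1)] sc[OF v(1)]])
    qed
    show "(a \<otimes>\<^bsub>class_ring\<^esub> b) \<odot>\<^bsub>W\<^esub> x = a \<odot>\<^bsub>W\<^esub> (b \<odot>\<^bsub>W\<^esub> x)"
      if ab: "a \<in> carrier class_ring" "b \<in> carrier class_ring" and x: "x \<in> carrier W" for a b :: 'f and x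
    proof -
      obtain u where u: "u \<in> carrier V" "x = q u" using car x by blast
      show ?thesis
        using arg_cong[OF smult_assoc1[OF ab u(1)], of q]
        by (simp only: u(2) scale[OF u(1)] scale[OF sc[OF u(1)]])
    qed
    show "\<one>\<^bsub>class_ring\<^esub> \<odot>\<^bsub>W\<^esub> x = x" if x: "x \<in> carrier W" for x
    proof -
      obtain u where u: "u \<in> carrier V" "x = q u" using car x by blast
      show ?thesis
        using arg_cong[OF smult_one[OF u(1)], of q] by (simp only: u(2) scale[OF u(1)])
    qed
  qed
  then show ?thesis
    using class_field by (rule vectorspace.intro)
qed

lemma quotient_space:
  fixes V :: "('f::field, 'v) module"
  assumes V: "vectorspace class_ring V" and N: "submodule class_ring N V"
  shows "(+>\<^bsub>V\<^esub>) N ` carrier V = carrier (quotient_space V N)"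
    and "\<And>x y. x \<in> carrier V \<Longrightarrow> y \<in> carrier V \<Longrightarrow>
      N +>\<^bsub>V\<^esub> (x \<oplus>\<^bsub>V\<^esub> y) = (N +>\<^bsub>V\<^esub> x) \<oplus>\<^bsub>quotient_space V N\<^esub> (N +>\<^bsub>V\<^esub> y)"
    and "\<And>a x. x \<in> carrier V \<Longrightarrow>
      N +>\<^bsub>V\<^esub> (a \<odot>\<^bsub>V\<^esub> x) = a \<odot>\<^bsub>quotient_space V N\<^esub> (N +>\<^bsub>V\<^esub> x)"
    and "\<And>x. x \<in> carrier V \<Longrightarrow> N +>\<^bsub>V\<^esub> x = \<zero>\<^bsub>quotient_space V N\<^esub> \<longleftrightarrow> x \<in> N"
    and "vectorspace class_ring (quotient_space V N)"
proof -
  interpret vectorspace class_ring V by (fact V)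
  interpret N: abelian_subgroup N V using submodule_abelian_subgroup[OF V N] .
  show surj: "(+>\<^bsub>V\<^esub>) N ` carrier V = carrier (quotient_space V N)"
    by (auto simp: quotient_space_def A_RCOSETS_def')
  show add: "N +>\<^bsub>V\<^esub> (x \<oplus>\<^bsub>V\<^esub> y) = (N +>\<^bsub>V\<^esub> x) \<oplus>\<^bsub>quotient_space V N\<^esub> (N +>\<^bsub>V\<^esub> y)"
    if "x \<in> carrier V" "y \<in> carrier V" for x y
    using N.a_rcos_sum[OF that] by (simp add: quotient_space_def)
  show scale: "N +>\<^bsub>V\<^esub> (a \<odot>\<^bsub>V\<^esub> x) = a \<odot>\<^bsub>quotient_space V N\<^esub> (N +>\<^bsub>V\<^esub> x)"
    if "x \<in> carrier V" for a x
  proof -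
    \<comment> \<open>The scalar action on cosets is the coset map of multiplication by a, so the
      previous lemma on cosets applies.\<close>
    have "coset_map V N (\<lambda>x. a \<odot>\<^bsub>V\<^esub> x) (N +>\<^bsub>V\<^esub> x) = N +>\<^bsub>V\<^esub> (a \<odot>\<^bsub>V\<^esub> x)"
    proof (rule coset_map_coset[OF V N V N _ _ _ that])
      show "(\<odot>\<^bsub>V\<^esub>) a \<in> carrier V \<rightarrow> carrier V" using smult_closed[of a] by simp
      show "(\<odot>\<^bsub>V\<^esub>) a ` N \<subseteq> N" using submodule.smult_closed[OF N, of a] by auto
    qed (use smult_r_distr[of a] in simp)
    then show ?thesis by (simp add: quotient_space_def coset_map_def)
  qed
  show zero: "N +>\<^bsub>V\<^esub> x = \<zero>\<^bsub>quotient_space V N\<^esub> \<longleftrightarrow> x \<in> N" if "x \<in> carrier V" for x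
    using M.a_coset_join1[OF _ that N.a_subgroup] M.a_coset_join2[OF that N.a_subgroup]
    by (auto simp: quotient_space_def)
  show "vectorspace class_ring (quotient_space V N)"
  proof (rule vectorspace_surjection[where q = "a_r_coset V N", OF V surj])
    show "N +>\<^bsub>V\<^esub> \<zero>\<^bsub>V\<^esub> = \<zero>\<^bsub>quotient_space V N\<^esub>"
      using zero[OF M.zero_closed] submodule.zero_closed[OF N] by simp
  qed (fact add scale)+
qed

lemma pmod_quotient_persistence_module:
  assumes Z: "persistence_module Z" and N: "\<And>t. submodule class_ring (N t) (space Z t)"
    and trans: "\<And>s t. s \<le> t \<Longrightarrow> transition Z s t ` N s \<subseteq> N t"
  shows "persistence_module (pmod_quotient Z N)" and "pmod_hom Z (pmod_quotient Z N) (quotient_map Z N)"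
proof -
  let ?H = "pmod_quotient Z N" and ?q = "quotient_map Z N"
  note V = persistence_module_vectorspace[OF Z]
  note q = quotient_space[OF V N]
  have sp: "space ?H t = quotient_space (space Z t) (N t)" for t
    by (simp add: pmod_quotient_def)
  have qt: "?q t x = N t +>\<^bsub>space Z t\<^esub> x" for t x
    by (simp add: quotient_map_def)
  have tr: "transition ?H s t (?q s x) = ?q t (transition Z s t x)"
    if st: "s \<le> t" and x: "x \<in> carrier (space Z s)" for s t x
  proof -
    note hom = persistence_module_transition_hom[OF Z st]
    have "coset_map (space Z t) (N t) (transition Z s t) (N s +>\<^bsub>space Z s\<^esub> x) =
        N t +>\<^bsub>space Z t\<^esub> transition Z s t x"
      by (rule coset_map_coset[OF V N V N _ trans[OF st] _ x])
        (use module_hom_mem[OF hom] LinearCombinations.module_hom_add[OF hom] in auto)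
    then show ?thesis by (simp add: qt pmod_quotient_def)
  qed
  have car: "\<exists>x\<in>carrier (space Z t). y = ?q t x" if "y \<in> carrier (space ?H t)" for t y
    using that q(1)[of t] unfolding sp qt by blast
  have qhom: "?q t \<in> LinearCombinations.module_hom class_ring (space Z t) (space ?H t)" for t
  proof (rule module_homI; unfold sp qt)
    show "N t +>\<^bsub>space Z t\<^esub> x \<in> carrier (quotient_space (space Z t) (N t))" if "x \<in> carrier (space Z t)" for x
      using q(1)[of t] that by blast
  qed (use q(2,3) in auto)
  show "pmod_hom Z ?H ?q"
    unfolding pmod_hom_def using qhom tr by simp
  note qmem = module_hom_mem[OF qhom] and qadd = LinearCombinations.module_hom_add[OF qhom]
    and qscale = module_hom_scale[OF qhom]
  show "persistence_module ?H"
  proof (rule persistence_moduleI)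
    show "vectorspace class_ring (space ?H t)" for t
      unfolding sp using q(5) .
    show "transition ?H s t \<in> LinearCombinations.module_hom class_ring (space ?H s) (space ?H t)"
      if st: "s \<le> t" for s t
    proof (rule module_homI)
      note hom = persistence_module_transition_hom[OF Z st]
      note tmem = module_hom_mem[OF hom]
      show "transition ?H s t x \<in> carrier (space ?H t)" if x: "x \<in> carrier (space ?H s)" for x
      proof -
        obtain u where u: "u \<in> carrier (space Z s)" "x = ?q s u" using car[OF x] by blast
        show ?thesis using qmem[OF tmem[OF u(1)]] by (simp only: u(2) tr[OF st u(1)])
      qed
      show "transition ?H s t (x \<oplus>\<^bsub>space ?H s\<^esub> y) = transition ?H s t x \<oplus>\<^bsub>space ?H t\<^esub> transition ?H s t y"
        if xy: "x \<in> carrier (space ?H s)" "y \<in> carrier (space ?H s)" for x y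
      proof -
        obtain u where u: "u \<in> carrier (space Z s)" "x = ?q s u" using car[OF xy(1)] by blast
        obtain v where v: "v \<in> carrier (space Z s)" "y = ?q s v" using car[OF xy(2)] by blast
        have uv: "u \<oplus>\<^bsub>space Z s\<^esub> v \<in> carrier (space Z s)"
          using abelian_monoid.a_closed[OF abelian_group.axioms(1)[OF vectorspace_abelian_group[OF V]] u(1) v(1)] .
        show ?thesis
          unfolding u(2) v(2) qadd[OF u(1) v(1), symmetric] tr[OF st uv] tr[OF st u(1)] tr[OF st v(1)]
            LinearCombinations.module_hom_add[OF hom u(1) v(1)]
          using qadd[OF tmem[OF u(1)] tmem[OF v(1)]] .
      qed
      show "transition ?H s t (a \<odot>\<^bsub>space ?H s\<^esub> x) = a \<odot>\<^bsub>space ?H t\<^esub> transition ?H s t x"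
        if x: "x \<in> carrier (space ?H s)" for a x
      proof -
        obtain u where u: "u \<in> carrier (space Z s)" "x = ?q s u" using car[OF x] by blast
        have au: "a \<odot>\<^bsub>space Z s\<^esub> u \<in> carrier (space Z s)"
          using module.smult_closed[OF vectorspace_module[OF V], of a, OF _ u(1)] by simp
        show ?thesis
          unfolding u(2) qscale[OF u(1), symmetric] tr[OF st au] tr[OF st u(1)] module_hom_scale[OF hom u(1)]
          using qscale[OF tmem[OF u(1)]] .
      qed
    qed
    show "transition ?H t t x = x" if x: "x \<in> carrier (space ?H t)" for t x
    proof -
      obtain u where u: "u \<in> carrier (space Z t)" "x = ?q t u" using car[OF x] by blast
      show ?thesis unfolding u(2) tr[OF order_refl u(1)] persistence_module_refl[OF Z u(1)] ..
    qed
    show "transition ?H s t (transition ?H r s x) = transition ?H r t x"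
      if rs: "r \<le> s" and st: "s \<le> t" and x: "x \<in> carrier (space ?H r)" for r s t x
    proof -
      obtain u where u: "u \<in> carrier (space Z r)" "x = ?q r u" using car[OF x] by blast
      show ?thesis
        unfolding u(2) tr[OF rs u(1)] tr[OF order_trans[OF rs st] u(1)]
          tr[OF st module_hom_mem[OF persistence_module_transition_hom[OF Z rs] u(1)]]
          persistence_module_trans[OF Z rs st u(1)] ..
    qed
  qed
qed

text \<open>S identifies E_t of \<Z> with E_t of \<H>, and the vectors presenting elements of N with
  F_t of \<H>. The presentation of the quotient therefore undoes S, applies \<pi> and passes to
  cosets.\<close>

lemma quotient_presents:
  assumes Z: "presents Z \<Z> \<pi>" and N: "\<And>t. submodule class_ring (N t) (space Z t)"
    and trans: "\<And>s t. s \<le> t \<Longrightarrow> transition Z s t ` N s \<subseteq> N t"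
    and bars: "bars \<H> = bars \<Z>" and S: "minvertible (bars \<Z>) S"
    and SB: "\<And>t w. w \<in> coord (bars \<Z>) \<Longrightarrow>
      mvec (bars \<Z>) (bars \<Z>) S w \<in> coord (born \<H> t) \<longleftrightarrow> w \<in> coord (born \<Z> t)"
    and SD: "\<And>t w. w \<in> coord (bars \<Z>) \<Longrightarrow>
      mvec (bars \<Z>) (bars \<Z>) S w \<in> coord (dead \<H> t) \<longleftrightarrow> w \<in> coord (born \<Z> t) \<and> \<pi> t w \<in> N t"
  defines "\<eta> \<equiv> \<lambda>t w. quotient_map Z N t (\<pi> t (mvec (bars \<Z>) (bars \<Z>) (minv (bars \<Z>) S) w))"
  shows "presents (pmod_quotient Z N) \<H> \<eta>" and "induces \<Z> \<pi> \<H> \<eta> (quotient_map Z N) S"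
proof -
  let ?H = "pmod_quotient Z N" and ?q = "quotient_map Z N"
  let ?S = "mvec (bars \<Z>) (bars \<Z>) S" and ?S' = "mvec (bars \<Z>) (bars \<Z>) (minv (bars \<Z>) S)"
  note Zp = presents.pmod[OF Z] and fin = presents.finite_bars[OF Z]
  note H = pmod_quotient_persistence_module[OF Zp N trans]
  note q = quotient_space[OF persistence_module_vectorspace[OF Zp] N]
  note qhom = pmod_hom_module_hom[OF H(2)]
  have SS': "?S (?S' w) = w" and S'S: "?S' (?S w) = w" if "w \<in> coord (bars \<Z>)" for w
    using minverts_mvec[OF fin minverts_minv[OF S] that] .
  have sub: "w \<in> coord (bars \<Z>)" if "w \<in> coord (born \<H> t)" for w :: "'d \<Rightarrow> 'b" and t
    using coord_subsetD[OF that born_subset] bars by simp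
  have born: "?S' w \<in> coord (born \<Z> t)" if "w \<in> coord (born \<H> t)" for w t
    using SB[OF mvec_in_coord, of "bars \<Z>" "minv (bars \<Z>) S" w t] SS'[OF sub[OF that]] that by simp
  have qzero: "?q t x = \<zero>\<^bsub>space ?H t\<^esub> \<longleftrightarrow> x \<in> N t" if "x \<in> carrier (space Z t)" for x t
    using q(4)[OF that] by (simp add: quotient_map_def pmod_quotient_def)
  show "presents ?H \<H> \<eta>"
    unfolding \<eta>_def
  proof (rule presents.intro)
    show "persistence_module ?H" using H(1) .
    show "finite (bars \<H>)" using fin bars by simp
    \<comment> \<open>Vectors presenting elements of N are in particular supported on bars born by
      t, so \<open>SD\<close> leads back to \<open>SB\<close>.\<close>
    show "dead \<H> t \<subseteq> born \<H> t" for t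
    proof
      fix j assume j: "j \<in> dead \<H> t"
      let ?e = "\<lambda>k. if k = j then 1 else (0 :: 'b)"
      have e: "?e \<in> coord (dead \<H> t)" using j by (simp only: unit_coord_iff)
      have SSe: "?S (?S' ?e) = ?e"
        using SS'[of ?e] coord_subsetD[OF e dead_subset] bars by simp
      have "?S' ?e \<in> coord (born \<Z> t)"
        using SD[OF mvec_in_coord, of "bars \<Z>" "minv (bars \<Z>) S" ?e t] e unfolding SSe by blast
      then have "?e \<in> coord (born \<H> t)"
        using SB[OF mvec_in_coord, of "bars \<Z>" "minv (bars \<Z>) S" ?e t] unfolding SSe by blast
      then show "j \<in> born \<H> t" by (simp only: unit_coord_iff)
    qed
    show "?q t (\<pi> t (?S' v)) \<in> carrier (space ?H t)" if v: "v \<in> coord (born \<H> t)" for v t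
      using module_hom_mem[OF qhom presents.closed[OF Z born[OF v]]] .
    show "\<exists>v\<in>coord (born \<H> t). x = ?q t (\<pi> t (?S' v))" if x: "x \<in> carrier (space ?H t)" for x t
    proof -
      have "x \<in> carrier (quotient_space (space Z t) (N t))"
        using x by (simp add: pmod_quotient_def)
      then obtain z where z: "z \<in> carrier (space Z t)" "x = ?q t z"
        unfolding q(1)[symmetric] quotient_map_def by blast
      obtain w where w: "w \<in> coord (born \<Z> t)" "z = \<pi> t w" using z(1) by (rule presents_surj[OF Z])
      have wb: "w \<in> coord (bars \<Z>)" using coord_subsetD[OF w(1) born_subset] .
      show ?thesis
      proof
        show "?S w \<in> coord (born \<H> t)" using SB[OF wb] w(1) by blast
        show "x = ?q t (\<pi> t (?S' (?S w)))" unfolding S'S[OF wb] z(2) w(2) ..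
      qed
    qed
    show "?q t (\<pi> t (?S' (\<lambda>j. u j + v j))) = ?q t (\<pi> t (?S' u)) \<oplus>\<^bsub>space ?H t\<^esub> ?q t (\<pi> t (?S' v))"
      if "u \<in> coord (born \<H> t)" "v \<in> coord (born \<H> t)" for u v t
      unfolding mvec_add presents.add[OF Z born[OF that(1)] born[OF that(2)]]
      using LinearCombinations.module_hom_add[OF qhom presents.closed[OF Z born[OF that(1)]]
          presents.closed[OF Z born[OF that(2)]]] .
    show "?q t (\<pi> t (?S' (\<lambda>j. a * v j))) = a \<odot>\<^bsub>space ?H t\<^esub> ?q t (\<pi> t (?S' v))"
      if "v \<in> coord (born \<H> t)" for a v t
      unfolding mvec_scale presents.scale[OF Z born[OF that]]
      using module_hom_scale[OF qhom presents.closed[OF Z born[OF that]]] .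
    show "?q t (\<pi> t (?S' v)) = \<zero>\<^bsub>space ?H t\<^esub> \<longleftrightarrow> v \<in> coord (dead \<H> t)" if v: "v \<in> coord (born \<H> t)" for v t
      unfolding qzero[OF presents.closed[OF Z born[OF v]]]
      using SD[OF mvec_in_coord, of "bars \<Z>" "minv (bars \<Z>) S" v t] born[OF v]
      unfolding SS'[OF sub[OF v]] by blast
    show "transition ?H s t (?q s (\<pi> s (?S' v))) = ?q t (\<pi> t (?S' v))"
      if st: "s \<le> t" and v: "v \<in> coord (born \<H> s)" for s t v
      using pmod_hom_transition[OF H(2) st presents.closed[OF Z born[OF v]], symmetric]
      unfolding presents.transition[OF Z st born[OF v]] .
  qed
  show "induces \<Z> \<pi> \<H> \<eta> ?q S"
  proof (rule inducesI; unfold bars)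
    show "?S v \<in> coord (born \<H> t)" if "v \<in> coord (born \<Z> t)" for v t
      using SB[OF coord_subsetD[OF that born_subset]] that by blast
    show "?S v \<in> coord (dead \<H> t)" if v: "v \<in> coord (dead \<Z> t)" for v t
    proof -
      have b: "v \<in> coord (born \<Z> t)" using coord_subsetD[OF v presents.dead_born[OF Z]] .
      have "\<pi> t v = \<zero>\<^bsub>space Z t\<^esub>" using presents.zero_iff[OF Z b] v by blast
      then have "\<pi> t v \<in> N t" using submodule.zero_closed[OF N] by simp
      then show ?thesis using SD[OF coord_subsetD[OF b born_subset]] b by blast
    qed
    show "?q t (\<pi> t v) = \<eta> t (?S v)" if "v \<in> coord (born \<Z> t)" for v t
      unfolding \<eta>_def S'S[OF coord_subsetD[OF that born_subset]] ..
  qed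
qed

text \<open>A vector supported on dead bars of \<H> may come from one that is not supported on dead
  bars of \<Z>, so the filtration property of Y does not control its image. Instead such a vector
  presents zero in H, and the morphism \<psi> preserves zero.\<close>

lemma induces_from_quotient:
  assumes B: "presents B \<B> \<rho>" and H: "presents H \<H> \<eta>" and \<psi>: "pmod_hom H B \<psi>"
    and q: "induces \<Z> \<pi> \<H> \<eta> q S"
    and Y: "induces \<Z> \<pi> \<B> \<rho> (\<lambda>t x. \<psi> t (q t x)) Y"
    and fin: "finite (bars \<Z>)" and bars: "bars \<H> = bars \<Z>" and S: "minvertible (bars \<Z>) S"
    and SB: "\<And>t w. w \<in> coord (bars \<Z>) \<Longrightarrow>
      mvec (bars \<Z>) (bars \<Z>) S w \<in> coord (born \<H> t) \<longleftrightarrow> w \<in> coord (born \<Z> t)"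
  shows "induces \<H> \<eta> \<B> \<rho> \<psi> (mmul (bars \<Z>) Y (minv (bars \<Z>) S))"
proof -
  let ?S = "mvec (bars \<Z>) (bars \<Z>) S" and ?S' = "mvec (bars \<Z>) (bars \<Z>) (minv (bars \<Z>) S)"
  let ?Y = "mvec (bars \<B>) (bars \<Z>) Y"
  have SS': "?S (?S' w) = w" if "w \<in> coord (born \<H> t)" for w t
    using minverts_mvec(1)[OF fin minverts_minv[OF S]] coord_subsetD[OF that born_subset] bars by simp
  have born: "?S' w \<in> coord (born \<Z> t)" if "w \<in> coord (born \<H> t)" for w t
    using SB[OF mvec_in_coord, of "bars \<Z>" "minv (bars \<Z>) S" w t] SS'[OF that] that by simp
  have eq: "\<psi> t (\<eta> t w) = \<rho> t (?Y (?S' w))" if w: "w \<in> coord (born \<H> t)" for w t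
    using induces_eq[OF Y born[OF w]] unfolding induces_eq[OF q born[OF w]] bars SS'[OF w] .
  show ?thesis
  proof (rule inducesI; unfold mvec_mmul bars)
    show "?Y (?S' w) \<in> coord (born \<B> t)" if "w \<in> coord (born \<H> t)" for w t
      using induces_born[OF Y born[OF that]] .
    show "?Y (?S' w) \<in> coord (dead \<B> t)" if w: "w \<in> coord (dead \<H> t)" for w t
    proof -
      have b: "w \<in> coord (born \<H> t)" using coord_subsetD[OF w presents.dead_born[OF H]] .
      have "\<eta> t w = \<zero>\<^bsub>space H t\<^esub>" using presents.zero_iff[OF H b] w by blast
      then have "\<rho> t (?Y (?S' w)) = \<zero>\<^bsub>space B t\<^esub>"
        using eq[OF b] module_hom_zero[OF pmod_hom_module_hom[OF \<psi>] presents_vectorspace[OF H]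
            presents_vectorspace[OF B]] by simp
      then show ?thesis
        using presents.zero_iff[OF B induces_born[OF Y born[OF b]]] by blast
    qed
    show "\<psi> t (\<eta> t w) = \<rho> t (?Y (?S' w))" if "w \<in> coord (born \<H> t)" for w t
      using eq[OF that] .
  qed
qed

section \<open>The procedures\<close>

text \<open>Bars with equal birth are born by t together, so the set is a prefix however ties are
  broken.\<close>

lemma increasing_order_initial:
  assumes "increasing_order b J xs"
  shows "initial xs {j\<in>J. t \<in> upper (b j)}"
proof -
  have "i \<in> J \<and> t \<in> upper (b i)" if "precedes xs i k" "t \<in> upper (b k)" for i k
  proof -
    have "b i \<le> b k" using assms that(1) sorted_wrt_precedes unfolding increasing_order_def by metis
    then show ?thesis
      using that precedes_in_set[OF that(1)] assms
      by (auto simp: increasing_order_def less_eq_cut_def upper_eq)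
  qed
  then show ?thesis using assms unfolding initial_def increasing_order_def by blast
qed

text \<open>Deaths decrease along the list, so once a bar is dead at t all later ones are.\<close>

lemma decreasing_order_final:
  assumes "decreasing_order d J xs"
  shows "final xs {j\<in>J. t \<notin> lower (d j)}"
proof -
  have "k \<in> J \<and> t \<notin> lower (d k)" if "precedes xs i k" "t \<notin> lower (d i)" for i k
  proof -
    have "d k \<le> d i"
      using sorted_wrt_precedes[OF _ that(1), of "(\<ge>)" d] assms unfolding decreasing_order_def by blast
    then show ?thesis
      using that precedes_in_set[OF that(1)] assms
      by (auto simp: decreasing_order_def less_eq_cut_def)
  qed
  then show ?thesis using assms unfolding final_def decreasing_order_def by blast
qed

text \<open>Each t gives prefixes and suffixes of the same four orders, so the two statements on
  \<open>rereduced\<close> hold for one matrix T and all t simultaneously.\<close>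

lemma kernel_procedure_correct:
  assumes "kernel_procedure \<U> \<V> X \<K> T"
  shows "bars \<K> = bars \<U>" and "minvertible (bars \<U>) T"
    and "\<And>t. mvec (bars \<U>) (bars \<U>) T ` coord (born \<K> t) =
      {v \<in> coord (born \<U> t). mvec (bars \<V>) (bars \<U>) X v \<in> coord (dead \<V> t)}"
    and "\<And>t. mvec (bars \<U>) (bars \<U>) T ` coord (dead \<K> t) = coord (dead \<U> t)"
proof -
  obtain cs rs cs' rs' b where
    cs: "increasing_order (birth \<U>) (bars \<U>) cs" and rs: "decreasing_order (death \<V>) (bars \<V>) rs"
    and b: "b = (\<lambda>j. case pivot rs (\<lambda>i. column_reduction rs cs X i j) of None \<Rightarrow> birth \<U> j
      | Some p \<Rightarrow> if birth \<U> j < death \<V> p then death \<V> p else birth \<U> j)"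
    and cs': "increasing_order b (bars \<U>) cs'" and rs': "decreasing_order (death \<U>) (bars \<U>) rs'"
    and T: "T = rereduced rs cs X rs' cs'"
    and \<K>: "\<K> = \<lparr>bars = bars \<U>, birth = b, death = (\<lambda>j. death \<U> (the (pivot rs' (\<lambda>i. T i j))))\<rparr>"
    using assms unfolding kernel_procedure_def rereduced_def by blast
  have sets: "distinct cs" "distinct cs'" "set cs = bars \<U>" "set cs' = bars \<U>" "set rs = bars \<V>"
      "set rs' = bars \<U>"
    using cs cs' rs rs' by (auto simp: increasing_order_def decreasing_order_def)
  show "bars \<K> = bars \<U>" by (simp add: \<K>)
  show inv: "minvertible (bars \<U>) T"
    using rereduced_minvertible[OF sets(1,2), of rs X rs'] sets T by simp
  \<comment> \<open>Invertibility gives every column a pivot, so \<open>the\<close> is never applied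
    to \<open>None\<close>.\<close>
  have piv: "the (pivot rs' (\<lambda>i. T i j)) \<in> bars \<U>" if j: "j \<in> bars \<U>" for j
  proof -
    obtain p where p: "pivot rs' (\<lambda>i. T i j) = Some p"
      by (rule minvertible_pivot[of rs' T j]) (use inv j sets in simp_all)
    then show ?thesis using pivot_SomeD[OF p] sets by simp
  qed
  fix t
  have "born \<K> t = {j \<in> born \<U> t. \<forall>p. pivot rs (\<lambda>i. column_reduction rs cs X i j) = Some p \<longrightarrow> p \<in> dead \<V> t}"
  proof -
    have "j \<in> born \<K> t \<longleftrightarrow>
        j \<in> born \<U> t \<and> (\<forall>p. pivot rs (\<lambda>i. column_reduction rs cs X i j) = Some p \<longrightarrow> p \<in> dead \<V> t)" for j
    proof (cases "pivot rs (\<lambda>i. column_reduction rs cs X i j)")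
      case None
      then show ?thesis by (simp add: born_def \<K> b)
    next
      case (Some p)
      have "p \<in> bars \<V>" using pivot_SomeD[OF Some] sets by simp
      \<comment> \<open>The case distinction on nontrivial positions computes the maximum of birth
        and death of the pivot row. In a trivial position the pivot row is already dead when the
        column is born.\<close>
      moreover consider "birth \<U> j < death \<V> p" | "death \<V> p \<le> birth \<U> j" by fastforce
      then have "t \<in> upper (b j) \<longleftrightarrow> t \<in> upper (birth \<U> j) \<and> t \<notin> lower (death \<V> p)"
        using Some by cases (auto simp: b less_cut_def less_eq_cut_def upper_eq)
      ultimately show ?thesis
        using Some by (auto simp: born_def dead_def \<K>)
    qed
    then show ?thesis by blast
  qed
  moreover have "initial cs' (born \<K> t)"
    using increasing_order_initial[OF cs', of t] by (simp add: born_def \<K>)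
  moreover have "initial cs (born \<U> t)"
    using increasing_order_initial[OF cs, of t] by (simp add: born_def)
  moreover have "final rs (dead \<V> t)"
    using decreasing_order_final[OF rs, of t] by (simp add: dead_def)
  ultimately show "mvec (bars \<U>) (bars \<U>) T ` coord (born \<K> t) =
      {v \<in> coord (born \<U> t). mvec (bars \<V>) (bars \<U>) X v \<in> coord (dead \<V> t)}"
    using rereduced_kernel[of cs cs' "born \<U> t" rs "dead \<V> t" "born \<K> t" X rs'] sets T by simp
  have "dead \<K> t = {j \<in> set cs. the (pivot rs' (\<lambda>i. T i j)) \<in> dead \<U> t}"
    using piv sets by (auto simp: dead_def \<K>)
  moreover have "final rs' (dead \<U> t)"
    using decreasing_order_final[OF rs', of t] by (simp add: dead_def)
  ultimately show "mvec (bars \<U>) (bars \<U>) T ` coord (dead \<K> t) = coord (dead \<U> t)"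
    using rereduced_final[of cs cs' rs' "dead \<U> t" T rs X "dead \<K> t"] sets T by simp
qed

text \<open>The transposed situation: the rows not dead at t form a prefix, and the columns not born
  by t form a suffix, as the statements on \<open>rereduced\<close> require of columns and
  rows.\<close>

lemma cokernel_procedure_correct:
  assumes "cokernel_procedure \<U> \<V> X \<H> S"
  shows "bars \<H> = bars \<V>" and "minvertible (bars \<V>) S"
    and "\<And>t w. w \<in> coord (bars \<V>) \<Longrightarrow>
      mvec (bars \<V>) (bars \<V>) S w \<in> coord (born \<H> t) \<longleftrightarrow> w \<in> coord (born \<V> t)"
    and "\<And>t w. w \<in> coord (bars \<V>) \<Longrightarrow>
      mvec (bars \<V>) (bars \<V>) S w \<in> coord (dead \<H> t) \<longleftrightarrow>
      (\<exists>u\<in>coord (dead \<V> t). \<exists>e\<in>coord (born \<U> t). w = (\<lambda>i. u i + mvec (bars \<V>) (bars \<U>) X e i))"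
proof -
  obtain cs rs cs' rs' d where
    cs: "increasing_order (birth \<U>) (bars \<U>) cs" and rs: "decreasing_order (death \<V>) (bars \<V>) rs"
    and d: "d = (\<lambda>i. case pivot cs (\<lambda>j. row_reduction rs cs X i j) of None \<Rightarrow> death \<V> i
      | Some p \<Rightarrow> if birth \<U> p < death \<V> i then birth \<U> p else death \<V> i)"
    and rs': "decreasing_order d (bars \<V>) rs'" and cs': "increasing_order (birth \<V>) (bars \<V>) cs'"
    and S: "S = mtranspose (rereduced cs rs (mtranspose X) cs' rs')"
    and \<H>: "\<H> = \<lparr>bars = bars \<V>, birth = (\<lambda>i. birth \<V> (the (pivot cs' (\<lambda>j. S i j)))), death = d\<rparr>"
  proof -
    have eq: "row_reduction rs' cs' (row_multiplier rs cs X) =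
        mtranspose (rereduced cs rs (mtranspose X) cs' rs')" for rs' cs' rs cs
      by (simp add: row_reduction_def row_multiplier_def rereduced_def)
    show thesis
      using assms unfolding cokernel_procedure_def
      by (elim exE conjE) (rule that; (simp only: eq; fail)?; simp only:)
  qed
  have sets: "distinct rs" "distinct rs'" "set cs = bars \<U>" "set cs' = bars \<V>" "set rs = bars \<V>"
      "set rs' = bars \<V>"
    using cs cs' rs rs' by (auto simp: increasing_order_def decreasing_order_def)
  show "bars \<H> = bars \<V>" by (simp add: \<H>)
  have inv: "minvertible (bars \<V>) (mtranspose S)"
    using rereduced_minvertible[OF sets(1,2), of cs "mtranspose X" cs'] sets by (simp add: S)
  then show "minvertible (bars \<V>) S"
    using minverts_mtranspose[of "bars \<V>" "mtranspose S"] by (auto simp: minvertible_def)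
  have piv: "the (pivot cs' (\<lambda>j. S i j)) \<in> bars \<V>" if i: "i \<in> bars \<V>" for i
  proof -
    obtain p where p: "pivot cs' (\<lambda>j. mtranspose S j i) = Some p"
      by (rule minvertible_pivot[of cs' "mtranspose S" i]) (use inv i sets in simp_all)
    then show ?thesis using pivot_SomeD[OF p] sets by (simp add: mtranspose_def)
  qed
  fix t and w :: "'c \<Rightarrow> 'd" assume w: "w \<in> coord (bars \<V>)"
  have "born \<H> t = {i \<in> set rs. the (pivot cs' (\<lambda>j. S i j)) \<in> born \<V> t}"
    using piv sets by (auto simp: born_def \<H>)
  moreover have "initial cs' (born \<V> t)"
    using increasing_order_initial[OF cs', of t] by (simp add: born_def)
  ultimately show "mvec (bars \<V>) (bars \<V>) S w \<in> coord (born \<H> t) \<longleftrightarrow> w \<in> coord (born \<V> t)"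
    using corereduced_birth[of rs rs' cs' "born \<V> t" S cs "mtranspose X" "born \<H> t" w] sets S w by simp
  have "dead \<H> t = {i \<in> set rs. i \<in> dead \<V> t \<or>
      (\<exists>p\<in>born \<U> t. pivot cs (\<lambda>j. row_reduction rs cs X i j) = Some p)}"
  proof -
    have "i \<in> dead \<H> t \<longleftrightarrow> i \<in> bars \<V> \<and> (i \<in> dead \<V> t \<or>
        (\<exists>p\<in>born \<U> t. pivot cs (\<lambda>j. row_reduction rs cs X i j) = Some p))" for i
    proof (cases "pivot cs (\<lambda>j. row_reduction rs cs X i j)")
      case None
      then show ?thesis by (auto simp: dead_def \<H> d)
    next
      case (Some p)
      have "p \<in> bars \<U>" using pivot_SomeD[OF Some] sets by simp
      \<comment> \<open>The new death is the minimum of the old death and the birth of the pivot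
        column: over t the row is dead if it was dead before or if its pivot column has been
        born.\<close>
      moreover have "birth \<U> p < death \<V> i \<or> death \<V> i \<le> birth \<U> p" by auto
      ultimately show ?thesis
        using Some by (auto simp: born_def dead_def \<H> d less_cut_def less_eq_cut_def upper_eq)
    qed
    then show ?thesis using sets by blast
  qed
  moreover have "final rs' (dead \<H> t)"
    using decreasing_order_final[OF rs', of t] by (simp add: dead_def \<H>)
  moreover have "final rs (dead \<V> t)"
    using decreasing_order_final[OF rs, of t] by (simp add: dead_def)
  moreover have "initial cs (born \<U> t)"
    using increasing_order_initial[OF cs, of t] by (simp add: born_def)
  ultimately show "mvec (bars \<V>) (bars \<V>) S w \<in> coord (dead \<H> t) \<longleftrightarrow>
      (\<exists>u\<in>coord (dead \<V> t). \<exists>e\<in>coord (born \<U> t). w = (\<lambda>i. u i + mvec (bars \<V>) (bars \<U>) X e i))"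
    using corereduced_death[of rs rs' "dead \<V> t" cs "born \<U> t" "dead \<H> t" X S cs' w] sets S w by simp
qed


section \<open>Cycles and homology\<close>

lemma decomposed_complexD:
  assumes "decomposed_complex C \<delta> \<C> \<alpha> D"
  shows "interval_decomposition (C n) (\<C> n) (\<alpha> n)" and "pmod_hom (C n) (C (n - 1)) (\<delta> n)"
    and "induces (\<C> n) (proj (C n) (\<C> n) (\<alpha> n)) (\<C> (n - 1)) (proj (C (n - 1)) (\<C> (n - 1)) (\<alpha> (n - 1)))
      (\<delta> n) (D n)"
    and "x \<in> carrier (space (C (n + 1)) t) \<Longrightarrow> \<delta> n t (\<delta> (n + 1) t x) = \<zero>\<^bsub>space (C (n - 1)) t\<^esub>"
proof -
  show dec: "interval_decomposition (C n) (\<C> n) (\<alpha> n)" for n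
    using assms unfolding decomposed_complex_def by blast
  have "represents (C n) (\<C> n) (\<alpha> n) (C (n - 1)) (\<C> (n - 1)) (\<alpha> (n - 1)) (\<delta> n) (D n)"
    using assms unfolding decomposed_complex_def by blast
  then show "pmod_hom (C n) (C (n - 1)) (\<delta> n)"
    and "induces (\<C> n) (proj (C n) (\<C> n) (\<alpha> n)) (\<C> (n - 1)) (proj (C (n - 1)) (\<C> (n - 1)) (\<alpha> (n - 1)))
      (\<delta> n) (D n)"
    unfolding represents_iff[OF dec dec] by blast+
  show "x \<in> carrier (space (C (n + 1)) t) \<Longrightarrow> \<delta> n t (\<delta> (n + 1) t x) = \<zero>\<^bsub>space (C (n - 1)) t\<^esub>"
    using assms unfolding decomposed_complex_def chain_complex_def by blast
qed

section \<open>Morphisms into kernels, out of kernels and out of quotients\<close>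

lemma pmod_hom_into_kernel:
  assumes \<psi>: "pmod_hom C A \<psi>"
    and zero: "\<And>t x. x \<in> carrier (space C t) \<Longrightarrow> \<phi> t (\<psi> t x) = \<zero>\<^bsub>space B t\<^esub>"
  shows "pmod_hom C (pmod_kernel A B \<phi>) \<psi>"
  unfolding pmod_hom_def
proof (intro conjI allI impI ballI)
  show "\<psi> t \<in> LinearCombinations.module_hom class_ring (space C t) (space (pmod_kernel A B \<phi>) t)" for t
  proof -
    note hom = pmod_hom_module_hom[OF \<psi>, of t]
    show ?thesis
      by (rule module_homI; (unfold pmod_kernel_simps)?)
        (use zero module_hom_mem[OF hom] LinearCombinations.module_hom_add[OF hom] module_hom_scale[OF hom]
          in \<open>auto simp: pmod_kernel_carrier\<close>)
  qed
qed (use pmod_hom_transition[OF \<psi>] in \<open>simp add: pmod_kernel_simps\<close>)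

lemma pmod_hom_from_kernel:
  assumes \<psi>: "pmod_hom A C \<psi>"
  shows "pmod_hom (pmod_kernel A B \<phi>) C \<psi>"
  unfolding pmod_hom_def
proof (intro conjI allI impI ballI)
  show "\<psi> t \<in> LinearCombinations.module_hom class_ring (space (pmod_kernel A B \<phi>) t) (space C t)" for t
  proof -
    note hom = pmod_hom_module_hom[OF \<psi>, of t]
    show ?thesis
      by (rule module_homI; (unfold pmod_kernel_simps)?)
        (use module_hom_mem[OF hom] LinearCombinations.module_hom_add[OF hom] module_hom_scale[OF hom]
          in \<open>auto simp: pmod_kernel_carrier\<close>)
  qed
qed (use pmod_hom_transition[OF \<psi>] in \<open>simp add: pmod_kernel_simps pmod_kernel_carrier\<close>)

lemma pmod_hom_id: "pmod_hom A A (\<lambda>t x. x)"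
  unfolding pmod_hom_def by (auto intro: module_homI)

lemma pmod_hom_comp:
  assumes \<phi>: "pmod_hom A B \<phi>" and \<psi>: "pmod_hom B C \<psi>"
  shows "pmod_hom A C (\<lambda>t x. \<psi> t (\<phi> t x))"
  unfolding pmod_hom_def
proof (intro conjI allI impI ballI)
  fix t
  note f = pmod_hom_module_hom[OF \<phi>, of t] and g = pmod_hom_module_hom[OF \<psi>, of t]
  show "(\<lambda>x. \<psi> t (\<phi> t x)) \<in> LinearCombinations.module_hom class_ring (space A t) (space C t)"
    by (rule module_homI)
      (simp_all only: module_hom_mem[OF f] module_hom_mem[OF g] LinearCombinations.module_hom_add[OF f]
        LinearCombinations.module_hom_add[OF g] module_hom_scale[OF f] module_hom_scale[OF g])
next
  fix s t x assume "(s::'a) \<le> t" "x \<in> carrier (space A s)"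
  then show "\<psi> t (\<phi> t (transition A s t x)) = transition C s t (\<psi> s (\<phi> s x))"
    by (simp only: pmod_hom_transition[OF \<phi>] pmod_hom_transition[OF \<psi>]
        module_hom_mem[OF pmod_hom_module_hom[OF \<phi>]])
qed

text \<open>Since q is surjective, every law for \<psi> can be checked on representatives, where it
  is a law for g.\<close>

lemma pmod_hom_factor:
  assumes q: "pmod_hom Z H q" and surj: "\<And>t. q t ` carrier (space Z t) = carrier (space H t)"
    and Z: "persistence_module Z"
    and g: "pmod_hom Z B g"
    and eq: "\<And>t x. x \<in> carrier (space Z t) \<Longrightarrow> \<psi> t (q t x) = g t x"
  shows "pmod_hom H B \<psi>"
  unfolding pmod_hom_def
proof (intro conjI allI impI ballI)
  have car: "\<exists>u\<in>carrier (space Z t). x = q t u" if "x \<in> carrier (space H t)" for t x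
    using that surj by blast
  note qhom = pmod_hom_module_hom[OF q] and ghom = pmod_hom_module_hom[OF g]
  note V = persistence_module_vectorspace[OF Z]
  show "\<psi> t \<in> LinearCombinations.module_hom class_ring (space H t) (space B t)" for t
  proof (rule module_homI)
    show "\<psi> t x \<in> carrier (space B t)" if x: "x \<in> carrier (space H t)" for x
    proof -
      obtain u where u: "u \<in> carrier (space Z t)" "x = q t u" using car[OF x] by blast
      show ?thesis unfolding u(2) eq[OF u(1)] using module_hom_mem[OF ghom u(1)] .
    qed
    show "\<psi> t (x \<oplus>\<^bsub>space H t\<^esub> y) = \<psi> t x \<oplus>\<^bsub>space B t\<^esub> \<psi> t y"
      if xy: "x \<in> carrier (space H t)" "y \<in> carrier (space H t)" for x y
    proof -
      obtain u where u: "u \<in> carrier (space Z t)" "x = q t u" using car[OF xy(1)] by blast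
      obtain v where v: "v \<in> carrier (space Z t)" "y = q t v" using car[OF xy(2)] by blast
      have uv: "u \<oplus>\<^bsub>space Z t\<^esub> v \<in> carrier (space Z t)"
        using abelian_monoid.a_closed[OF abelian_group.axioms(1)[OF vectorspace_abelian_group[OF V]] u(1) v(1)] .
      show ?thesis
        unfolding u(2) v(2) LinearCombinations.module_hom_add[OF qhom u(1) v(1), symmetric]
          eq[OF uv] eq[OF u(1)] eq[OF v(1)]
        using LinearCombinations.module_hom_add[OF ghom u(1) v(1)] .
    qed
    show "\<psi> t (a \<odot>\<^bsub>space H t\<^esub> x) = a \<odot>\<^bsub>space B t\<^esub> \<psi> t x" if x: "x \<in> carrier (space H t)" for a x
    proof -
      obtain u where u: "u \<in> carrier (space Z t)" "x = q t u" using car[OF x] by blast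
      have au: "a \<odot>\<^bsub>space Z t\<^esub> u \<in> carrier (space Z t)"
        using module.smult_closed[OF vectorspace_module[OF V], of a, OF _ u(1)] by simp
      show ?thesis
        unfolding u(2) module_hom_scale[OF qhom u(1), symmetric] eq[OF au] eq[OF u(1)]
        using module_hom_scale[OF ghom u(1)] .
    qed
  qed
  show "\<psi> t (transition H s t x) = transition B s t (\<psi> s x)"
    if st: "s \<le> t" and x: "x \<in> carrier (space H s)" for s t x
  proof -
    obtain u where u: "u \<in> carrier (space Z s)" "x = q s u" using car[OF x] by blast
    show ?thesis
      unfolding u(2) pmod_hom_transition[OF q st u(1), symmetric] eq[OF u(1)]
        eq[OF module_hom_mem[OF persistence_module_transition_hom[OF Z st] u(1)]]
      using pmod_hom_transition[OF g st u(1)] .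
  qed
qed

section \<open>Cycles, boundaries and their decompositions\<close>

lemma boundary_hom:
  assumes "decomposed_complex C \<delta> \<C> \<alpha> D"
  shows "pmod_hom (C (n + 1)) (cycles C \<delta> n) (\<delta> (n + 1))"
  unfolding cycles_def
  using decomposed_complexD(2)[OF assms, of "n + 1"] decomposed_complexD(4)[OF assms]
  by (intro pmod_hom_into_kernel) simp_all

lemma cycles_persistence_module:
  assumes "decomposed_complex C \<delta> \<C> \<alpha> D"
  shows "persistence_module (cycles C \<delta> n)"
  unfolding cycles_def
  using decomposed_complexD(1)[OF assms] decomposed_complexD(2)[OF assms]
  by (intro pmod_kernel_persistence_module) (auto simp: interval_decomposition_def)

lemma boundaries_submodule:
  assumes C: "decomposed_complex C \<delta> \<C> \<alpha> D"
  shows "submodule class_ring (boundaries C \<delta> n t) (space (cycles C \<delta> n) t)"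
proof -
  have "persistence_module (C (n + 1))"
    using decomposed_complexD(1)[OF C] by (simp add: interval_decomposition_def)
  then interpret mod_hom class_ring "space (C (n + 1)) t" "space (cycles C \<delta> n) t" "\<delta> (n + 1) t"
    by (intro module_hom_mod_hom persistence_module_vectorspace cycles_persistence_module[OF C]
        pmod_hom_module_hom[OF boundary_hom[OF C]])
  show ?thesis
    using im_is_submodule by (simp add: im_def boundaries_def pmod_image_def)
qed

lemma boundaries_transition:
  assumes C: "decomposed_complex C \<delta> \<C> \<alpha> D" and st: "s \<le> t"
  shows "transition (cycles C \<delta> n) s t ` boundaries C \<delta> n s \<subseteq> boundaries C \<delta> n t"
proof
  fix y assume "y \<in> transition (cycles C \<delta> n) s t ` boundaries C \<delta> n s"
  then obtain x where x: "x \<in> carrier (space (C (n + 1)) s)"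
      "y = transition (cycles C \<delta> n) s t (\<delta> (n + 1) s x)"
    by (auto simp: boundaries_def pmod_image_def)
  have pm: "persistence_module (C (n + 1))"
    using decomposed_complexD(1)[OF C] by (simp add: interval_decomposition_def)
  have "y = \<delta> (n + 1) t (transition (C (n + 1)) s t x)"
    using pmod_hom_transition[OF boundary_hom[OF C] st x(1)] x(2) by simp
  then show "y \<in> boundaries C \<delta> n t"
    using module_hom_mem[OF persistence_module_transition_hom[OF pm st] x(1)]
    by (simp add: boundaries_def pmod_image_def)
qed

lemma cycles_decomposition_iff:
  assumes C: "decomposed_complex C \<delta> \<C> \<alpha> D"
  shows "cycles_decomposition C \<delta> \<C> \<alpha> n \<Z> T \<zeta> \<longleftrightarrow>
    interval_decomposition (cycles C \<delta> n) \<Z> \<zeta> \<and>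
    induces \<Z> (proj (cycles C \<delta> n) \<Z> \<zeta>) (\<C> n) (proj (C n) (\<C> n) (\<alpha> n)) (\<lambda>t x. x) T"
proof -
  have "pmod_hom (cycles C \<delta> n) (C n) (\<lambda>t x. x)"
    unfolding cycles_def by (rule pmod_hom_from_kernel[OF pmod_hom_id])
  then show ?thesis
    unfolding cycles_decomposition_def
    using represents_iff[OF _ decomposed_complexD(1)[OF C], of "cycles C \<delta> n" \<Z> \<zeta>] by blast
qed

lemma homology_decomposition_iff:
  assumes C: "decomposed_complex C \<delta> \<C> \<alpha> D" and \<zeta>: "interval_decomposition (cycles C \<delta> n) \<Z> \<zeta>"
  shows "homology_decomposition C \<delta> n \<Z> \<zeta> \<H> S \<eta> \<longleftrightarrow>
    interval_decomposition (homology C \<delta> n) \<H> \<eta> \<and>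
    induces \<Z> (proj (cycles C \<delta> n) \<Z> \<zeta>) \<H> (proj (homology C \<delta> n) \<H> \<eta>)
      (quotient_map (cycles C \<delta> n) (boundaries C \<delta> n)) S"
proof -
  have "pmod_hom (cycles C \<delta> n) (homology C \<delta> n) (quotient_map (cycles C \<delta> n) (boundaries C \<delta> n))"
    unfolding homology_def
    using pmod_quotient_persistence_module(2)[OF cycles_persistence_module[OF C] boundaries_submodule[OF C]
        boundaries_transition[OF C]] .
  then show ?thesis
    unfolding homology_decomposition_def
    using represents_iff[OF \<zeta>, of "homology C \<delta> n" \<H> \<eta>] by blast
qed

lemma boundary_map_induces:
  assumes C: "decomposed_complex C \<delta> \<C> \<alpha> D"
    and ker: "kernel_procedure (\<C> n) (\<C> (n - 1)) (D n) \<Z> T"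
    and \<zeta>: "cycles_decomposition C \<delta> \<C> \<alpha> n \<Z> T \<zeta>"
  shows "induces (\<C> (n + 1)) (proj (C (n + 1)) (\<C> (n + 1)) (\<alpha> (n + 1))) \<Z> (proj (cycles C \<delta> n) \<Z> \<zeta>)
    (\<delta> (n + 1)) (mmul (bars (\<C> n)) (minv (bars (\<C> n)) T) (D (n + 1)))"
proof (rule induces_into_kernel)
  note P = interval_decomposition_presents[OF decomposed_complexD(1)[OF C]]
  show "presents (C (n - 1)) (\<C> (n - 1)) (proj (C (n - 1)) (\<C> (n - 1)) (\<alpha> (n - 1)))" by (rule P)
  show "induces (\<C> n) (proj (C n) (\<C> n) (\<alpha> n)) (\<C> (n - 1)) (proj (C (n - 1)) (\<C> (n - 1)) (\<alpha> (n - 1)))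
      (\<delta> n) (D n)" by (rule decomposed_complexD(3)[OF C])
  show "induces (\<C> (n + 1)) (proj (C (n + 1)) (\<C> (n + 1)) (\<alpha> (n + 1))) (\<C> n) (proj (C n) (\<C> n) (\<alpha> n))
      (\<delta> (n + 1)) (D (n + 1))"
    using decomposed_complexD(3)[OF C, of "n + 1"] by simp
  show "\<delta> n t (\<delta> (n + 1) t x) = \<zero>\<^bsub>space (C (n - 1)) t\<^esub>"
    if "x \<in> proj (C (n + 1)) (\<C> (n + 1)) (\<alpha> (n + 1)) t ` coord (born (\<C> (n + 1)) t)" for t x
    using that presents.closed[OF P] decomposed_complexD(4)[OF C] by blast
  show "finite (bars (\<C> n))" by (rule presents.finite_bars[OF P])
  show "induces \<Z> (proj (cycles C \<delta> n) \<Z> \<zeta>) (\<C> n) (proj (C n) (\<C> n) (\<alpha> n)) (\<lambda>t x. x) T"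
    using \<zeta> cycles_decomposition_iff[OF C] by blast
qed (fact kernel_procedure_correct[OF ker])+

text \<open>The procedure returns only a barcode and a matrix. The isomorphism \<zeta> is recovered
  from the presentation of the kernel, for which T represents the inclusion by construction.\<close>

lemma cycles_decomposition_exists:
  assumes C: "decomposed_complex C \<delta> \<C> \<alpha> D"
    and ker: "kernel_procedure (\<C> n) (\<C> (n - 1)) (D n) \<Z> T"
  obtains \<zeta> where "cycles_decomposition C \<delta> \<C> \<alpha> n \<Z> T \<zeta>"
proof -
  note P = interval_decomposition_presents[OF decomposed_complexD(1)[OF C]]
  note K = kernel_presents[OF P P decomposed_complexD(2)[OF C] decomposed_complexD(3)[OF C]
      kernel_procedure_correct[OF ker], folded cycles_def]
  obtain \<zeta> where \<zeta>: "interval_decomposition (cycles C \<delta> n) \<Z> \<zeta>"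
    "\<And>t v. v \<in> coord (born \<Z> t) \<Longrightarrow> proj (cycles C \<delta> n) \<Z> \<zeta> t v =
      proj (C n) (\<C> n) (\<alpha> n) t (mvec (bars (\<C> n)) (bars (\<C> n)) T v)"
    using presents_interval_decomposition[OF K(1)] by metis
  have "induces \<Z> (proj (cycles C \<delta> n) \<Z> \<zeta>) (\<C> n) (proj (C n) (\<C> n) (\<alpha> n)) (\<lambda>t x. x) T"
    by (rule induces_cong_proj[OF K(2) \<zeta>(2) refl])
  then show ?thesis
    using that \<zeta>(1) cycles_decomposition_iff[OF C] by blast
qed

lemma homology_decomposition_exists:
  assumes C: "decomposed_complex C \<delta> \<C> \<alpha> D"
    and \<zeta>: "interval_decomposition (cycles C \<delta> n) \<Z> \<zeta>"
    and M: "induces (\<C> (n + 1)) (proj (C (n + 1)) (\<C> (n + 1)) (\<alpha> (n + 1))) \<Z> (proj (cycles C \<delta> n) \<Z> \<zeta>)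
      (\<delta> (n + 1)) M"
    and coker: "cokernel_procedure (\<C> (n + 1)) \<Z> M \<H> S"
  obtains \<eta> where "homology_decomposition C \<delta> n \<Z> \<zeta> \<H> S \<eta>"
proof -
  let ?\<pi> = "proj (cycles C \<delta> n) \<Z> \<zeta>" and ?\<sigma> = "proj (C (n + 1)) (\<C> (n + 1)) (\<alpha> (n + 1))"
  let ?M = "mvec (bars \<Z>) (bars (\<C> (n + 1))) M"
  note Z = interval_decomposition_presents[OF \<zeta>]
  note P = interval_decomposition_presents[OF decomposed_complexD(1)[OF C, of "n + 1"]]
  note S = cokernel_procedure_correct[OF coker]
  \<comment> \<open>The sum produced by the cokernel procedure is read in the cycles: dead vectors
    present zero, and M induces the boundary map, so these are exactly the vectors presenting
    boundaries.\<close>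
  have SD: "mvec (bars \<Z>) (bars \<Z>) S w \<in> coord (dead \<H> t) \<longleftrightarrow>
      w \<in> coord (born \<Z> t) \<and> ?\<pi> t w \<in> boundaries C \<delta> n t" if w: "w \<in> coord (bars \<Z>)" for t w
    unfolding S(4)[OF w]
  proof
    assume "\<exists>u\<in>coord (dead \<Z> t). \<exists>e\<in>coord (born (\<C> (n + 1)) t). w = (\<lambda>i. u i + ?M e i)"
    then obtain u e where u: "u \<in> coord (dead \<Z> t)" and e: "e \<in> coord (born (\<C> (n + 1)) t)"
      and w: "w = (\<lambda>i. u i + ?M e i)" by blast
    have b: "w \<in> coord (born \<Z> t)"
      unfolding w using coord_subsetD[OF u presents.dead_born[OF Z]] induces_born[OF M e] by (rule coord_add)
    moreover have "?\<pi> t w = ?\<pi> t (?M e)"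
      using presents_eq_iff[OF Z b induces_born[OF M e]] u by (simp add: w)
    moreover have "?\<pi> t (?M e) \<in> boundaries C \<delta> n t"
      unfolding induces_eq[OF M e, symmetric] boundaries_def pmod_image_def
      using presents.closed[OF P e] by blast
    ultimately show "w \<in> coord (born \<Z> t) \<and> ?\<pi> t w \<in> boundaries C \<delta> n t" by simp
  next
    assume w: "w \<in> coord (born \<Z> t) \<and> ?\<pi> t w \<in> boundaries C \<delta> n t"
    then obtain x where x: "x \<in> carrier (space (C (n + 1)) t)" "?\<pi> t w = \<delta> (n + 1) t x"
      unfolding boundaries_def pmod_image_def by blast
    obtain e where e: "e \<in> coord (born (\<C> (n + 1)) t)" "x = ?\<sigma> t e"
      using x(1) by (rule presents_surj[OF P])
    have "?\<pi> t w = ?\<pi> t (?M e)"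
      unfolding x(2) e(2) using induces_eq[OF M e(1)] .
    then have "(\<lambda>i. w i - ?M e i) \<in> coord (dead \<Z> t)"
      using presents_eq_iff[OF Z _ induces_born[OF M e(1)]] w by blast
    then show "\<exists>u\<in>coord (dead \<Z> t). \<exists>e\<in>coord (born (\<C> (n + 1)) t). w = (\<lambda>i. u i + ?M e i)"
      using e(1) by (intro bexI[of _ e] bexI[of _ "\<lambda>i. w i - ?M e i"]) simp_all
  qed
  note H = quotient_presents[OF Z boundaries_submodule[OF C] boundaries_transition[OF C] S(1,2,3) SD,
      folded homology_def]
  obtain \<eta> where \<eta>: "interval_decomposition (homology C \<delta> n) \<H> \<eta>"
    "\<And>t v. v \<in> coord (born \<H> t) \<Longrightarrow> proj (homology C \<delta> n) \<H> \<eta> t v =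
      quotient_map (cycles C \<delta> n) (boundaries C \<delta> n) t (?\<pi> t (mvec (bars \<Z>) (bars \<Z>) (minv (bars \<Z>) S) v))"
    using presents_interval_decomposition[OF H(1)] by metis
  have "induces \<Z> ?\<pi> \<H> (proj (homology C \<delta> n) \<H> \<eta>) (quotient_map (cycles C \<delta> n) (boundaries C \<delta> n)) S"
    by (rule induces_cong_proj[OF H(2) refl \<eta>(2)])
  then show ?thesis
    using that \<eta>(1) homology_decomposition_iff[OF C \<zeta>] by blast
qed

section \<open>Maps induced by a chain map\<close>

lemma cycles_map_induces:
  assumes C: "decomposed_complex C \<delta> \<C> \<alpha> D" and C': "decomposed_complex C' \<delta>' \<C>' \<alpha>' D'"
    and ker': "kernel_procedure (\<C>' n) (\<C>' (n - 1)) (D' n) \<Z>' T'"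
    and f: "chain_map C \<delta> C' \<delta>' f"
    and X: "represents (C n) (\<C> n) (\<alpha> n) (C' n) (\<C>' n) (\<alpha>' n) (f n) X"
    and \<zeta>: "cycles_decomposition C \<delta> \<C> \<alpha> n \<Z> T \<zeta>"
    and \<zeta>': "cycles_decomposition C' \<delta>' \<C>' \<alpha>' n \<Z>' T' \<zeta>'"
  shows "pmod_hom (cycles C \<delta> n) (cycles C' \<delta>' n) (f n)"
    and "induces \<Z> (proj (cycles C \<delta> n) \<Z> \<zeta>) \<Z>' (proj (cycles C' \<delta>' n) \<Z>' \<zeta>') (f n)
      (mmul (bars (\<C>' n)) (minv (bars (\<C>' n)) T') (mmul (bars (\<C> n)) X T))"
proof -
  note Z = interval_decomposition_presents[OF conjunct1[OF \<zeta>[unfolded cycles_decomposition_iff[OF C]]]]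
  note P' = interval_decomposition_presents[OF decomposed_complexD(1)[OF C']]
  have hom: "pmod_hom (C m) (C' m) (f m)" for m
    using f unfolding chain_map_def by blast
  have zero: "\<delta>' n t (f n t x) = \<zero>\<^bsub>space (C' (n - 1)) t\<^esub>" if "x \<in> carrier (space (cycles C \<delta> n) t)" for t x
  proof -
    have x: "x \<in> carrier (space (C n) t)" "\<delta> n t x = \<zero>\<^bsub>space (C (n - 1)) t\<^esub>"
      using that by (simp_all add: cycles_def pmod_kernel_carrier)
    have "\<delta>' n t (f n t x) = f (n - 1) t (\<delta> n t x)"
      using f x(1) unfolding chain_map_def by blast
    also have "\<dots> = \<zero>\<^bsub>space (C' (n - 1)) t\<^esub>"
      unfolding x(2)
      using pmod_hom_module_hom[OF hom]
        presents_vectorspace[OF interval_decomposition_presents[OF decomposed_complexD(1)[OF C]]]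
        presents_vectorspace[OF P'] by (rule module_hom_zero)
    finally show ?thesis .
  qed
  show "pmod_hom (cycles C \<delta> n) (cycles C' \<delta>' n) (f n)"
    unfolding cycles_def[of C']
    using zero by (intro pmod_hom_into_kernel) (simp_all add: cycles_def pmod_hom_from_kernel[OF hom])
  \<comment> \<open>The inclusion of cycles followed by the chain map. The boundary of C'
    annihilates this composite, so it factors through the cycles of C'.\<close>
  have "induces \<Z> (proj (cycles C \<delta> n) \<Z> \<zeta>) (\<C>' n) (proj (C' n) (\<C>' n) (\<alpha>' n)) (f n)
      (mmul (bars (\<C> n)) X T)"
    using induces_comp[of \<Z> _ "\<C> n" _ "\<lambda>t x. x" T] \<zeta> X
    unfolding cycles_decomposition_iff[OF C]
      represents_iff[OF decomposed_complexD(1)[OF C] decomposed_complexD(1)[OF C']] by blast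
  then show "induces \<Z> (proj (cycles C \<delta> n) \<Z> \<zeta>) \<Z>' (proj (cycles C' \<delta>' n) \<Z>' \<zeta>') (f n)
      (mmul (bars (\<C>' n)) (minv (bars (\<C>' n)) T') (mmul (bars (\<C> n)) X T))"
  proof (rule induces_into_kernel[OF P' decomposed_complexD(3)[OF C'] _ _ presents.finite_bars[OF P']
        kernel_procedure_correct[OF ker']])
    show "\<delta>' n t (f n t x) = \<zero>\<^bsub>space (C' (n - 1)) t\<^esub>"
      if "x \<in> proj (cycles C \<delta> n) \<Z> \<zeta> t ` coord (born \<Z> t)" for t x
      using that presents.closed[OF Z] zero by blast
    show "induces \<Z>' (proj (cycles C' \<delta>' n) \<Z>' \<zeta>') (\<C>' n) (proj (C' n) (\<C>' n) (\<alpha>' n)) (\<lambda>t x. x) T'"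
      using \<zeta>' cycles_decomposition_iff[OF C'] by blast
  qed
qed

lemma homology_map_quotient_map:
  assumes C: "decomposed_complex C \<delta> \<C> \<alpha> D" and C': "decomposed_complex C' \<delta>' \<C>' \<alpha>' D'"
    and f: "chain_map C \<delta> C' \<delta>' f" and hom: "pmod_hom (cycles C \<delta> n) (cycles C' \<delta>' n) (f n)"
    and x: "x \<in> carrier (space (cycles C \<delta> n) t)"
  shows "homology_map C' \<delta>' n (f n) t (quotient_map (cycles C \<delta> n) (boundaries C \<delta> n) t x) =
    quotient_map (cycles C' \<delta>' n) (boundaries C' \<delta>' n) t (f n t x)"
  unfolding homology_map_def quotient_map_def
proof (rule coset_map_coset[OF _ boundaries_submodule[OF C] _ boundaries_submodule[OF C'] _ _ _ x])
  show "vectorspace class_ring (space (cycles C \<delta> n) t)"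
    by (rule persistence_module_vectorspace[OF cycles_persistence_module[OF C]])
  show "vectorspace class_ring (space (cycles C' \<delta>' n) t)"
    by (rule persistence_module_vectorspace[OF cycles_persistence_module[OF C']])
  \<comment> \<open>The square of the chain map in degree n + 1 sends boundaries to
    boundaries.\<close>
  show "f n t ` boundaries C \<delta> n t \<subseteq> boundaries C' \<delta>' n t"
  proof
    fix y assume "y \<in> f n t ` boundaries C \<delta> n t"
    then obtain z where z: "z \<in> carrier (space (C (n + 1)) t)" "y = f n t (\<delta> (n + 1) t z)"
      by (auto simp: boundaries_def pmod_image_def)
    have hom': "pmod_hom (C (n + 1)) (C' (n + 1)) (f (n + 1))"
      and comm: "\<delta>' (n + 1) t (f (n + 1) t z) = f (n + 1 - 1) t (\<delta> (n + 1) t z)"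
      using f z(1) unfolding chain_map_def by blast+
    then have "y = \<delta>' (n + 1) t (f (n + 1) t z)" using z(2) by simp
    then show "y \<in> boundaries C' \<delta>' n t"
      using module_hom_mem[OF pmod_hom_module_hom[OF hom'] z(1)] by (simp add: boundaries_def pmod_image_def)
  qed
qed (use module_hom_mem[OF pmod_hom_module_hom[OF hom]]
    LinearCombinations.module_hom_add[OF pmod_hom_module_hom[OF hom]] in auto)

text \<open>The map on homology composed with the quotient map of C equals the quotient map of C'
  composed with the map on cycles. The latter composite is represented by the product of S' with the
  matrix on cycles, and descending along the first quotient map multiplies it on the right by the
  inverse of S.\<close>

lemma homology_map_represents:
  assumes C: "decomposed_complex C \<delta> \<C> \<alpha> D" and C': "decomposed_complex C' \<delta>' \<C>' \<alpha>' D'"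
    and ker: "kernel_procedure (\<C> n) (\<C> (n - 1)) (D n) \<Z> T"
    and ker': "kernel_procedure (\<C>' n) (\<C>' (n - 1)) (D' n) \<Z>' T'"
    and coker: "cokernel_procedure (\<C> (n + 1)) \<Z> M \<H> S"
    and f: "chain_map C \<delta> C' \<delta>' f"
    and X: "represents (C n) (\<C> n) (\<alpha> n) (C' n) (\<C>' n) (\<alpha>' n) (f n) X"
    and \<zeta>: "cycles_decomposition C \<delta> \<C> \<alpha> n \<Z> T \<zeta>"
    and \<zeta>': "cycles_decomposition C' \<delta>' \<C>' \<alpha>' n \<Z>' T' \<zeta>'"
    and \<eta>: "homology_decomposition C \<delta> n \<Z> \<zeta> \<H> S \<eta>"
    and \<eta>': "homology_decomposition C' \<delta>' n \<Z>' \<zeta>' \<H>' S' \<eta>'"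
  shows "represents (cycles C \<delta> n) \<Z> \<zeta> (cycles C' \<delta>' n) \<Z>' \<zeta>' (f n)
      (mmul (bars (\<C>' n)) (minv (bars (\<C>' n)) T') (mmul (bars (\<C> n)) X T))"
    and "represents (homology C \<delta> n) \<H> \<eta> (homology C' \<delta>' n) \<H>' \<eta>' (homology_map C' \<delta>' n (f n))
      (mmul (bars (\<C>' n)) S' (mmul (bars (\<C>' n)) (minv (bars (\<C>' n)) T')
        (mmul (bars (\<C> n)) X (mmul (bars (\<C> n)) T (minv (bars (\<C> n)) S)))))"
proof -
  let ?W = "mmul (bars (\<C>' n)) (minv (bars (\<C>' n)) T') (mmul (bars (\<C> n)) X T)"
  let ?q = "quotient_map (cycles C \<delta> n) (boundaries C \<delta> n)"
    and ?q' = "quotient_map (cycles C' \<delta>' n) (boundaries C' \<delta>' n)"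
    and ?h = "homology_map C' \<delta>' n (f n)"
  note W = cycles_map_induces[OF C C' ker' f X \<zeta> \<zeta>']
  have dZ: "interval_decomposition (cycles C \<delta> n) \<Z> \<zeta>" and dZ': "interval_decomposition (cycles C' \<delta>' n) \<Z>' \<zeta>'"
    using \<zeta> \<zeta>' by (auto simp: cycles_decomposition_def)
  show "represents (cycles C \<delta> n) \<Z> \<zeta> (cycles C' \<delta>' n) \<Z>' \<zeta>' (f n) ?W"
    using W represents_iff[OF dZ dZ'] by blast
  have dH: "interval_decomposition (homology C \<delta> n) \<H> \<eta>" and dH': "interval_decomposition (homology C' \<delta>' n) \<H>' \<eta>'"
    using \<eta> \<eta>' by (auto simp: homology_decomposition_def)
  have iq: "induces \<Z> (proj (cycles C \<delta> n) \<Z> \<zeta>) \<H> (proj (homology C \<delta> n) \<H> \<eta>) ?q S"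
    using \<eta> homology_decomposition_iff[OF C dZ] by blast
  have iq': "induces \<Z>' (proj (cycles C' \<delta>' n) \<Z>' \<zeta>') \<H>' (proj (homology C' \<delta>' n) \<H>' \<eta>') ?q' S'"
    using \<eta>' homology_decomposition_iff[OF C' dZ'] by blast
  note q = pmod_quotient_persistence_module(2)[OF cycles_persistence_module[OF C] boundaries_submodule[OF C]
      boundaries_transition[OF C], folded homology_def]
  note q' = pmod_quotient_persistence_module(2)[OF cycles_persistence_module[OF C'] boundaries_submodule[OF C']
      boundaries_transition[OF C'], folded homology_def]
  note Z = interval_decomposition_presents[OF dZ]
  note hq = homology_map_quotient_map[OF C C' f W(1)]
  have surj: "?q t ` carrier (space (cycles C \<delta> n) t) = carrier (space (homology C \<delta> n) t)" for t
  proof -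
    have "?q t ` carrier (space (cycles C \<delta> n) t) =
        carrier (quotient_space (space (cycles C \<delta> n) t) (boundaries C \<delta> n t))"
      unfolding quotient_map_def
      by (rule quotient_space(1)[OF persistence_module_vectorspace[OF cycles_persistence_module[OF C]]
          boundaries_submodule[OF C]])
    then show ?thesis by (simp add: homology_def pmod_quotient_def)
  qed
  have hom: "pmod_hom (homology C \<delta> n) (homology C' \<delta>' n) ?h"
    by (rule pmod_hom_factor[OF q surj cycles_persistence_module[OF C] pmod_hom_comp[OF W(1) q'] hq])
  have bZ: "bars \<Z> = bars (\<C> n)" and bZ': "bars \<Z>' = bars (\<C>' n)"
    using kernel_procedure_correct(1)[OF ker] kernel_procedure_correct(1)[OF ker'] .
  note S = cokernel_procedure_correct[OF coker]
  have "induces \<Z> (proj (cycles C \<delta> n) \<Z> \<zeta>) \<H>' (proj (homology C' \<delta>' n) \<H>' \<eta>')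
      (\<lambda>t x. ?q' t (f n t x)) (mmul (bars \<Z>') S' ?W)"
    using induces_comp[OF W(2) iq'] .
  then have "induces \<Z> (proj (cycles C \<delta> n) \<Z> \<zeta>) \<H>' (proj (homology C' \<delta>' n) \<H>' \<eta>')
      (\<lambda>t x. ?h t (?q t x)) (mmul (bars \<Z>') S' ?W)"
    unfolding induces_def using hq presents.closed[OF Z] by simp
  then have "induces \<H> (proj (homology C \<delta> n) \<H> \<eta>) \<H>' (proj (homology C' \<delta>' n) \<H>' \<eta>') ?h
      (mmul (bars \<Z>) (mmul (bars \<Z>') S' ?W) (minv (bars \<Z>) S))"
    by (rule induces_from_quotient[OF interval_decomposition_presents[OF dH']
          interval_decomposition_presents[OF dH] hom iq _ presents.finite_bars[OF Z] S(1,2,3)])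
  then show "represents (homology C \<delta> n) \<H> \<eta> (homology C' \<delta>' n) \<H>' \<eta>' ?h
      (mmul (bars (\<C>' n)) S' (mmul (bars (\<C>' n)) (minv (bars (\<C>' n)) T')
        (mmul (bars (\<C> n)) X (mmul (bars (\<C> n)) T (minv (bars (\<C> n)) S)))))"
    \<comment> \<open>Both products are brought to the same bracketing by associativity.\<close>
    unfolding represents_iff[OF dH dH'] bZ bZ' mmul_assoc using hom by blast
qed

text \<open>The second half ranges over all decompositions in which the given matrices represent the
  inclusions and the quotient maps. It is not vacuous: the first half, applied to each complex,
  provides such decompositions.\<close>

theorem mainTheorem10:
  fixes C :: "int \<Rightarrow> ('r::linorder, 'f::field, 'v) pmod"
    and \<delta> :: "int \<Rightarrow> 'r \<Rightarrow> 'v \<Rightarrow> 'v"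
    and \<C> :: "int \<Rightarrow> ('r, 'j) barcode"
    and \<alpha> :: "int \<Rightarrow> 'r \<Rightarrow> 'v \<Rightarrow> 'j \<Rightarrow> 'f"
    and D :: "int \<Rightarrow> 'j \<Rightarrow> 'j \<Rightarrow> 'f"
    and \<Z> \<H> :: "('r, 'j) barcode"
    and T S M :: "'j \<Rightarrow> 'j \<Rightarrow> 'f"
    and C' :: "int \<Rightarrow> ('r, 'f, 'w) pmod"
    and \<delta>' :: "int \<Rightarrow> 'r \<Rightarrow> 'w \<Rightarrow> 'w"
    and \<C>' :: "int \<Rightarrow> ('r, 'k) barcode"
    and \<alpha>' :: "int \<Rightarrow> 'r \<Rightarrow> 'w \<Rightarrow> 'k \<Rightarrow> 'f"
    and D' :: "int \<Rightarrow> 'k \<Rightarrow> 'k \<Rightarrow> 'f"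
    and \<Z>' \<H>' :: "('r, 'k) barcode"
    and T' S' M' :: "'k \<Rightarrow> 'k \<Rightarrow> 'f"
    and f :: "int \<Rightarrow> 'r \<Rightarrow> 'v \<Rightarrow> 'w"
    and X :: "int \<Rightarrow> 'k \<Rightarrow> 'j \<Rightarrow> 'f"
    and n :: int
  assumes complex: "decomposed_complex C \<delta> \<C> \<alpha> D"
    and ker: "kernel_procedure (\<C> n) (\<C> (n - 1)) (D n) \<Z> T"
    and M: "M = mmul (bars (\<C> n)) (minv (bars (\<C> n)) T) (D (n + 1))"
    and coker: "cokernel_procedure (\<C> (n + 1)) \<Z> M \<H> S"
  shows
    "(\<exists>\<zeta> \<eta>.
        cycles_decomposition C \<delta> \<C> \<alpha> n \<Z> T \<zeta> \<and> minvertible (bars (\<C> n)) T \<and>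
        represents (C (n + 1)) (\<C> (n + 1)) (\<alpha> (n + 1)) (cycles C \<delta> n) \<Z> \<zeta> (\<delta> (n + 1)) M \<and>
        homology_decomposition C \<delta> n \<Z> \<zeta> \<H> S \<eta> \<and> minvertible (bars (\<C> n)) S) \<and>
     (decomposed_complex C' \<delta>' \<C>' \<alpha>' D' \<and>
      kernel_procedure (\<C>' n) (\<C>' (n - 1)) (D' n) \<Z>' T' \<and>
      M' = mmul (bars (\<C>' n)) (minv (bars (\<C>' n)) T') (D' (n + 1)) \<and>
      cokernel_procedure (\<C>' (n + 1)) \<Z>' M' \<H>' S' \<and>
      chain_map C \<delta> C' \<delta>' f \<and>
      (\<forall>m. represents (C m) (\<C> m) (\<alpha> m) (C' m) (\<C>' m) (\<alpha>' m) (f m) (X m)) \<longrightarrow>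
      (\<forall>\<zeta> \<eta> \<zeta>' \<eta>'.
        cycles_decomposition C \<delta> \<C> \<alpha> n \<Z> T \<zeta> \<and>
        homology_decomposition C \<delta> n \<Z> \<zeta> \<H> S \<eta> \<and>
        cycles_decomposition C' \<delta>' \<C>' \<alpha>' n \<Z>' T' \<zeta>' \<and>
        homology_decomposition C' \<delta>' n \<Z>' \<zeta>' \<H>' S' \<eta>' \<longrightarrow>
        represents (cycles C \<delta> n) \<Z> \<zeta> (cycles C' \<delta>' n) \<Z>' \<zeta>' (f n)
          (mmul (bars (\<C>' n)) (minv (bars (\<C>' n)) T') (mmul (bars (\<C> n)) (X n) T)) \<and>
        represents (homology C \<delta> n) \<H> \<eta> (homology C' \<delta>' n) \<H>' \<eta>'
          (homology_map C' \<delta>' n (f n))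
          (mmul (bars (\<C>' n)) S'
            (mmul (bars (\<C>' n)) (minv (bars (\<C>' n)) T')
              (mmul (bars (\<C> n)) (X n)
                (mmul (bars (\<C> n)) T (minv (bars (\<C> n)) S)))))))"
proof (intro conjI impI)
  note T = kernel_procedure_correct[OF ker]
  obtain \<zeta> where \<zeta>: "cycles_decomposition C \<delta> \<C> \<alpha> n \<Z> T \<zeta>"
    using cycles_decomposition_exists[OF complex ker] .
  then have dZ: "interval_decomposition (cycles C \<delta> n) \<Z> \<zeta>"
    by (simp add: cycles_decomposition_def)
  note iM = boundary_map_induces[OF complex ker \<zeta>, folded M]
  obtain \<eta> where \<eta>: "homology_decomposition C \<delta> n \<Z> \<zeta> \<H> S \<eta>"
    using homology_decomposition_exists[OF complex dZ iM coker] .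
  have "represents (C (n + 1)) (\<C> (n + 1)) (\<alpha> (n + 1)) (cycles C \<delta> n) \<Z> \<zeta> (\<delta> (n + 1)) M"
    using represents_iff[OF decomposed_complexD(1)[OF complex] dZ] boundary_hom[OF complex] iM by blast
  moreover have "minvertible (bars (\<C> n)) S"
    using cokernel_procedure_correct(2)[OF coker] T(1) by simp
  ultimately show "\<exists>\<zeta> \<eta>.
      cycles_decomposition C \<delta> \<C> \<alpha> n \<Z> T \<zeta> \<and> minvertible (bars (\<C> n)) T \<and>
      represents (C (n + 1)) (\<C> (n + 1)) (\<alpha> (n + 1)) (cycles C \<delta> n) \<Z> \<zeta> (\<delta> (n + 1)) M \<and>
      homology_decomposition C \<delta> n \<Z> \<zeta> \<H> S \<eta> \<and> minvertible (bars (\<C> n)) S"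
    using \<zeta> \<eta> T(2) by blast
next
  assume H: "decomposed_complex C' \<delta>' \<C>' \<alpha>' D' \<and>
      kernel_procedure (\<C>' n) (\<C>' (n - 1)) (D' n) \<Z>' T' \<and>
      M' = mmul (bars (\<C>' n)) (minv (bars (\<C>' n)) T') (D' (n + 1)) \<and>
      cokernel_procedure (\<C>' (n + 1)) \<Z>' M' \<H>' S' \<and>
      chain_map C \<delta> C' \<delta>' f \<and>
      (\<forall>m. represents (C m) (\<C> m) (\<alpha> m) (C' m) (\<C>' m) (\<alpha>' m) (f m) (X m))"
  then have complex': "decomposed_complex C' \<delta>' \<C>' \<alpha>' D'"
    and ker': "kernel_procedure (\<C>' n) (\<C>' (n - 1)) (D' n) \<Z>' T'"
    and f: "chain_map C \<delta> C' \<delta>' f"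
    and X: "represents (C n) (\<C> n) (\<alpha> n) (C' n) (\<C>' n) (\<alpha>' n) (f n) (X n)"
    by blast+
  note result = homology_map_represents[OF complex complex' ker ker' coker f X]
  show "\<forall>\<zeta> \<eta> \<zeta>' \<eta>'.
      cycles_decomposition C \<delta> \<C> \<alpha> n \<Z> T \<zeta> \<and>
      homology_decomposition C \<delta> n \<Z> \<zeta> \<H> S \<eta> \<and>
      cycles_decomposition C' \<delta>' \<C>' \<alpha>' n \<Z>' T' \<zeta>' \<and>
      homology_decomposition C' \<delta>' n \<Z>' \<zeta>' \<H>' S' \<eta>' \<longrightarrow>
      represents (cycles C \<delta> n) \<Z> \<zeta> (cycles C' \<delta>' n) \<Z>' \<zeta>' (f n)
        (mmul (bars (\<C>' n)) (minv (bars (\<C>' n)) T') (mmul (bars (\<C> n)) (X n) T)) \<and>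
      represents (homology C \<delta> n) \<H> \<eta> (homology C' \<delta>' n) \<H>' \<eta>'
        (homology_map C' \<delta>' n (f n))
        (mmul (bars (\<C>' n)) S'
          (mmul (bars (\<C>' n)) (minv (bars (\<C>' n)) T')
            (mmul (bars (\<C> n)) (X n)
              (mmul (bars (\<C> n)) T (minv (bars (\<C> n)) S)))))"
    by (intro allI impI conjI; elim conjE; rule result; assumption)
qed

end
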